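(* Let $w\in W_B^n$, $m\ge2$, and let $\boldsymbol A=(s_1\boldsymbol a_1)(s_2\boldsymbol a_2)\cdots(s_m\boldsymbol a_m)\in U_m^\pm(w)$. The odd Kashiwara operator $\tilde f_{\bar1}^F$ acts on $\boldsymbol A$ as follows; if $\tilde f_{\bar1}^F\boldsymbol A\neq\mathbf0$, it changes only the first two factors. (1) If the concatenation $\boldsymbol a_1\boldsymbol a_2$ is not unimodal: let $\boldsymbol a_1'$ be $\boldsymbol a_1$ with its last letter removed and $\boldsymbol a_2'$ the word obtained by prepending that letter to $\boldsymbol a_2$. If $\boldsymbol a_2'$ is unimodal, then $\tilde f_{\bar1}^F\boldsymbol A=(s_1\boldsymbol a_1')(s_2\boldsymbol a_2')(s_3\boldsymbol a_3)\cdots$; otherwise $\tilde f_{\bar1}^F\boldsymbol A=\mathbf0$. (2) If $\boldsymbol a_1\boldsymbol a_2$ is unimodal: if $\boldsymbol a_2\ne\emptyset$ and $s_2=-$, then $\tilde f_{\bar1}^F\boldsymbol A=\mathbf0$. Otherwise $\tilde f_{\bar1}^F\boldsymbol A=(s_1'\boldsymbol a_1')(s_2'\boldsymbol a_2')(s_3\boldsymbol a_3)\cdots$ with $\boldsymbol a_1',\boldsymbol a_2'$ as in (1) and $(s_1',s_2')=(0,s_1)$ if $|\boldsymbol a_1|=1$, $(s_1',s_2')=(s_1,-)$ if $|\boldsymbol a_1|\ge2$.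
   Context: Type $B$: $W_B^n$ is generated by $s_0,\dots,s_{n-1}$ (signed permutations, $s_0$ changes the sign of the first entry, $s_i$ swaps positions $i,i+1$); a word $a_1\cdots a_l$ over $\{0,\dots,n-1\}$ is a reduced word of $w$ if $w=s_{a_1}\cdots s_{a_l}$ with $l$ minimal. A word $a_1\cdots a_l$ is unimodal if $a_1>\dots>a_k<a_{k+1}<\dots<a_l$ for some $k$ ($a_1\cdots a_k$ is its decreasing part $R_\downarrow$, the rest its increasing part $R_\uparrow$); the empty word is unimodal. A signed unimodal factorization with $m$ factors of a reduced word $\boldsymbol a$ of $w$ is $\boldsymbol A=(s_1\boldsymbol a_1)\cdots(s_m\boldsymbol a_m)$ with $\boldsymbol a_1\cdots\boldsymbol a_m=\boldsymbol a$, each $\boldsymbol a_i$ unimodal (possibly empty), and $s_i=0$ if $\boldsymbol a_i$ is empty, $s_i\in\{+,-\}$ otherwise; $U_m^\pm(w)$ is the set of all these; $|\boldsymbol a|$ is the number of letters. Shifted diagram $S(\lambda)=\{(i,j):1\le i\le l(\lambda),\ i\le j\le\lambda_i+i-1\}$ for a strict partition $\lambda$ (row $i$, column $j$, row 1 on top; main diagonal $\{(i,i)\}$). A standard decomposition tableau of $w$ of shape $\lambda$ is a filling of $S(\lambda)$ whose rows $P_i$ satisfy: $P_lP_{l-1}\cdots P_1$ is a reduced word of $w$ and $P_i$ is a unimodal subword of maximum length of $P_{i+1}P_i$. Kra\'skiewicz insertion of a letter $a$: let $R$ be the first row. If $Ra$ is unimodal, append $a$ to $R$ and stop. Otherwise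 let $b$ be the smallest element of $R_\uparrow$ with $b\ge a$. If $a=0$ and $R$ contains $101$ as a subsequence, leave $R$ unchanged and insert $0$ into the next row. Otherwise: if $b\ne a$, put $a$ in $b$'s position, $c=b$; if $b=a$, leave $R_\uparrow$, $c=a+1$. Let $d$ be the largest element of $R_\downarrow$ with $d\le c$; if $d\ne c$ put $c$ in $d$'s place, $a'=d$; if $d=c$ leave $R_\downarrow$, $a'=c-1$. Insert $a'$ into the next row likewise. A signed primed tableau of shape $\lambda$ is a filling of $S(\lambda)$ with letters $1'<1<2'<\dots<m'<m$, weakly increasing along rows and columns, with at most one $i'$ per row and one $i$ per column for each $i$. Primed Kra\'skiewicz insertion $\mathrm{KR}'(\boldsymbol A)=(P,T)$: from $(\emptyset,\emptyset)$, for $i=1,\dots,m$ insert the letters of $\boldsymbol a_i$ left to right into $P$ by Kra\'skiewicz insertion; let $(x_1,y_1),\dots,(x_r,y_r)$ be the new boxes (row, column) in order of creation; there is $k$ with $x_1<\dots<x_k\ge\dots\ge x_r$ and $y_1\ge\dots\ge y_k<\dots<y_r$; add to $T$ boxes $(x_1,y_1),\dots,(x_{k-1},y_{k-1})$ filled with $i'$, $(x_{k+1},y_{k+1}),\dots,(x_r,y_r)$ filled with $i$, and $(x_k,y_k)$ filled with $i'$ if $s_i=-$, $i$ if $s_i=+$. $\mathrm{KR}'$ is a bijection from $U_m^\pm(w)$ onto pairs (standard decomposition tableau of $w$, signed primed tableau) of the same shape. Odd operator: $\tilde f_{\bar1}^F=\mathrm{KR}'^{-1}\circ(\mathrm{Id},\tilde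 f_{\bar1}^{\pm P})\circ\mathrm{KR}'$, where $\tilde f_{\bar1}^{\pm P}T=\mathrm{PR}\circ\tilde f_{\bar1}^P\circ\mathrm{DPR}(T)$ with $\mathrm{DPR}$ removing primes on the main diagonal and $\mathrm{PR}$ restoring them at the same diagonal positions, and $\tilde f_{\bar1}^PT=P_{HM}(\tilde f_{\bar1}\mathrm{HM}^{-1}(T,Q_\lambda))$ for any fixed standard shifted Young tableau $Q_\lambda$ of shape $\lambda$ (independent of $Q_\lambda$; $\mathbf0$ maps to $\mathbf 0$). Here $\mathrm{HM}$ is semistandard shifted mixed insertion of a word over $\{1,\dots,m\}$: insert $x$ into the first row bumping the leftmost entry strictly greater than $x$ (or append $x$ and stop); a bumped off-diagonal unprimed entry is inserted into the next row in the same way, a bumped off-diagonal primed entry is inserted into the next column to the right bumping the topmost entry strictly greater (or appended at the bottom), a bumped diagonal entry $a$ becomes $a'$ and is inserted into the column to the right; the recording tableau stores the step number in the new box; $\mathrm{HM}(\boldsymbol b)=(P_{HM}(\boldsymbol b),Q)$ is a bijection onto pairs (primed tableau, standard shifted tableau) of equal shape, where a primed tableau is a signed primed tableau with no primes on the main diagonal. On words, $\tilde f_{\bar1}$ changes the leftmost $1$ to $2$ if no $2$ precedes it, and is $\mathbf0$ if there is no $1$ or a $2$ precedes the leftmost $1$.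
   Formalization: In case (2) the "otherwise" formula is undefined when a_1 is empty (there is no last letter to move, and |a_1| is neither 1 nor at least 2); the formal statement gives the operator the value 0 there. *)

theory Defs
  imports "HOL-Combinatorics.Permutations" "HOL-Library.Sublist"
begin

section \<open>Signed permutations and reduced words\<close>

text \<open>A signed permutation is an odd bijection of the nonzero integers of absolute value at most
  \<open>n\<close>, extended by the identity; its one-line notation is \<open>w 1, \<dots>, w n\<close>. Multiplication is
  composition, so right multiplication by a generator acts on the positions of the one-line
  notation.\<close>

definition signed_perms :: "nat \<Rightarrow> (int \<Rightarrow> int) set" where
  "signed_perms n =
     {w. w permutes {i. i \<noteq> 0 \<and> \<bar>i\<bar> \<le> int n} \<and> (\<forall>i. w (- i) = - w i)}"

definition gen_B :: "nat \<Rightarrow> int \<Rightarrow> int" where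
  "gen_B i =
     (if i = 0 then Transposition.transpose 1 (- 1)
      else Transposition.transpose (int i) (int i + 1)
           \<circ> Transposition.transpose (- int i) (- (int i + 1)))"

definition word_prod :: "nat list \<Rightarrow> int \<Rightarrow> int" where
  "word_prod a = foldr (\<lambda>i u. gen_B i \<circ> u) a id"

definition reduced_word :: "nat \<Rightarrow> (int \<Rightarrow> int) \<Rightarrow> nat list \<Rightarrow> bool" where
  "reduced_word n w a \<longleftrightarrow>
     a \<in> lists {0..<n} \<and> word_prod a = w \<and>
     (\<forall>b \<in> lists {0..<n}. word_prod b = w \<longrightarrow> length a \<le> length b)"


section \<open>Signed unimodal factorizations\<close>

definition unimodal :: "nat list \<Rightarrow> bool" where
  "unimodal a \<longleftrightarrow>
     a = [] \<or> (\<exists>k < length a. sorted_wrt (>) (take (Suc k) a) \<and> sorted_wrt (<) (drop k a))"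

text \<open>On unimodal words the longest strictly decreasing prefix is the decreasing part; it includes
  the minimal letter.\<close>

fun dec_part :: "nat list \<Rightarrow> nat list" where
  "dec_part [] = []"
| "dec_part [x] = [x]"
| "dec_part (x # y # ys) = (if x > y then x # dec_part (y # ys) else [x])"

definition inc_part :: "nat list \<Rightarrow> nat list" where
  "inc_part a = drop (length (dec_part a)) a"

datatype sign = SZero | SPlus | SMinus

type_synonym factorization = "(sign \<times> nat list) list"

definition signed_unimodal_facts :: "nat \<Rightarrow> nat \<Rightarrow> (int \<Rightarrow> int) \<Rightarrow> factorization set" where
  "signed_unimodal_facts n m w =
     {A. length A = m \<and> reduced_word n w (concat (map snd A)) \<and>
         (\<forall>(s, a) \<in> set A. unimodal a \<and> (s = SZero \<longleftrightarrow> a = []))}"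


section \<open>Shifted tableaux\<close>

text \<open>Boxes are pairs (row, column), both counted from 1.\<close>

type_synonym box = "nat \<times> nat"

definition strict_partition :: "nat list \<Rightarrow> bool" where
  "strict_partition lam \<longleftrightarrow> sorted_wrt (>) lam \<and> 0 \<notin> set lam"

definition shifted_diagram :: "nat list \<Rightarrow> box set" where
  "shifted_diagram lam =
     {(i, j). 1 \<le> i \<and> i \<le> length lam \<and> i \<le> j \<and> j \<le> lam ! (i - 1) + i - 1}"

definition standard_shifted_tableau :: "nat list \<Rightarrow> (box \<rightharpoonup> nat) \<Rightarrow> bool" where
  "standard_shifted_tableau lam Q \<longleftrightarrow>
     dom Q = shifted_diagram lam \<and>
     bij_betw (\<lambda>b. the (Q b)) (shifted_diagram lam) {1..sum_list lam} \<and>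
     (\<forall>i j x y. Q (i, j) = Some x \<and> Q (i, j + 1) = Some y \<longrightarrow> x < y) \<and>
     (\<forall>i j x y. Q (i, j) = Some x \<and> Q (i + 1, j) = Some y \<longrightarrow> x < y)"

text \<open>\<open>Primed i\<close> is the letter \<open>i'\<close> and \<open>Plain i\<close> is the letter \<open>i\<close>.\<close>

datatype letter = Primed (val: nat) | Plain (val: nat)

instantiation letter :: linorder
begin

definition less_letter :: "letter \<Rightarrow> letter \<Rightarrow> bool" where
  "x < y \<longleftrightarrow> val x < val y \<or> x = Primed (val y) \<and> y = Plain (val y)"

definition less_eq_letter :: "letter \<Rightarrow> letter \<Rightarrow> bool" where
  "x \<le> y \<longleftrightarrow> x < y \<or> x = (y :: letter)"

instance
proof
  fix x y z :: letter
  show "x < y \<longleftrightarrow> x \<le> y \<and> \<not> y \<le> x"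
    by (cases x; cases y) (auto simp: less_letter_def less_eq_letter_def)
  show "x \<le> x"
    by (simp add: less_eq_letter_def)
  show "x \<le> y \<Longrightarrow> y \<le> z \<Longrightarrow> x \<le> z"
    by (cases x; cases y; cases z) (auto simp: less_letter_def less_eq_letter_def)
  show "x \<le> y \<Longrightarrow> y \<le> x \<Longrightarrow> x = y"
    by (cases x; cases y) (auto simp: less_letter_def less_eq_letter_def)
  show "x \<le> y \<or> y \<le> x"
    by (cases x; cases y) (auto simp: less_letter_def less_eq_letter_def)
qed

end

type_synonym ptab = "box \<rightharpoonup> letter"

definition shape_of :: "ptab \<Rightarrow> nat list" where
  "shape_of T = (THE lam. strict_partition lam \<and> dom T = shifted_diagram lam)"


section \<open>Primed Kraskiewicz insertion\<close>

text \<open>The bumping step on a row \<open>R\<close>, for \<open>R @ [a]\<close> not unimodal: the new row and the letter to be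
  inserted into the next row. The minimum and the maximum exist whenever the insertion is applied
  along a reduced word.\<close>

definition kr_bump :: "nat \<Rightarrow> nat list \<Rightarrow> nat list \<times> nat" where
  "kr_bump a R =
     (if a = 0 \<and> subseq [1, 0, 1] R then (R, 0)
      else
        let D = dec_part R; I = inc_part R;
            b = Min {x \<in> set I. a \<le> x};
            (I', c) = (if b \<noteq> a then (map (\<lambda>x. if x = b then a else x) I, b) else (I, a + 1));
            d = Max {x \<in> set D. x \<le> c}
        in if d \<noteq> c then (map (\<lambda>x. if x = d then c else x) D @ I', d) else (D @ I', c - 1))"

text \<open>Insertion of \<open>a\<close> into the rows \<open>i, i + 1, \<dots>\<close> of a tableau given by its list of rows; the
  second component is the new box.\<close>

fun kr_insert :: "nat \<Rightarrow> nat \<Rightarrow> nat list list \<Rightarrow> nat list list \<times> box" where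
  "kr_insert i a [] = ([[a]], (i, i))"
| "kr_insert i a (R # P) =
     (if unimodal (R @ [a]) then ((R @ [a]) # P, (i, i + length R))
      else let (R', a') = kr_bump a R; (P', bx) = kr_insert (i + 1) a' P in (R' # P', bx))"

fun kr_insert_word :: "nat list \<Rightarrow> nat list list \<Rightarrow> nat list list \<times> box list" where
  "kr_insert_word [] P = (P, [])"
| "kr_insert_word (a # as) P =
     (let (P', bx) = kr_insert 1 a P; (P'', bxs) = kr_insert_word as P' in (P'', bx # bxs))"

text \<open>The turning index \<open>k\<close>, counted from 0.\<close>

definition turn_index :: "box list \<Rightarrow> nat" where
  "turn_index bxs =
     (THE k. k < length bxs \<and>
        sorted_wrt (<) (map fst (take (Suc k) bxs)) \<and> sorted_wrt (\<ge>) (map fst (drop k bxs)) \<and>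
        sorted_wrt (\<ge>) (map snd (take (Suc k) bxs)) \<and> sorted_wrt (<) (map snd (drop k bxs)))"

definition rec_labels :: "nat \<Rightarrow> sign \<Rightarrow> box list \<Rightarrow> letter list" where
  "rec_labels i s bxs =
     map (\<lambda>j. if j < turn_index bxs \<or> j = turn_index bxs \<and> s = SMinus then Primed i else Plain i)
       [0..<length bxs]"

definition KR_step :: "nat list list \<times> ptab \<Rightarrow> nat \<times> sign \<times> nat list \<Rightarrow> nat list list \<times> ptab" where
  "KR_step = (\<lambda>(P, T) (i, s, a).
     let (P', bxs) = kr_insert_word a P in (P', T(bxs [\<mapsto>] rec_labels i s bxs)))"

definition KR :: "factorization \<Rightarrow> nat list list \<times> ptab" where
  "KR A = foldl KR_step ([], Map.empty) (enumerate 1 A)"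


section \<open>Semistandard shifted mixed insertion\<close>

datatype line = Row nat | Col nat

text \<open>The box where \<open>x\<close> is placed: the first box of the line that is empty or has an entry greater
  than \<open>x\<close>.\<close>

fun hm_box :: "line \<Rightarrow> letter \<Rightarrow> ptab \<Rightarrow> box" where
  "hm_box (Row i) x T = (i, LEAST j. i \<le> j \<and> (\<forall>y. T (i, j) = Some y \<longrightarrow> x < y))"
| "hm_box (Col j) x T = (LEAST i. 1 \<le> i \<and> (\<forall>y. T (i, j) = Some y \<longrightarrow> x < y), j)"

partial_function (tailrec) hm_insert :: "line \<Rightarrow> letter \<Rightarrow> ptab \<Rightarrow> ptab \<times> box" where
  "hm_insert l x T =
     (let b = hm_box l x T; T' = T(b \<mapsto> x)
      in case T b of
           None \<Rightarrow> (T', b)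
         | Some y \<Rightarrow>
             if fst b = snd b then hm_insert (Col (snd b + 1)) (Primed (val y)) T'
             else if y = Primed (val y) then hm_insert (Col (snd b + 1)) y T'
             else hm_insert (Row (fst b + 1)) y T')"

definition HM_step :: "ptab \<times> (box \<rightharpoonup> nat) \<Rightarrow> nat \<times> nat \<Rightarrow> ptab \<times> (box \<rightharpoonup> nat)" where
  "HM_step = (\<lambda>(P, Q) (k, x). let (P', bx) = hm_insert (Row 1) (Plain x) P in (P', Q(bx \<mapsto> k)))"

definition HM :: "nat list \<Rightarrow> ptab \<times> (box \<rightharpoonup> nat)" where
  "HM b = foldl HM_step (Map.empty, Map.empty) (enumerate 1 b)"


section \<open>Odd Kashiwara operators\<close>

text \<open>The value \<open>None\<close> stands for \<open>\<zero>\<close>.\<close>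

definition odd_f_word :: "nat list \<Rightarrow> nat list option" where
  "odd_f_word b =
     (let u = takeWhile (\<lambda>x. x \<noteq> 1) b
      in if 1 \<notin> set b \<or> 2 \<in> set u then None else Some (b[length u := 2]))"

text \<open>The operators on tableaux and on factorizations depend formally on a choice \<open>Q\<close> of a standard shifted tableau for
  every shape.\<close>

definition odd_f_P :: "(nat list \<Rightarrow> box \<rightharpoonup> nat) \<Rightarrow> nat \<Rightarrow> ptab \<Rightarrow> ptab option" where
  "odd_f_P Q m T =
     map_option (\<lambda>b. fst (HM b)) (odd_f_word (inv_into (lists {1..m}) HM (T, Q (shape_of T))))"

definition DPR :: "ptab \<Rightarrow> ptab" where
  "DPR T = (\<lambda>(i, j). if i = j then map_option (\<lambda>x. Plain (val x)) (T (i, j)) else T (i, j))"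

definition primed_diag :: "ptab \<Rightarrow> nat set" where
  "primed_diag T = {i. \<exists>k. T (i, i) = Some (Primed k)}"

definition PR :: "nat set \<Rightarrow> ptab \<Rightarrow> ptab" where
  "PR D T =
     (\<lambda>(i, j). if i = j \<and> i \<in> D then map_option (\<lambda>x. Primed (val x)) (T (i, j)) else T (i, j))"

definition odd_f_sP :: "(nat list \<Rightarrow> box \<rightharpoonup> nat) \<Rightarrow> nat \<Rightarrow> ptab \<Rightarrow> ptab option" where
  "odd_f_sP Q m T = map_option (PR (primed_diag T)) (odd_f_P Q m (DPR T))"

definition odd_f_F ::
  "(nat list \<Rightarrow> box \<rightharpoonup> nat) \<Rightarrow> nat \<Rightarrow> nat \<Rightarrow> (int \<Rightarrow> int) \<Rightarrow> factorization \<Rightarrow> factorization option" where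
  "odd_f_F Q n m w A =
     (let (P, T) = KR A
      in map_option (\<lambda>T'. inv_into (signed_unimodal_facts n m w) KR (P, T')) (odd_f_sP Q m T))"

end

theory Submission
  imports Defs
begin

text \<open>
  Only the first row of the recording tableau matters. On a primed tableau \<open>T\<close> the odd operator is \<open>\<zero>\<close> if there
  is no \<open>1\<close> or if \<open>2'\<close> occurs in the first row, and otherwise turns the last \<open>1\<close> of the first row into \<open>2'\<close> (into
  \<open>2\<close> if it sits on the diagonal): changing the leftmost \<open>1\<close> of a word to \<open>2\<close> makes two mixed insertions run in
  parallel. The first factor fills boxes of the first row, and the box labelled by the last \<open>1\<close> is the one created
  by the last letter of \<open>a1\<close>, so changing its label amounts to moving that letter to the second factor.

  This needs that the recording tableau is semistandard and determines the factorization. Bumping a row is an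
  involution up to reversal, which gives injectivity. A bumped row \<open>R a \<mapsto> a' R'\<close> is reached by moves that do not
  lengthen the longest unimodal subwords, which gives strictness of the shape; and a step to the right followed by
  a step down in the box sequence forces a peak in the inserted word, which gives the turning index.
\<close>

section \<open>Unimodal words and plactic moves\<close>

text \<open>Both insertions enter the operator through \<open>inv_into\<close>, and this dictates
  what must be known about them. For mixed insertion it is surjectivity: the chosen word is then a
  genuine preimage, and the effect of the odd operator is read off from its insertion tableau alone,
  so that the choice of \<open>Q\<close> drops out. For \<open>KR\<close> it is injectivity: the
  factorization with the letter moved is exhibited together with its image, and injectivity
  identifies it as the chosen preimage. Inverting the row step meets two obstacles. The minimum of a
  unimodal row may be counted in either half, and a step can turn one reading into the other; hence
  the step is described by a relation with a free cut. And when \<open>0\<close> meets a row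
  containing \<open>1 0 1\<close>, the row stays as it is: this case rests on the four-letter braid
  relation between \<open>0\<close> and \<open>1\<close>, is kept apart from the relation, and must
  not collide with an ordinary step. Reducedness does more than forbid equal neighbours: it supplies
  the letters \<open>a + 1\<close> and \<open>c - 1\<close> that the special bumping rules
  presuppose.\<close>

abbreviation inc :: "nat list \<Rightarrow> bool" where "inc \<equiv> sorted_wrt (<)"
abbreviation dcr :: "nat list \<Rightarrow> bool" where "dcr \<equiv> sorted_wrt (>)"

lemma inc_Cons: "inc (x # w) \<longleftrightarrow> w = [] \<or> x < hd w \<and> inc w"
  by (cases w) auto

lemma dcr_Cons: "dcr (x # w) \<longleftrightarrow> w = [] \<or> hd w < x \<and> dcr w"
  by (cases w) auto

declare sorted_wrt.simps(2) [simp del]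

lemma inc_singleton [simp]: "inc [x]"
  by (simp add: inc_Cons)

lemma dcr_singleton [simp]: "dcr [x]"
  by (simp add: dcr_Cons)

lemma dcr_snoc: "dcr (w @ [x]) \<longleftrightarrow> w = [] \<or> x < last w \<and> dcr w"
  by (induction w) (auto simp: dcr_Cons hd_append)

lemma inc_append: "inc (u @ v) \<longleftrightarrow> inc u \<and> inc v \<and> (u = [] \<or> v = [] \<or> last u < hd v)"
  by (induction u) (auto simp: inc_Cons hd_append)

lemma unimodal_Nil [simp]: "unimodal []"
  by (simp add: unimodal_def)

text \<open>In \<open>unimodal_def\<close> the two sorted pieces share the minimal letter at index
  \<open>k\<close>. Pivot \<open>0\<close> makes the word increasing; any other pivot is a pivot of
  the tail, shifted by one.\<close>

lemma unimodal_Cons: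
  "unimodal (x # w) \<longleftrightarrow> w = [] \<or> hd w < x \<and> unimodal w \<or> x < hd w \<and> inc w"
proof -
  have "unimodal (x # w) \<longleftrightarrow> inc (x # w) \<or>
      (\<exists>k < length w. dcr (x # take (Suc k) w) \<and> inc (drop k w))"
    unfolding unimodal_def
    by (auto simp: less_Suc_eq_0_disj dcr_Cons)
  also have "\<dots> \<longleftrightarrow> w = [] \<or> hd w < x \<and> unimodal w \<or> x < hd w \<and> inc w"
    by (cases w) (auto simp: unimodal_def dcr_Cons inc_Cons)
  finally show ?thesis .
qed

lemma inc_imp_unimodal: "inc w \<Longrightarrow> unimodal w"
  by (cases w) (auto simp: unimodal_Cons inc_Cons)

lemma dcr_imp_unimodal: "dcr w \<Longrightarrow> unimodal w"
  by (induction w) (auto simp: unimodal_Cons dcr_Cons)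

text \<open>The comparison at the joint decides: a fall into \<open>z\<close> forces all of
  \<open>u\<close> to fall, a rise forces the rest to rise. The exchange arguments for subwords rest
  on this equivalence.\<close>

lemma unimodal_append_Cons:
  "unimodal (u @ z # w) \<longleftrightarrow>
     dcr u \<and> (u = [] \<or> z < last u) \<and> unimodal (z # w) \<or>
     unimodal u \<and> u \<noteq> [] \<and> last u < z \<and> inc (z # w)"
proof (induction u)
  case (Cons x u)
  show ?case
  proof (cases "u = []")
    case False
    then show ?thesis
      using Cons.IH by (auto simp: unimodal_Cons[of x] inc_append dcr_Cons[of x] hd_append intro: inc_imp_unimodal dcr_imp_unimodal)
  qed (auto simp: unimodal_Cons[of x] inc_Cons[of z])
qed simp

lemma unimodal_snoc:
  "unimodal (u @ [z]) \<longleftrightarrow> u = [] \<or> last u < z \<and> unimodal u \<or> z < last u \<and> dcr u"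
  by (auto simp: unimodal_append_Cons unimodal_Cons)

lemma unimodal_append_left: "unimodal (u @ v) \<Longrightarrow> unimodal u"
  by (cases v) (auto simp: unimodal_append_Cons intro: dcr_imp_unimodal)

lemma unimodal_append_right: "unimodal (u @ v) \<Longrightarrow> unimodal v"
  by (cases v) (auto simp: unimodal_append_Cons intro: inc_imp_unimodal)

lemma unimodal_split:
  assumes "dcr d" "inc i" "d = [] \<or> i = [] \<or> last d \<noteq> hd i"
  shows "unimodal (d @ i)"
proof (cases "d = [] \<or> i = []")
  case True
  then show ?thesis
    using assms inc_imp_unimodal[of i] dcr_imp_unimodal[of d] by auto
next
  case False
  then obtain z w where "i = z # w" "last d < z \<or> z < last d"
    using assms(3) by (cases i) (auto simp: neq_iff)
  then show ?thesis
    using assms False inc_imp_unimodal[of i] dcr_imp_unimodal[of d] by (metis unimodal_append_Cons)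
qed

text \<open>Reversal swaps the two halves; this is what lets the bumping step be inverted by reading
  it backwards.\<close>

lemma unimodal_rev: "unimodal (rev w) \<longleftrightarrow> unimodal w"
proof (induction w)
  case (Cons x w)
  have "inc (rev w) \<longleftrightarrow> dcr w" "dcr (rev w) \<longleftrightarrow> inc w"
    by (simp_all add: sorted_wrt_rev)
  then show ?case
    using Cons by (auto simp: unimodal_snoc unimodal_Cons last_rev)
qed simp

lemma dec_part_inc_part: "dec_part w @ inc_part w = w"
proof -
  have "dec_part w = take (length (dec_part w)) w"
    by (induction w rule: dec_part.induct) auto
  then show ?thesis
    by (metis append_take_drop_id inc_part_def)
qed

lemma dec_part_eq_Nil [simp]: "dec_part w = [] \<longleftrightarrow> w = []"
  by (induction w rule: dec_part.induct) auto

lemma hd_dec_part: "w \<noteq> [] \<Longrightarrow> hd (dec_part w) = hd w"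
  by (induction w rule: dec_part.induct) auto

lemma dcr_dec_part: "dcr (dec_part w)"
  by (induction w rule: dec_part.induct) (auto simp: dcr_Cons hd_dec_part)

lemma inc_part_inc: "unimodal w \<Longrightarrow> inc (inc_part w) \<and> (inc_part w \<noteq> [] \<longrightarrow> last (dec_part w) < hd (inc_part w))"
  by (induction w rule: dec_part.induct) (auto simp: unimodal_Cons inc_part_def inc_Cons)

text \<open>Only one direction of the plactic invariance is needed: the moves are applied from left to right, and
  the longest unimodal subwords must not become longer.\<close>

definition ck :: "nat list \<Rightarrow> nat list \<Rightarrow> bool" where
  "ck x y \<longleftrightarrow> word_prod x = word_prod y \<and> length x = length y \<and> set y \<subseteq> set x \<and>
     (\<forall>u v V. subseq V (u @ y @ v) \<and> unimodal V \<longrightarrow>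
        (\<exists>V'. subseq V' (u @ x @ v) \<and> unimodal V' \<and> length V' = length V))"

lemma word_prod_Nil [simp]: "word_prod [] = id"
  by (simp add: word_prod_def)

lemma word_prod_Cons [simp]: "word_prod (a # w) = gen_B a \<circ> word_prod w"
  by (simp add: word_prod_def)

lemma word_prod_append [simp]: "word_prod (u @ v) = word_prod u \<circ> word_prod v"
  by (induction u) (auto simp: comp_assoc)

lemma ck_refl [simp]: "ck x x"
  by (auto simp: ck_def)

lemma ck_trans [trans]:
  assumes "ck x y" "ck y z" shows "ck x z"
  unfolding ck_def
proof (intro conjI allI impI)
  fix u v V assume V: "subseq V (u @ z @ v) \<and> unimodal V"
  obtain V1 where "subseq V1 (u @ y @ v)" "unimodal V1" "length V1 = length V"
    using assms(2) V unfolding ck_def by blast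
  then show "\<exists>V'. subseq V' (u @ x @ v) \<and> unimodal V' \<and> length V' = length V"
    using assms(1) unfolding ck_def by metis
qed (use assms in \<open>auto simp: ck_def\<close>)

lemma ck_context: "ck x y \<Longrightarrow> ck (u @ x @ v) (u @ y @ v)"
  unfolding ck_def
proof (elim conjE, intro conjI allI impI)
  fix u' v' V
  assume "\<forall>u v V. subseq V (u @ y @ v) \<and> unimodal V \<longrightarrow>
      (\<exists>V'. subseq V' (u @ x @ v) \<and> unimodal V' \<and> length V' = length V)"
    and "subseq V (u' @ (u @ y @ v) @ v') \<and> unimodal V"
  then show "\<exists>V'. subseq V' (u' @ (u @ x @ v) @ v') \<and> unimodal V' \<and> length V' = length V"
    by (metis append_assoc)
qed auto

text \<open>The set \<open>B\<close> collects the subwords of \<open>y\<close> that are not visibly subwords of \<open>x\<close>.\<close>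

lemma ckI:
  assumes "word_prod x = word_prod y" "length x = length y" "set y \<subseteq> set x"
    and sub: "\<forall>Y\<in>set (subseqs y). Y \<in> set (subseqs x) \<or> Y \<in> B"
    and B: "\<And>Y U W. Y \<in> B \<Longrightarrow> unimodal (U @ Y @ W) \<Longrightarrow>
      \<exists>Y'\<in>set (subseqs x). length Y' = length Y \<and> unimodal (U @ Y' @ W)"
  shows "ck x y"
  unfolding ck_def
proof (intro conjI allI impI)
  fix u v V assume "subseq V (u @ y @ v) \<and> unimodal V"
  then obtain U Y W where V: "V = U @ Y @ W" "subseq U u" "subseq Y y" "subseq W v" "unimodal V"
    by (auto elim!: subseq_appendE)
  have "Y \<in> set (subseqs x) \<or> Y \<in> B"
    using sub V(3) by simp
  then obtain Y' where "subseq Y' x" "length Y' = length Y" "unimodal (U @ Y' @ W)"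
    using B[of Y U W] V by auto
  with V show "\<exists>V'. subseq V' (u @ x @ v) \<and> unimodal V' \<and> length V' = length V"
    by (intro exI[of _ "U @ Y' @ W"]) (auto intro!: list_emb_append_mono)
qed (use assms in auto)

section \<open>Coxeter relations of type B\<close>

lemma gen_B_0: "gen_B 0 x = (if x = 1 then - 1 else if x = - 1 then 1 else x)"
  by (simp add: gen_B_def Transposition.transpose_def)

lemma gen_B_pos:
  assumes "0 < a"
  shows "gen_B a x = (if x = int a then int a + 1 else if x = int a + 1 then int a
    else if x = - int a then - int a - 1 else if x = - int a - 1 then - int a else x)"
proof -
  consider "x = int a" | "x = int a + 1" | "x = - int a" | "x = - int a - 1"
    | "x \<noteq> int a" "x \<noteq> int a + 1" "x \<noteq> - int a" "x \<noteq> - int a - 1"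
    by blast
  then show ?thesis
    by cases (use assms in \<open>simp_all add: gen_B_def Transposition.transpose_def\<close>)
qed

lemma gen_B_invol [simp]: "gen_B a \<circ> gen_B a = id"
  by (cases "a = 0") (auto simp: gen_B_0 gen_B_pos fun_eq_iff)

lemma gen_B_fix: "\<bar>x\<bar> \<noteq> int a \<Longrightarrow> \<bar>x\<bar> \<noteq> int a + 1 \<Longrightarrow> gen_B a x = x"
  by (cases "a = 0") (auto simp: gen_B_0 gen_B_pos)

lemma gen_B_abs:
  "\<bar>x\<bar> = int a \<or> \<bar>x\<bar> = int a + 1 \<Longrightarrow> \<bar>gen_B a x\<bar> = int a \<or> \<bar>gen_B a x\<bar> = int a + 1"
  by (cases "a = 0") (auto simp: gen_B_0 gen_B_pos)

text \<open>A generator \<open>gen_B a\<close> can move only entries of absolute value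
  \<open>a\<close> or \<open>a + 1\<close>, and it preserves this set; for letters at distance at
  least two these sets are disjoint.\<close>

lemma gen_B_commute: "gen_B a \<circ> gen_B b = gen_B b \<circ> gen_B a" if "a + 1 < b \<or> b + 1 < a"
proof (rule ext)
  fix x :: int
  consider "\<bar>x\<bar> = int a \<or> \<bar>x\<bar> = int a + 1" | "\<bar>x\<bar> = int b \<or> \<bar>x\<bar> = int b + 1"
    | "\<bar>x\<bar> \<noteq> int a" "\<bar>x\<bar> \<noteq> int a + 1" "\<bar>x\<bar> \<noteq> int b" "\<bar>x\<bar> \<noteq> int b + 1"
    by blast
  then have "gen_B a (gen_B b x) = gen_B b (gen_B a x)"
  proof cases
    case 1
    have "gen_B b x = x" "gen_B b (gen_B a x) = gen_B a x"
      using that 1 gen_B_abs[OF 1] by (auto intro!: gen_B_fix)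
    then show ?thesis by simp
  next
    case 2
    have "gen_B a x = x" "gen_B a (gen_B b x) = gen_B b x"
      using that 2 gen_B_abs[OF 2] by (auto intro!: gen_B_fix)
    then show ?thesis by simp
  qed (simp add: gen_B_fix)
  then show "(gen_B a \<circ> gen_B b) x = (gen_B b \<circ> gen_B a) x"
    by simp
qed

text \<open>Positivity matters: between \<open>0\<close> and \<open>1\<close> the relation has four
  letters on each side, as in \<open>gen_B_braid4\<close>.\<close>

lemma gen_B_braid:
  assumes "0 < a"
  shows "gen_B a \<circ> (gen_B (Suc a) \<circ> gen_B a) = gen_B (Suc a) \<circ> (gen_B a \<circ> gen_B (Suc a))"
proof (rule ext)
  fix x :: int
  consider "\<bar>x\<bar> = int a" | "\<bar>x\<bar> = int a + 1" | "\<bar>x\<bar> = int a + 2"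
    | "\<bar>x\<bar> \<noteq> int a" "\<bar>x\<bar> \<noteq> int a + 1" "\<bar>x\<bar> \<noteq> int a + 2"
    by blast
  then have "gen_B a (gen_B (Suc a) (gen_B a x)) = gen_B (Suc a) (gen_B a (gen_B (Suc a) x))"
  proof cases
    case 1
    then have "x = int a \<or> x = - int a" by arith
    then show ?thesis using assms by (elim disjE) (simp_all add: gen_B_pos)
  next
    case 2
    then have "x = int a + 1 \<or> x = - int a - 1" by arith
    then show ?thesis using assms by (elim disjE) (simp_all add: gen_B_pos)
  next
    case 3
    then have "x = int a + 2 \<or> x = - int a - 2" by arith
    then show ?thesis using assms by (elim disjE) (simp_all add: gen_B_pos)
  qed (simp add: gen_B_fix)
  then show "(gen_B a \<circ> (gen_B (Suc a) \<circ> gen_B a)) x = (gen_B (Suc a) \<circ> (gen_B a \<circ> gen_B (Suc a))) x"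
    by simp
qed

lemma gen_B_braid4:
  "gen_B 0 \<circ> (gen_B 1 \<circ> (gen_B 0 \<circ> gen_B 1)) = gen_B 1 \<circ> (gen_B 0 \<circ> (gen_B 1 \<circ> gen_B 0))"
  by (intro ext) (simp add: gen_B_0 gen_B_pos)

lemma gen_B_commute': "a + 1 < b \<or> b + 1 < a \<Longrightarrow> gen_B a \<circ> (gen_B b \<circ> f) = gen_B b \<circ> (gen_B a \<circ> f)"
  using arg_cong[OF gen_B_commute, of a b "\<lambda>h. h \<circ> f"] by (simp only: comp_assoc)

lemma gen_B_braid':
  "0 < a \<Longrightarrow> gen_B a \<circ> (gen_B (Suc a) \<circ> (gen_B a \<circ> f)) = gen_B (Suc a) \<circ> (gen_B a \<circ> (gen_B (Suc a) \<circ> f))"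
  using arg_cong[OF gen_B_braid, of a "\<lambda>h. h \<circ> f"] by (simp only: comp_assoc)

section \<open>Elementary moves on three and four letters\<close>

lemmas unimodal_simps = unimodal_append_Cons unimodal_Cons inc_Cons

text \<open>The letters \<open>a\<close> and \<open>c\<close> commute because \<open>b\<close> lies
  strictly between them. A unimodal subword that uses the new rise \<open>a c\<close> keeps its
  final \<open>c\<close> and trades the rest: \<open>a c\<close> for \<open>b c\<close>, or for
  \<open>p c\<close> if the letter before it is \<open>b\<close>; \<open>b a c\<close> and
  \<open>p a c\<close> for \<open>p b c\<close>.\<close>

lemma ck_pbca: assumes "a < b" "b < c" "p < b" shows "ck [p, b, c, a] [p, b, a, c]"
proof (rule ckI)
  show "word_prod [p, b, c, a] = word_prod [p, b, a, c]"
    using assms gen_B_commute[of c a] by simp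
  show "\<forall>Y\<in>set (subseqs [p, b, a, c]). Y \<in> set (subseqs [p, b, c, a]) \<or> Y \<in> {[a,c], [b,a,c], [p,a,c], [p,b,a,c]}"
    by (simp add: Let_def)
  fix Y U W
  assume Y: "Y \<in> {[a,c], [b,a,c], [p,a,c], [p,b,a,c]}" "unimodal (U @ Y @ W)"
  from Y(1) consider "Y = [a,c]" | "Y = [b,a,c]" | "Y = [p,a,c]" | "Y = [p,b,a,c]"
    by blast
  then have "length Y = length [b,c] \<and> unimodal (U @ [b,c] @ W) \<or> length Y = length [p,c] \<and> unimodal (U @ [p,c] @ W) \<or>
      length Y = length [p,b,c] \<and> unimodal (U @ [p,b,c] @ W)"
    by cases (use Y(2) assms in \<open>auto simp: unimodal_simps intro: dcr_imp_unimodal\<close>)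
  moreover have "[b,c] \<in> set (subseqs [p,b,c,a])" "[p,b,c] \<in> set (subseqs [p,b,c,a])" "[p,c] \<in> set (subseqs [p,b,c,a])"
    by simp_all
  ultimately show "\<exists>Y'\<in>set (subseqs [p,b,c,a]). length Y' = length Y \<and> unimodal (U @ Y' @ W)"
    by metis
qed simp_all

text \<open>A unimodal subword using the fall \<open>b q\<close> either rises after
  \<open>q\<close>, and then \<open>p q\<close> replaces it, or does not, and then
  \<open>b r\<close> does; for \<open>b q r\<close> the replacement is \<open>p q r\<close>.\<close>

lemma ck_pqbr: assumes "p < q" "q < r" "r < b" shows "ck [p, q, b, r] [p, b, q, r]"
proof (rule ckI)
  show "word_prod [p, q, b, r] = word_prod [p, b, q, r]"
    using assms gen_B_commute'[of q b "gen_B r"] by simp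
  show "\<forall>Y\<in>set (subseqs [p, b, q, r]). Y \<in> set (subseqs [p, q, b, r]) \<or> Y \<in> {[b,q], [b,q,r], [p,b,q], [p,b,q,r]}"
    by (simp add: Let_def)
  fix Y U W
  assume Y: "Y \<in> {[b,q], [b,q,r], [p,b,q], [p,b,q,r]}" "unimodal (U @ Y @ W)"
  from Y(1) consider "Y = [b,q]" | "Y = [b,q,r]" | "Y = [p,b,q]" | "Y = [p,b,q,r]"
    by blast
  then have "length Y = length [b,r] \<and> unimodal (U @ [b,r] @ W) \<or> length Y = length [p,q] \<and> unimodal (U @ [p,q] @ W) \<or>
      length Y = length [p,q,r] \<and> unimodal (U @ [p,q,r] @ W)"
    by cases (use Y(2) assms in \<open>auto simp: unimodal_simps\<close>)
  moreover have "[b,r] \<in> set (subseqs [p,q,b,r])" "[p,q,r] \<in> set (subseqs [p,q,b,r])" "[p,q] \<in> set (subseqs [p,q,b,r])"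
    by simp_all
  ultimately show "\<exists>Y'\<in>set (subseqs [p,q,b,r]). length Y' = length Y \<and> unimodal (U @ Y' @ W)"
    by metis
qed simp_all

text \<open>Among the new subwords only \<open>a + 1, a, a + 1\<close> can be unimodal. It is
  entered by a fall and left by a rise, so the increasing \<open>p, a, a + 1\<close> can take its
  place.\<close>

lemma ck_braid_right: assumes "p < a" shows "ck [p, a, Suc a, a] [p, Suc a, a, Suc a]"
proof (rule ckI)
  show "word_prod [p, a, Suc a, a] = word_prod [p, Suc a, a, Suc a]"
    using assms gen_B_braid[of a] by simp
  let ?B = "{[Suc a, a, Suc a], [Suc a, Suc a], [p, Suc a, Suc a], [p, Suc a, a], [p, Suc a, a, Suc a]}"
  show "\<forall>Y\<in>set (subseqs [p, Suc a, a, Suc a]). Y \<in> set (subseqs [p, a, Suc a, a]) \<or> Y \<in> ?B"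
    by (simp add: Let_def)
  fix Y U W
  assume Y: "Y \<in> ?B" "unimodal (U @ Y @ W)"
  from Y(1) consider "Y = [Suc a, a, Suc a]" | "Y = [Suc a, Suc a]" | "Y = [p, Suc a, Suc a]"
    | "Y = [p, Suc a, a]" | "Y = [p, Suc a, a, Suc a]"
    by blast
  then have "length Y = length [p,a,Suc a] \<and> unimodal (U @ [p,a,Suc a] @ W)"
    by cases (use Y(2) assms in \<open>auto simp: unimodal_simps\<close>)
  moreover have "[p,a,Suc a] \<in> set (subseqs [p, a, Suc a, a])"
    by simp_all
  ultimately show "\<exists>Y'\<in>set (subseqs [p, a, Suc a, a]). length Y' = length Y \<and> unimodal (U @ Y' @ W)"
    by metis
qed simp_all

text \<open>A unimodal word that uses the fall \<open>c p\<close> comes down to \<open>c\<close>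
  from above, so the smaller \<open>q\<close> can stand in for \<open>c\<close>.\<close>

lemma ck_qpc: assumes "p < q" "q < c" shows "ck [q, p, c] [q, c, p]"
proof (rule ckI)
  show "word_prod [q, p, c] = word_prod [q, c, p]"
    using assms gen_B_commute[of p c] by simp
  show "\<forall>Y\<in>set (subseqs [q, c, p]). Y \<in> set (subseqs [q, p, c]) \<or> Y \<in> {[c, p], [q, c, p]}"
    by (simp add: Let_def)
  fix Y U W
  assume Y: "Y \<in> {[c, p], [q, c, p]}" "unimodal (U @ Y @ W)"
  then have "length Y = length [q,p] \<and> unimodal (U @ [q,p] @ W)"
    using assms by (auto simp: unimodal_simps)
  moreover have "[q,p] \<in> set (subseqs [q, p, c])"
    by simp_all
  ultimately show "\<exists>Y'\<in>set (subseqs [q, p, c]). length Y' = length Y \<and> unimodal (U @ Y' @ W)"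
    by metis
qed simp_all

text \<open>A unimodal word that rises from \<open>a\<close> to \<open>c\<close> keeps rising, so
  the smaller \<open>b\<close> can stand in for \<open>c\<close>.\<close>

lemma ck_cab: assumes "a < b" "b < c" shows "ck [c, a, b] [a, c, b]"
proof (rule ckI)
  show "word_prod [c, a, b] = word_prod [a, c, b]"
    using assms gen_B_commute'[of c a "gen_B b"] by simp
  show "\<forall>Y\<in>set (subseqs [a, c, b]). Y \<in> set (subseqs [c, a, b]) \<or> Y \<in> {[a, c], [a, c, b]}"
    by (simp add: Let_def)
  fix Y U W
  assume Y: "Y \<in> {[a, c], [a, c, b]}" "unimodal (U @ Y @ W)"
  then have "length Y = length [a,b] \<and> unimodal (U @ [a,b] @ W)"
    using assms by (auto simp: unimodal_simps)
  moreover have "[a,b] \<in> set (subseqs [c, a, b])"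
    by simp_all
  ultimately show "\<exists>Y'\<in>set (subseqs [c, a, b]). length Y' = length Y \<and> unimodal (U @ Y' @ W)"
    by metis
qed simp_all

text \<open>Nothing has to be traded here: every subword that is new contains a peak or a repeated
  letter.\<close>

lemma ck_braid_left: assumes "z < x" shows "ck [Suc x, x, Suc x, z] [x, Suc x, x, z]"
proof (rule ckI)
  show "word_prod [Suc x, x, Suc x, z] = word_prod [x, Suc x, x, z]"
    using assms gen_B_braid'[of x "gen_B z"] by simp
  let ?B = "{[x, Suc x, x], [x, x], [x, x, z], [x, Suc x, x, z], [x, Suc x, z]}"
  show "\<forall>Y\<in>set (subseqs [x, Suc x, x, z]). Y \<in> set (subseqs [Suc x, x, Suc x, z]) \<or> Y \<in> ?B"
    by (simp add: Let_def)
  fix Y U W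
  assume Y: "Y \<in> ?B" "unimodal (U @ Y @ W)"
  then have False using assms by (auto simp: unimodal_simps)
  then show "\<exists>Y'\<in>set (subseqs [Suc x, x, Suc x, z]). length Y' = length Y \<and> unimodal (U @ Y' @ W)" ..
qed simp_all

text \<open>The move behind the exceptional rule for \<open>0\<close>; again the new subwords
  contain a peak or a repeated letter.\<close>

lemma ck_1010: "ck [1, 0, 1, 0] [0, 1, 0, 1]"
proof (rule ckI)
  show "word_prod [1, 0, 1, 0] = word_prod [0, 1, 0, 1]"
    using gen_B_braid4 by simp
  let ?B = "{[0, 1, 0, 1], [0, 0, 1], [0, 1, 1], [0, 0], [1, 1], [0, 1, 0]} :: nat list set"
  show "\<forall>Y\<in>set (subseqs [0, 1, 0, 1]). Y \<in> set (subseqs [1, 0, 1, 0]) \<or> Y \<in> ?B"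
    by (simp add: Let_def)
  fix Y :: "nat list" and U W
  assume Y: "Y \<in> ?B" "unimodal (U @ Y @ W)"
  then have False by (auto simp: unimodal_simps)
  then show "\<exists>Y'\<in>set (subseqs [1, 0, 1, 0]). length Y' = length Y \<and> unimodal (U @ Y' @ W)" ..
qed simp_all


section \<open>Reduced words and row insertion\<close>

definition red :: "nat \<Rightarrow> nat list \<Rightarrow> bool" where
  "red n w \<longleftrightarrow> reduced_word n (word_prod w) w"

lemma red_factor:
  assumes "red n (u @ x @ v)" shows "red n x"
  unfolding red_def reduced_word_def
proof (intro conjI ballI impI)
  fix b assume b: "b \<in> lists {0..<n}" "word_prod b = word_prod x"
  then have "u @ b @ v \<in> lists {0..<n}" "word_prod (u @ b @ v) = word_prod (u @ x @ v)"
    using assms by (auto simp: red_def reduced_word_def)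
  then have "length (u @ x @ v) \<le> length (u @ b @ v)"
    using assms unfolding red_def reduced_word_def by blast
  then show "length x \<le> length b" by simp
qed (use assms in \<open>auto simp: red_def reduced_word_def\<close>)

lemma red_appendD1: "red n (x @ y) \<Longrightarrow> red n x"
  using red_factor[of n "[]" x y] by simp

lemma red_appendD2: "red n (x @ y) \<Longrightarrow> red n y"
  using red_factor[of n x y "[]"] by simp

lemma red_ck: "red n x \<Longrightarrow> ck x y \<Longrightarrow> red n y"
  by (auto simp: red_def reduced_word_def ck_def)

lemma red_minimal:
  "red n x \<Longrightarrow> word_prod y = word_prod x \<Longrightarrow> set y \<subseteq> set x \<Longrightarrow> length x \<le> length y"
  by (auto simp: red_def reduced_word_def subset_iff)

lemma gen_B_commute_word:
  "\<forall>b\<in>set x. a + 1 < b \<or> b + 1 < a \<Longrightarrow> gen_B a \<circ> word_prod x = word_prod x \<circ> gen_B a"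
proof (induction x)
  case (Cons b x)
  then have "gen_B a \<circ> gen_B b = gen_B b \<circ> gen_B a"
    by (intro gen_B_commute) auto
  with Cons show ?case
    by (auto simp: fun_eq_iff)
qed simp

text \<open>Otherwise every letter in between commutes with \<open>a\<close>, and the two copies of
  \<open>a\<close> cancel. This is how reducedness produces the letters that the special bumping
  rules presuppose.\<close>

lemma red_neighbour:
  assumes "red n (u @ a # x @ a # v)"
  shows "\<exists>b\<in>set x. b = a \<or> b = Suc a \<or> Suc b = a"
proof (rule ccontr)
  assume "\<not> ?thesis"
  then have "\<forall>b\<in>set x. a + 1 < b \<or> b + 1 < a"
    by (metis Suc_eq_plus1 Suc_lessI linorder_neqE_nat)
  then have "word_prod (a # x @ [a]) = word_prod x"
    using gen_B_commute_word[of x a] pointfree_idE[OF gen_B_invol[of a]] by (auto simp: fun_eq_iff)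
  moreover have "red n (a # x @ [a])"
    using red_factor[of n u "a # x @ [a]" v] assms by simp
  ultimately have "length (a # x @ [a]) \<le> length x"
    by (intro red_minimal) auto
  then show False by simp
qed

lemma red_distinct_adj: "red n (u @ a # b # v) \<Longrightarrow> a \<noteq> b"
  using red_neighbour[of n u a "[]" v] by auto

text \<open>Edelman-Greene row insertion of \<open>a\<close> into an increasing word, with
  \<open>c\<close> leaving; the second case is the special rule for a word containing both
  \<open>a\<close> and \<open>a + 1\<close>. As a relation it can be read in both directions, so
  that insertion into the decreasing part becomes inverse insertion into its reversal.\<close>

definition row_ins :: "nat list \<Rightarrow> nat \<Rightarrow> nat \<Rightarrow> nat list \<Rightarrow> bool" where
  "row_ins I a c I' \<longleftrightarrow>
     (\<exists>I1 I2. I = I1 @ c # I2 \<and> I' = I1 @ a # I2 \<and> a < c \<and> (\<forall>x\<in>set I1. x < a) \<and> (\<forall>x\<in>set I2. c < x)) \<or>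
     (\<exists>I1 I2. I = I1 @ a # c # I2 \<and> c = Suc a \<and> I' = I)"

text \<open>The minimal letter of a unimodal row may be counted in either part. This, and reading the insertion into the
  decreasing part backwards, makes the relation symmetric under reversal.\<close>

definition bump :: "nat list \<Rightarrow> nat \<Rightarrow> nat list \<Rightarrow> nat \<Rightarrow> bool" where
  "bump R a R' a' \<longleftrightarrow>
     (\<exists>D I D' I' c. R = D @ I \<and> R' = D' @ I' \<and> dcr D \<and> inc I \<and> dcr D' \<and> inc I' \<and>
        row_ins I a c I' \<and> row_ins (rev D') a' c (rev D))"

lemma bump_rev: "bump R a R' a' \<Longrightarrow> bump (rev R') a' (rev R) a"
  unfolding bump_def
proof (elim exE conjE, intro exI conjI)
  fix D I D' I' c
  assume *: "R = D @ I" "R' = D' @ I'" "dcr D" "inc I" "dcr D'" "inc I'"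
    "row_ins I a c I'" "row_ins (rev D') a' c (rev D)"
  show "rev R' = rev I' @ rev D'" "rev R = rev I @ rev D" "dcr (rev I')" "inc (rev D')"
    "dcr (rev I)" "inc (rev D)" "row_ins (rev D') a' c (rev D)" "row_ins (rev (rev I)) a c (rev (rev I'))"
    using * by (simp_all add: sorted_wrt_rev)
qed

lemma inc_append_set: "inc (u @ v) \<longleftrightarrow> inc u \<and> inc v \<and> (\<forall>x\<in>set u. \<forall>y\<in>set v. x < y)"
  by (rule sorted_wrt_append)

lemma inc_Cons_set: "inc (x # w) \<longleftrightarrow> (\<forall>y\<in>set w. x < y) \<and> inc w"
  by (rule sorted_wrt.simps(2))

lemma dcr_append_set: "dcr (u @ v) \<longleftrightarrow> dcr u \<and> dcr v \<and> (\<forall>x\<in>set u. \<forall>y\<in>set v. y < x)"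
  by (rule sorted_wrt_append)

lemma dcr_Cons_set: "dcr (x # w) \<longleftrightarrow> (\<forall>y\<in>set w. y < x) \<and> dcr w"
  by (rule sorted_wrt.simps(2))

lemmas inc_set = inc_append_set inc_Cons_set
lemmas dcr_set = dcr_append_set dcr_Cons_set

lemma row_ins_length: "row_ins I a c I' \<Longrightarrow> length I' = length I"
  by (auto simp: row_ins_def)

lemma row_ins_less: "row_ins I a c I' \<Longrightarrow> a < c"
  by (auto simp: row_ins_def)

lemma row_ins_mem: "row_ins I a c I' \<Longrightarrow> a \<in> set I' \<and> c \<in> set I"
  by (auto simp: row_ins_def)

lemma row_ins_inc: "row_ins I a c I' \<Longrightarrow> inc I \<longleftrightarrow> inc I'"
  unfolding row_ins_def by (elim disjE exE conjE) (fastforce simp: inc_set)+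

lemma row_ins_set_ne:
  "row_ins I a c I' \<Longrightarrow> inc I \<Longrightarrow> a \<notin> set I \<Longrightarrow> set I' = insert a (set I - {c}) \<and> c \<notin> set I'"
  unfolding row_ins_def by (elim disjE exE conjE) (fastforce simp: inc_set)+

lemma row_ins_eq: "row_ins I a c I' \<Longrightarrow> inc I \<Longrightarrow> a \<in> set I \<Longrightarrow> I' = I \<and> c = Suc a"
  unfolding row_ins_def by (elim disjE exE conjE) (fastforce simp: inc_set)+

text \<open>Together with \<open>row_ins_mem\<close> this pins down \<open>c\<close> from
  \<open>I\<close> and \<open>a\<close>, and \<open>a\<close> from \<open>I'\<close> and
  \<open>c\<close>; determinism follows in both directions.\<close>

lemma row_ins_next:
  assumes "row_ins I a c I'" "inc I"
  shows "\<forall>x\<in>set I. a < x \<longrightarrow> c \<le> x" "\<forall>x\<in>set I'. x < c \<longrightarrow> x \<le> a"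
  using assms unfolding row_ins_def by (elim disjE exE conjE; fastforce simp: inc_set)+

lemma map_replace: "distinct (u @ c # v) \<Longrightarrow> map (\<lambda>x. if x = c then a else x) (u @ c # v) = u @ a # v"
  by (auto intro: map_idI)

lemma inc_distinct: "inc w \<Longrightarrow> distinct w"
  by (induction w) (auto simp: inc_set)

lemma dcr_distinct: "dcr w \<Longrightarrow> distinct w"
  by (induction w) (auto simp: dcr_set)

lemma row_ins_right: "row_ins I a c I' \<Longrightarrow> inc I \<Longrightarrow>
    I' = (if a \<in> set I then I else map (\<lambda>x. if x = c then a else x) I)"
proof (cases "a \<in> set I")
  case False
  assume *: "row_ins I a c I'" "inc I"
  with False obtain I1 I2 where "I = I1 @ c # I2" "I' = I1 @ a # I2"
    by (auto simp: row_ins_def)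
  then show ?thesis
    using map_replace[of I1 c I2] inc_distinct[OF *(2)] False by simp
qed (auto dest: row_ins_eq)

lemma row_ins_left: "row_ins I a c I' \<Longrightarrow> inc I \<Longrightarrow>
    I = (if c \<in> set I' then I' else map (\<lambda>x. if x = a then c else x) I')"
proof (cases "c \<in> set I'")
  case False
  assume *: "row_ins I a c I'" "inc I"
  with False obtain I1 I2 where "I = I1 @ c # I2" "I' = I1 @ a # I2"
    by (auto simp: row_ins_def)
  then show ?thesis
    using map_replace[of I1 a I2] inc_distinct[of I'] row_ins_inc[OF *(1)] *(2) False by simp
qed (auto dest: row_ins_set_ne row_ins_eq)

lemma row_ins_det_right:
  assumes "row_ins I a c I'" "row_ins I a d J" "inc I"
  shows "c = d" "I' = J"
proof -
  show "c = d"
    using row_ins_next(1)[OF assms(1,3)] row_ins_next(1)[OF assms(2,3)]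
      row_ins_less[OF assms(1)] row_ins_less[OF assms(2)]
      row_ins_mem[OF assms(1)] row_ins_mem[OF assms(2)]
    by (meson le_antisym)
  then show "I' = J"
    using row_ins_right[OF assms(1,3)] row_ins_right[OF assms(2,3)] by simp
qed

lemma row_ins_det_left:
  assumes "row_ins I a c I'" "row_ins J b c I'" "inc I'"
  shows "a = b" "I = J"
proof -
  have *: "inc I" "inc J"
    using assms row_ins_inc by blast+
  show "a = b"
    using row_ins_next(2)[OF assms(1) *(1)] row_ins_next(2)[OF assms(2) *(2)]
      row_ins_less[OF assms(1)] row_ins_less[OF assms(2)]
      row_ins_mem[OF assms(1)] row_ins_mem[OF assms(2)]
    by (meson le_antisym)
  then show "I = J"
    using row_ins_left[OF assms(1) *(1)] row_ins_left[OF assms(2) *(2)] by simp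
qed

lemma dec_part_inc: "inc (x # w) \<Longrightarrow> dec_part (x # w) = [x]"
  by (cases w) (auto simp: inc_Cons)

lemma dec_part_append:
  assumes "dcr d" "inc i" "d \<noteq> []"
  shows "dec_part (d @ i) = (if i \<noteq> [] \<and> hd i < last d then d @ [hd i] else d)"
  using assms
proof (induction d rule: dec_part.induct)
  case (2 x)
  then show ?case
    by (cases i) (auto simp: dec_part_inc)
qed (auto simp: dcr_Cons)

text \<open>The cut in \<open>bump\<close> is free, whereas \<open>dec_part\<close> always counts
  the minimum to the left. If \<open>bump\<close> counts it to the right, it is smaller than both
  \<open>a'\<close> and \<open>c\<close>, takes no part in the exchange and may change
  sides.\<close>

lemma bump_dec_part:
  assumes "bump R a R' a'"
  obtains D' I' c where "R' = D' @ I'" "row_ins (inc_part R) a c I'"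
    "row_ins (rev D') a' c (rev (dec_part R))" "inc I'" "dcr D'"
proof -
  obtain D I D' I' c where *: "R = D @ I" "R' = D' @ I'" "dcr D" "inc I" "dcr D'" "inc I'"
    "row_ins I a c I'" "row_ins (rev D') a' c (rev D)"
    using assms by (auto simp: bump_def)
  have "D \<noteq> []"
    using row_ins_mem[OF *(8)] row_ins_length[OF *(8)] by auto
  show ?thesis
  proof (cases "I \<noteq> [] \<and> hd I < last D")
    case False
    then have "dec_part R = D"
      using dec_part_append[OF *(3,4) \<open>D \<noteq> []\<close>] *(1) by simp
    then have "inc_part R = I"
      by (metis *(1) dec_part_inc_part same_append_eq)
    with \<open>dec_part R = D\<close> show ?thesis
      using that * by blast
  next
    case True
    then obtain \<mu> J where J: "I = \<mu> # J" "\<mu> < last D"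
      by (cases I) auto
    have "dec_part R = D @ [\<mu>]"
      using dec_part_append[OF *(3,4) \<open>D \<noteq> []\<close>] *(1) J True by simp
    then have "inc_part R = J"
      by (metis *(1) J(1) append.assoc append_Cons append_Nil dec_part_inc_part same_append_eq)
    have small: "\<mu> < x" if "x \<in> set D" for x
      using that J(2) *(3) \<open>D \<noteq> []\<close> dcr_append_set[of "butlast D" "[last D]"]
      by (metis append_butlast_last_id in_set_conv_decomp_last list.set_intros(1) less_trans rotate1.simps(2) set_ConsD set_rotate1)
    have "a' \<in> set D" "a' < c"
      using row_ins_mem[OF *(8)] row_ins_less[OF *(8)] by auto
    then have "\<mu> < a'" "\<mu> < c"
      using small by force+
    obtain J' where J': "I' = \<mu> # J'" "row_ins J a c J'"
    proof -
      from *(7) consider (1) I1 I2 where "I = I1 @ c # I2" "I' = I1 @ a # I2" "a < c" "\<forall>x\<in>set I1. x < a" "\<forall>x\<in>set I2. c < x"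
        | (2) I1 I2 where "I = I1 @ a # c # I2" "c = Suc a" "I' = I"
        unfolding row_ins_def by blast
      then show ?thesis
      proof cases
        case 1
        then obtain I3 where "I1 = \<mu> # I3"
          using J(1) \<open>\<mu> < c\<close> by (cases I1) auto
        with 1 J(1) have "I' = \<mu> # (I3 @ a # I2)" "row_ins J a c (I3 @ a # I2)"
          by (auto simp: row_ins_def)
        then show ?thesis by (rule that)
      next
        case 2
        \<comment> \<open>Otherwise \<open>\<mu> = a\<close>, which contradicts
          \<open>\<mu> < a' < Suc a\<close>.\<close>
        have "I1 \<noteq> []"
        proof
          assume "I1 = []"
          then have "\<mu> = a" using 2 J(1) by simp
          then show False using \<open>\<mu> < a'\<close> \<open>a' < c\<close> 2 by simp
        qed
        then obtain I3 where "I1 = \<mu> # I3"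
          using J(1) 2 by (cases I1) auto
        with 2 J(1) have "I' = \<mu> # J" "row_ins J a c J"
          by (auto simp: row_ins_def)
        then show ?thesis by (rule that)
      qed
    qed
    have "row_ins (rev (D' @ [\<mu>])) a' c (rev (D @ [\<mu>]))"
      using *(8) \<open>\<mu> < a'\<close> unfolding row_ins_def
    proof (elim disjE exE conjE)
      fix I1 I2
      assume "rev D' = I1 @ c # I2" "rev D = I1 @ a' # I2" "a' < c" "\<forall>x\<in>set I1. x < a'" "\<forall>x\<in>set I2. c < x"
      with \<open>\<mu> < a'\<close> show "(\<exists>I1 I2. rev (D' @ [\<mu>]) = I1 @ c # I2 \<and> rev (D @ [\<mu>]) = I1 @ a' # I2 \<and>
          a' < c \<and> (\<forall>x\<in>set I1. x < a') \<and> (\<forall>x\<in>set I2. c < x)) \<or>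
        (\<exists>I1 I2. rev (D' @ [\<mu>]) = I1 @ a' # c # I2 \<and> c = Suc a' \<and> rev (D @ [\<mu>]) = rev (D' @ [\<mu>]))"
        by (intro disjI1 exI[of _ "\<mu> # I1"] exI[of _ I2]) auto
    next
      fix I1 I2
      assume "rev D' = I1 @ a' # c # I2" "c = Suc a'" "rev D = rev D'"
      then show "(\<exists>I1 I2. rev (D' @ [\<mu>]) = I1 @ c # I2 \<and> rev (D @ [\<mu>]) = I1 @ a' # I2 \<and>
          a' < c \<and> (\<forall>x\<in>set I1. x < a') \<and> (\<forall>x\<in>set I2. c < x)) \<or>
        (\<exists>I1 I2. rev (D' @ [\<mu>]) = I1 @ a' # c # I2 \<and> c = Suc a' \<and> rev (D @ [\<mu>]) = rev (D' @ [\<mu>]))"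
        by (intro disjI2 exI[of _ "\<mu> # I1"] exI[of _ I2]) auto
    qed
    then show ?thesis
      using that[of "D' @ [\<mu>]" J' c] *(2,6) J' \<open>dec_part R = D @ [\<mu>]\<close> \<open>inc_part R = J\<close>
        row_ins_inc[of "rev (D' @ [\<mu>])" a' c "rev (D @ [\<mu>])"] dcr_dec_part[of R]
      by (simp add: inc_set dcr_set sorted_wrt_rev)
  qed
qed

text \<open>The right half determines \<open>c\<close> and \<open>I'\<close> from \<open>a\<close>;
  the left half, read in the inverse direction, then determines \<open>a'\<close> and
  \<open>D'\<close> from \<open>c\<close>.\<close>

lemma bump_det:
  assumes "bump R a R' a'" "bump R a S b" "unimodal R"
  shows "R' = S \<and> a' = b"
proof -
  obtain D' I' c where 1: "R' = D' @ I'" "row_ins (inc_part R) a c I'"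
    "row_ins (rev D') a' c (rev (dec_part R))"
    using bump_dec_part[OF assms(1)] by metis
  obtain E' J' d where 2: "S = E' @ J'" "row_ins (inc_part R) a d J'"
    "row_ins (rev E') b d (rev (dec_part R))"
    using bump_dec_part[OF assms(2)] by metis
  have "inc (inc_part R)" "inc (rev (dec_part R))"
    using inc_part_inc[OF assms(3)] dcr_dec_part[of R] by (auto simp: sorted_wrt_rev)
  then show ?thesis
    using row_ins_det_right[OF 1(2) 2(2)] row_ins_det_left[OF 1(3)] 1(1) 2 by auto
qed

lemma bump_inj:
  assumes "bump R a R' a'" "bump S b R' a'" "unimodal R'"
  shows "R = S \<and> a = b"
  using bump_det[OF bump_rev[OF assms(1)] bump_rev[OF assms(2)]] assms(3) by (simp add: unimodal_rev)


section \<open>Carrying letters through a row by elementary moves\<close>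

lemma ck_left: "ck x y \<Longrightarrow> ck (u @ x) (u @ y)"
  using ck_context[of x y u "[]"] by simp

lemma ck_right: "ck x y \<Longrightarrow> ck (x @ v) (y @ v)"
  using ck_context[of x y "[]" v] by simp

lemma ck_Cons: "ck x y \<Longrightarrow> ck (a # x) (a # y)"
  using ck_left[of x y "[a]"] by simp

text \<open>The letter \<open>a\<close> moves left past larger letters. Each exchange is witnessed
  by the letter to the left of the one passed, so \<open>a\<close> comes to rest just after
  \<open>b\<close>.\<close>

lemma ck_pass_large:
  "p < b \<Longrightarrow> a < b \<Longrightarrow> inc (b # w) \<Longrightarrow> ck (p # b # w @ [a]) (p # b # a # w)"
proof (induction w arbitrary: p b)
  case (Cons z w)
  then have "ck (b # z # w @ [a]) (b # z # a # w)"
    by (auto simp: inc_Cons)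
  then have "ck (p # b # z # w @ [a]) (p # b # z # a # w)"
    by (rule ck_Cons)
  also have "ck (p # b # z # a # w) (p # b # a # z # w)"
    using ck_right[OF ck_pbca[of a b z p], of w] Cons.prems by (auto simp: inc_Cons)
  finally show ?case by simp
qed simp

text \<open>The letter \<open>c\<close> moves left past smaller letters. Each exchange is witnessed
  by the letter on its right, which is why a final \<open>r\<close> is carried along.\<close>

lemma ck_pass_small:
  "inc (p # w @ [r]) \<Longrightarrow> r < c \<Longrightarrow> ck (p # w @ [c, r]) (p # c # w @ [r])"
proof (induction w arbitrary: p)
  case (Cons q w)
  then have "ck (q # w @ [c, r]) (q # c # w @ [r])"
    by (auto simp: inc_Cons)
  then have "ck (p # q # w @ [c, r]) (p # q # c # w @ [r])"
    by (rule ck_Cons)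
  also have "ck (p # q # c # w @ [r]) (p # c # q # w @ [r])"
  proof -
    obtain h v where hv: "w @ [r] = h # v" by (cases "w @ [r]") auto
    then have "q < h" "p < q" "h \<le> r"
      using Cons.prems(1) by (cases w; auto simp: inc_set)+
    then show ?thesis
      using ck_right[OF ck_pqbr[of p q h c], of v] Cons.prems(2) hv by simp
  qed
  finally show ?case by simp
qed simp

text \<open>The incoming \<open>a\<close> travels left to its place, then \<open>c\<close> travels
  left out of the word. Under the special rule a braid move between the two trips turns
  \<open>a, a + 1, a\<close> into \<open>a + 1, a, a + 1\<close>. The letter \<open>p\<close> in
  front is the guard for these moves.\<close>

lemma ck_row_ins:
  assumes "inc (p # I)" "row_ins I a c I'"
  shows "ck (p # I @ [a]) (p # c # I')"
  using assms(2) unfolding row_ins_def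
proof (elim disjE exE conjE)
  fix I1 I2
  assume I: "I = I1 @ c # I2" "I' = I1 @ a # I2" "a < c" "\<forall>x\<in>set I1. x < a"
  \<comment> \<open>\<open>q\<close> is the letter preceding \<open>c\<close>; it may be
    \<open>p\<close> itself.\<close>
  obtain u q where uq: "p # I1 = u @ [q]"
    by (metis list.distinct(1) rev_exhaust)
  have "q \<in> set (p # I1)" by (simp add: uq)
  then have "q < c"
    using assms(1) I by (auto simp: inc_set)
  then have "ck (q # c # I2 @ [a]) (q # c # a # I2)"
    using assms(1) I by (intro ck_pass_large) (auto simp: inc_set)
  then have "ck (u @ q # c # I2 @ [a]) (u @ q # c # a # I2)"
    by (rule ck_left)
  then have "ck (p # I @ [a]) ((p # I1) @ c # a # I2)"
    using uq by (metis I(1) append.assoc append_Cons append_Nil)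
  also have "ck ((p # I1) @ c # a # I2) (p # c # I1 @ a # I2)"
  proof (cases "I1 = []")
    case False
    then obtain q' w where "I1 = q' # w" by (cases I1) auto
    then have "inc (p # I1 @ [a])"
      using assms(1) I by (auto simp: inc_set)
    then show ?thesis
      using ck_right[OF ck_pass_small[of p I1 a c], of I2] I(3) by simp
  qed simp
  finally show ?thesis
    using I(2) by simp
next
  fix I1 I2
  assume I: "I = I1 @ a # c # I2" "c = Suc a" "I' = I"
  obtain u q where uq: "p # I1 = u @ [q]"
    by (metis list.distinct(1) rev_exhaust)
  have "q \<in> set (p # I1)" by (simp add: uq)
  then have "q < a"
    using assms(1) I by (auto simp: inc_set)
  have "ck (a # c # I2 @ [a]) (a # c # a # I2)"
    using assms(1) I by (intro ck_pass_large) (auto simp: inc_set)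
  then have "ck (u @ q # a # c # I2 @ [a]) (u @ q # a # c # a # I2)"
    using ck_left[of "a # c # I2 @ [a]" _ "u @ [q]"] by simp
  also have "ck (u @ q # a # c # a # I2) (u @ q # c # a # c # I2)"
    using ck_context[OF ck_braid_right[OF \<open>q < a\<close>], of u I2] I(2) by simp
  finally have "ck (p # I @ [a]) ((p # I1) @ c # a # c # I2)"
    using uq by (metis I(1) append.assoc append_Cons append_Nil)
  also have "ck ((p # I1) @ c # a # c # I2) (p # c # I1 @ a # c # I2)"
    using ck_right[OF ck_pass_small[of p I1 a c], of "c # I2"] assms(1) I by (simp add: inc_set)
  finally show ?thesis
    using I by simp
qed

lemma ck_pass_dcr: "dcr (q # w) \<Longrightarrow> q < c \<Longrightarrow> ck (q # w @ [c]) (q # c # w)"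
proof (induction w arbitrary: q)
  case (Cons p w)
  then have "ck (p # w @ [c]) (p # c # w)"
    by (auto simp: dcr_Cons)
  then have "ck (q # p # w @ [c]) (q # p # c # w)"
    by (rule ck_Cons)
  also have "ck (q # p # c # w) (q # c # p # w)"
    using ck_right[OF ck_qpc[of p q c], of w] Cons.prems by (auto simp: dcr_Cons)
  finally show ?case by simp
qed simp

lemma ck_pass_front: "\<forall>x\<in>set w. c < x \<Longrightarrow> dcr w \<Longrightarrow> a < c \<Longrightarrow> ck (w @ [a, c]) (a # w @ [c])"
proof (induction w)
  case (Cons x w)
  then have "ck (w @ [a, c]) (a # w @ [c])"
    by (auto simp: dcr_set)
  then have "ck (x # w @ [a, c]) (x # a # w @ [c])"
    by (rule ck_Cons)
  also have "ck (x # a # w @ [c]) (a # x # w @ [c])"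
  proof -
    obtain h v where hv: "w @ [c] = h # v" by (cases "w @ [c]") auto
    then have "a < h" "h < x"
      using Cons.prems by (cases w; auto simp: dcr_set)+
    then show ?thesis
      using ck_right[OF ck_cab[of a h x], of v] hv by simp
  qed
  finally show ?case by simp
qed simp

text \<open>The mirror image for the decreasing part: \<open>c\<close> enters at its right end and
  \<open>a'\<close> leaves in front. The letter \<open>r\<close> that follows serves as a guard, and
  \<open>1 < c\<close> keeps the three-letter braid move away from \<open>0\<close> and
  \<open>1\<close>.\<close>

lemma ck_row_ins_dcr:
  assumes "dcr D" "dcr D'" "row_ins (rev D') a' c (rev D)" "r < c" "1 < c" "red n (D @ [c, r])"
  shows "ck (D @ [c, r]) (a' # D' @ [r])"
  using assms(3) unfolding row_ins_def
proof (elim disjE exE conjE)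
  fix I1 I2
  assume "rev D' = I1 @ c # I2" "rev D = I1 @ a' # I2" and less: "a' < c"
  then have "rev (rev D') = rev (I1 @ c # I2)" "rev (rev D) = rev (I1 @ a' # I2)"
    by simp_all
  then have D: "D' = rev I2 @ c # rev I1" "D = rev I2 @ a' # rev I1"
    by simp_all
  have "ck (a' # rev I1 @ [c]) (a' # c # rev I1)"
    using assms(1) less unfolding D by (intro ck_pass_dcr) (auto simp: dcr_set)
  then have "ck (D @ [c, r]) (rev I2 @ [a', c] @ rev I1 @ [r])"
    using ck_context[of _ _ "rev I2" "[r]"] unfolding D by fastforce
  also have "ck (rev I2 @ [a', c] @ rev I1 @ [r]) (a' # D' @ [r])"
    using ck_right[OF ck_pass_front[of "rev I2" c a'], of "rev I1 @ [r]"] assms(2) less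
    unfolding D by (simp add: dcr_set)
  finally show ?thesis .
next
  fix I1 I2
  assume D': "rev D' = I1 @ a' # c # I2" and c: "c = Suc a'" and "rev D = rev D'"
  have "rev (rev D') = rev (I1 @ a' # c # I2)"
    by (simp only: D')
  then have "D' = rev I2 @ c # a' # rev I1" by simp
  moreover have "D = D'"
    using \<open>rev D = rev D'\<close> by (rule rev_is_rev_conv[THEN iffD1])
  ultimately have D: "D' = rev I2 @ c # a' # rev I1" "D = rev I2 @ c # a' # rev I1"
    by blast+
  have "ck (a' # rev I1 @ [c]) (a' # c # rev I1)"
    using assms(1) c unfolding D by (intro ck_pass_dcr) (auto simp: dcr_set)
  then have "ck ((rev I2 @ [c]) @ (a' # rev I1 @ [c]) @ [r]) ((rev I2 @ [c]) @ (a' # c # rev I1) @ [r])"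
    by (rule ck_context)
  then have *: "ck (D @ [c, r]) (rev I2 @ c # a' # c # rev I1 @ [r])"
    unfolding D by simp
  obtain h v where hv: "rev I1 @ [r] = h # v" by (cases "rev I1 @ [r]") auto
  \<comment> \<open>\<open>ck_braid_left\<close> asks for a smaller letter on the right. If that
    letter is \<open>r\<close> and \<open>r = a'\<close>, then \<open>c a' c a'\<close> shortens by
    a braid move and a cancellation.\<close>
  have "h < a'"
  proof (cases "rev I1 = []")
    case False
    then have "h \<in> set (rev I1)"
      using hv by (cases "rev I1") auto
    then show ?thesis
      using assms(1) unfolding D by (auto simp: dcr_set)
  next
    case True
    have "red n (rev I2 @ c # a' # c # rev I1 @ [r])"
      using * assms(6) red_ck by blast
    with True have "red n (rev I2 @ [c, a', c, r] @ [])"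
      by simp
    then have red: "red n [c, a', c, r]"
      by (rule red_factor)
    have "r \<noteq> a'"
    proof
      assume "r = a'"
      moreover have "word_prod [c, a', c, a'] = word_prod [a', c]"
      proof -
        have "gen_B c \<circ> (gen_B a' \<circ> (gen_B c \<circ> gen_B a')) = gen_B a' \<circ> (gen_B c \<circ> (gen_B a' \<circ> gen_B a'))"
          unfolding c using assms(5) c by (intro gen_B_braid'[symmetric]) simp
        then show ?thesis by simp
      qed
      ultimately have "length [c, a', c, r] \<le> length [a', c]"
        using red by (intro red_minimal) auto
      then show False by simp
    qed
    then show ?thesis
      using assms(4) c hv True by simp
  qed
  note *
  also have "ck (rev I2 @ c # a' # c # rev I1 @ [r]) (rev I2 @ a' # c # a' # rev I1 @ [r])"
    using ck_context[OF ck_braid_left[OF \<open>h < a'\<close>], of "rev I2" v] c hv by simp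
  also have "ck (rev I2 @ a' # c # a' # rev I1 @ [r]) (a' # D' @ [r])"
    using ck_right[OF ck_pass_front[of "rev I2" c a'], of "a' # rev I1 @ [r]"] assms(2) c
    unfolding D by (simp add: dcr_set)
  finally show ?thesis .
qed

text \<open>In a unimodal word strict monotonicity leaves no room between the \<open>0\<close> and a
  \<open>1\<close> on either side of it, as no letter lies strictly between them; so the three
  letters are adjacent.\<close>

lemma subseq_101_unimodal:
  assumes "subseq [1,0,1] R" "unimodal R"
  obtains X Y where "R = X @ [1,0,1] @ Y" "dcr (X @ [1])" "inc (1 # Y)"
proof -
  obtain A B C E where R: "R = A @ 1 # B @ 0 # C @ 1 # E"
  proof -
    obtain A R1 where 1: "R = A @ 1 # R1" "subseq [0,1] R1"
      using assms(1) by (auto dest: list_emb_ConsD)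
    moreover obtain B R2 where "R1 = B @ 0 # R2" "subseq [1] R2"
      using 1(2) by (auto dest: list_emb_ConsD)
    moreover obtain C E where "R2 = C @ 1 # E"
      using \<open>subseq [1] R2\<close> by (auto dest: list_emb_ConsD)
    ultimately show ?thesis using that by auto
  qed
  then have "unimodal ((A @ 1 # B) @ 0 # (C @ 1 # E))"
    using assms(2) by simp
  then have *: "dcr (A @ 1 # B)" "0 < last (A @ 1 # B)" "unimodal (0 # C @ 1 # E)"
    unfolding unimodal_append_Cons by auto
  have B: "B = []"
  proof (rule ccontr)
    assume "B \<noteq> []"
    then have "last B \<in> set B" "0 < last B" using *(2) by auto
    then show False using *(1) by (auto simp: dcr_set)
  qed
  have "inc (C @ 1 # E)" "0 < hd (C @ 1 # E)"
    using *(3) by (auto simp: unimodal_Cons)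
  then have C: "C = []"
    by (cases C) (auto simp: inc_set)
  show ?thesis
    using that[of A E] R B C * \<open>inc (C @ 1 # E)\<close> by simp
qed

text \<open>Needed for injectivity: the exceptional step keeps the row and passes on
  \<open>0\<close>, so an ordinary bump may have such an outcome only on an exceptional input. Here
  \<open>1\<close> is the least letter above \<open>0\<close> in \<open>D'\<close>, hence
  \<open>c = 1\<close> and \<open>a = 0\<close>.\<close>

lemma bump_nonexceptional:
  assumes "bump R a R' 0" "unimodal R" "unimodal R'" "subseq [1,0,1] R'"
  shows "a = 0 \<and> subseq [1,0,1] R"
proof -
  obtain X Y where XY: "R' = X @ [1,0,1] @ Y" "dcr (X @ [1])" "inc (1 # Y)"
    using subseq_101_unimodal[OF assms(4,3)] .
  obtain D' I' c where *: "R' = D' @ I'" "row_ins (inc_part R) a c I'"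
    "row_ins (rev D') 0 c (rev (dec_part R))" "inc I'" "dcr D'"
    using bump_dec_part[OF assms(1)] .
  have incs: "inc (inc_part R)" "inc (rev (dec_part R))" "inc (rev D')"
    using inc_part_inc[OF assms(2)] dcr_dec_part[of R] *(5) by (auto simp: sorted_wrt_rev)
  have 0: "0 \<in> set (dec_part R)" "0 < c" "c \<in> set D'"
    using row_ins_mem[OF *(3)] row_ins_less[OF *(3)] by auto
  have not0: "0 \<notin> set (inc_part R)"
  proof
    assume "0 \<in> set (inc_part R)"
    moreover have "inc_part R \<noteq> []" "dec_part R \<noteq> []" using calculation 0 by auto
    moreover have "hd (inc_part R) \<le> 0"
      using calculation(1) incs(1) by (cases "inc_part R") (auto simp: inc_set)
    ultimately show False
      using inc_part_inc[OF assms(2)] by simp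
  qed
  \<comment> \<open>Both parts are strictly monotone, so the cut between them separates the two
    letters \<open>1\<close>.\<close>
  have 1: "1 \<in> set D'" "1 \<in> set I'"
  proof -
    have "(X @ [1]) @ [0,1] @ Y = D' @ I'" using XY *(1) by simp
    then obtain us where "X @ [1] = D' @ us \<and> us @ [0,1] @ Y = I' \<or> (X @ [1]) @ us = D' \<and> [0,1] @ Y = us @ I'"
      unfolding append_eq_append_conv2 by blast
    then have "1 \<in> set D' \<and> 1 \<in> set I'"
    proof (elim disjE conjE)
      assume us: "X @ [1] = D' @ us" "us @ [0,1] @ Y = I'"
      have "us = []"
      proof (rule ccontr)
        assume "us \<noteq> []"
        then have "last us = last (X @ [1])" using us(1) by simp
        then have "1 \<in> set us" using \<open>us \<noteq> []\<close> last_in_set[of us] by simp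
        then show False using us(2)[symmetric] *(4) by (auto simp: inc_set)
      qed
      then show ?thesis using us(2)[symmetric] us(1)[symmetric] by simp
    next
      assume us: "(X @ [1]) @ us = D'" "[0,1] @ Y = us @ I'"
      have "length us < 2"
      proof (rule ccontr)
        assume "\<not> length us < 2"
        then obtain x y zs where "us = x # y # zs"
          by (cases us; cases "tl us") auto
        then show False using us *(5) by (auto simp: dcr_set)
      qed
      then have "1 \<in> set I'"
        using us(2) by (cases us) auto
      then show ?thesis using us(1)[symmetric] by simp
    qed
    then show "1 \<in> set D'" "1 \<in> set I'" by simp_all
  qed
  then have "c = 1"
    using row_ins_next(1)[OF *(3) incs(3)] 0 by force
  then have "a = 0" using row_ins_less[OF *(2)] by simp
  have "1 \<in> set (inc_part R)"
    using row_ins_mem[OF *(2)] \<open>c = 1\<close> by simp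
  have "1 \<in> set I'" by fact
  then show ?thesis
    using row_ins_set_ne[OF *(2) incs(1)] not0 \<open>a = 0\<close> \<open>c = 1\<close> by simp
qed


section \<open>The bumping step\<close>

lemma not_unimodal_snoc:
  assumes "unimodal R" "\<not> unimodal (R @ [a])" "red n (R @ [a])"
  shows "R \<noteq> []" "a < last R" "inc_part R \<noteq> []" "dec_part R \<noteq> []" "last (inc_part R) = last R"
    "last (dec_part R) < hd (inc_part R)"
proof -
  show "R \<noteq> []" using assms(2) by (auto simp: unimodal_Cons)
  then have "last R \<noteq> a"
    using red_distinct_adj[of n "butlast R" "last R" a "[]"] assms(3)
    by (metis append.assoc append_Cons append_Nil append_butlast_last_id)
  then show "a < last R"
    using assms(1,2) by (auto simp: unimodal_snoc)
  then have "\<not> dcr R"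
    using assms(2) by (auto simp: unimodal_snoc)
  then show *: "inc_part R \<noteq> []"
    using dec_part_inc_part[of R] dcr_dec_part[of R] by (metis append_Nil2)
  show "dec_part R \<noteq> []" using \<open>R \<noteq> []\<close> by simp
  show "last (inc_part R) = last R"
    using dec_part_inc_part[of R] * by (metis last_appendR)
  show "last (dec_part R) < hd (inc_part R)"
    using inc_part_inc[OF assms(1)] * by simp
qed

lemma inc_hd_le: "inc w \<Longrightarrow> x \<in> set w \<Longrightarrow> hd w \<le> x"
  by (cases w) (auto simp: inc_set)

lemma dcr_last_le: "dcr w \<Longrightarrow> x \<in> set w \<Longrightarrow> last w \<le> x"
  by (cases w rule: rev_cases) (auto simp: dcr_set less_imp_le)

text \<open>The \<open>Min\<close> and the \<open>Max\<close> of the algorithm are tied to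
  \<open>row_ins\<close> in the two halves, and the word is followed through them:
  \<open>R a\<close> becomes \<open>D c I'\<close>, and then \<open>D c\<close> becomes
  \<open>a' D'\<close>.\<close>

lemma kr_bump_row_ins:
  assumes "unimodal R" "\<not> unimodal (R @ [a])" "red n (R @ [a])" "kr_bump a R = (R', a')"
    "\<not> (a = 0 \<and> subseq [1,0,1] R)"
  obtains c D' I' where "R' = D' @ I'" "row_ins (inc_part R) a c I'"
    "row_ins (rev D') a' c (rev (dec_part R))" "inc I'" "dcr D'"
    "red n (dec_part R @ c # I')" "ck (R @ [a]) (a' # R')"
proof -
  note N = not_unimodal_snoc[OF assms(1-3)]
  define D where "D = dec_part R"
  define I where "I = inc_part R"
  have RDI: "R = D @ I" by (simp add: D_def I_def dec_part_inc_part)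
  have D: "dcr D" and I: "inc I"
    using dcr_dec_part[of R] inc_part_inc[OF assms(1)] by (simp_all add: D_def I_def)
  have DI: "x < y" if "x = last D" "y \<in> set I" for x y
    using inc_hd_le[OF I that(2)] N(6) that(1) unfolding D_def I_def by linarith
  define b where "b = Min {x \<in> set I. a \<le> x}"
  have "last I \<in> {x \<in> set I. a \<le> x}"
    using N(2,3,5) last_in_set[OF N(3)] by (simp add: I_def)
  then have "{x \<in> set I. a \<le> x} \<noteq> {}" by blast
  then have b: "b \<in> set I" "a \<le> b" "\<forall>x\<in>set I. a \<le> x \<longrightarrow> b \<le> x"
    using Min_in[of "{x \<in> set I. a \<le> x}"] Min_le[of "{x \<in> set I. a \<le> x}"] unfolding b_def by auto
  define I' where "I' = (if b \<noteq> a then map (\<lambda>x. if x = b then a else x) I else I)"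
  define c where "c = (if b \<noteq> a then b else a + 1)"
  define d where "d = Max {x \<in> set D. x \<le> c}"
  have kr: "(R', a') = (if d \<noteq> c then (map (\<lambda>x. if x = d then c else x) D @ I', d) else (D @ I', c - 1))"
    using assms(4,5) unfolding kr_bump_def Let_def
    by (auto simp: D_def[symmetric] I_def[symmetric] b_def[symmetric] I'_def c_def d_def split: if_splits)
  obtain I1 I2 where I12: "I = I1 @ b # I2"
    using b(1) by (auto dest: split_list)
  have I1: "\<forall>x\<in>set I1. x < a"
  proof
    fix x assume "x \<in> set I1"
    then have "x < b" "x \<in> set I"
      using I unfolding I12 by (auto simp: inc_set)
    then show "x < a" using b(3) by (meson not_le)
  qed
  have ins: "row_ins I a c I'"
  proof (cases "b = a")
    case False
    then have "I' = I1 @ a # I2"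
      using map_replace[of I1 b I2] inc_distinct[OF I] by (simp add: I'_def I12)
    with False show ?thesis
      using I1 b(2) I unfolding I12 by (auto simp: row_ins_def c_def inc_set)
  next
    case True
    \<comment> \<open>Everything between the two letters \<open>a\<close> is larger than
      \<open>a\<close>, so the neighbour forced by reducedness is \<open>a + 1\<close>, and it
      stands first in \<open>I2\<close>.\<close>
    have "red n ((D @ I1) @ a # I2 @ a # [])"
      using assms(3) True by (simp add: RDI I12)
    then obtain y where "y \<in> set I2" "y = a \<or> y = Suc a \<or> Suc y = a"
      using red_neighbour by blast
    moreover have "a < z" if "z \<in> set I2" for z
      using I that True unfolding I12 by (auto simp: inc_set)
    ultimately have "Suc a \<in> set I2"
      by force
    then obtain I3 where "I2 = Suc a # I3"
      using I True unfolding I12 by (cases I2) (auto simp: inc_set)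
    then show ?thesis
      using True by (auto simp: row_ins_def I'_def c_def I12)
  qed
  have cI: "c \<in> set I" "a < c" "a \<in> set I'"
    using row_ins_mem[OF ins] row_ins_less[OF ins] by auto
  have "D \<noteq> []" using N by (simp add: D_def)
  have cD: "last D < c" using DI cI(1) by blast
  have "last D \<in> {x \<in> set D. x \<le> c}"
    using cD \<open>D \<noteq> []\<close> by simp
  then have "{x \<in> set D. x \<le> c} \<noteq> {}" by blast
  then have d: "d \<in> set D" "d \<le> c" "\<forall>x\<in>set D. x \<le> c \<longrightarrow> x \<le> d"
    using Max_in[of "{x \<in> set D. x \<le> c}"] Max_ge[of "{x \<in> set D. x \<le> c}"] unfolding d_def by auto
  obtain D1 D2 where D12: "D = D1 @ d # D2"
    using d(1) by (auto dest: split_list)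
  have D1: "\<forall>x\<in>set D1. c < x"
  proof
    fix x assume "x \<in> set D1"
    then have "d < x" "x \<in> set D"
      using D unfolding D12 by (auto simp: dcr_set)
    then show "c < x" using d(3) by (meson not_le)
  qed
  have I': "inc I'" using row_ins_inc[OF ins] I by simp
  have hdI: "D = butlast D @ [last D]" using \<open>D \<noteq> []\<close> by simp
  have "inc (last D # I)"
    using DI I by (auto simp: inc_set)
  then have "ck (last D # I @ [a]) (last D # c # I')"
    using ins by (rule ck_row_ins)
  from ck_left[OF this, of "butlast D"] have ck1: "ck (R @ [a]) (D @ c # I')"
    using hdI by (simp add: RDI) (metis append.assoc append_Cons append_Nil)
  then have red1: "red n (D @ c # I')"
    using assms(3) red_ck by blast
  \<comment> \<open>The first letter of \<open>I'\<close> is at most \<open>a\<close>, hence below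
    \<open>c\<close>; it is the guard for the moves in the decreasing part.\<close>
  obtain r J where rJ: "I' = r # J" using cI(3) by (cases I') auto
  have "r \<le> a" using inc_hd_le[OF I' cI(3)] rJ by simp
  have ex: "\<exists>D'. R' = D' @ I' \<and> dcr D' \<and> row_ins (rev D') a' c (rev D) \<and> (d = c \<longrightarrow> 1 < c)"
  proof (cases "d = c")
    case False
    then have D': "R' = (D1 @ c # D2) @ I'" "a' = d"
      using kr map_replace[of D1 d D2] dcr_distinct[OF D] by (simp_all add: D12)
    have "dcr (D1 @ c # D2)"
      using D D1 d(2) False unfolding D12 by (auto simp: dcr_set)
    moreover have "row_ins (rev (D1 @ c # D2)) a' c (rev D)"
      using D D1 d(2) False D'(2) unfolding row_ins_def D12
      by (intro disjI1 exI[of _ "rev D2"] exI[of _ "rev D1"]) (auto simp: dcr_set)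
    ultimately show ?thesis using D'(1) False by blast
  next
    case True
    then have D': "R' = D @ I'" "a' = c - 1"
      using kr by simp_all
    \<comment> \<open>After the first half the word contains \<open>c\<close> twice with only
      smaller letters in between, so \<open>c - 1\<close> stands directly behind the first
      \<open>c\<close>.\<close>
    have "red n (D1 @ c # D2 @ c # I')"
      using red1 True by (simp add: D12)
    then obtain y where y: "y \<in> set D2" "y = c \<or> y = Suc c \<or> Suc y = c"
      using red_neighbour by blast
    moreover have small: "z < c" if "z \<in> set D2" for z
      using D that True unfolding D12 by (auto simp: dcr_set)
    ultimately have "Suc y = c"
      by force
    then obtain D3 where D3: "D2 = y # D3"
    proof (cases D2)
      case (Cons z D3)
      then have "z < c" "y \<le> z"
        using small y(1) D unfolding D12 by (auto simp: dcr_set)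
      then show ?thesis
        using that Cons \<open>Suc y = c\<close> by auto
    qed (use y in simp)
    have "row_ins (rev D) a' c (rev D)"
      using D3 True \<open>Suc y = c\<close> D'(2) unfolding row_ins_def D12
      by (intro disjI2 exI[of _ "rev D3"] exI[of _ "rev D1"]) auto
    \<comment> \<open>With \<open>c = 1\<close> the row would contain \<open>1 0 1\<close> and
      \<open>a\<close> would be \<open>0\<close>, the exceptional case.\<close>
    moreover have "1 < c"
    proof (rule ccontr)
      assume "\<not> 1 < c"
      then have "c = 1" "y = 0" "a = 0" using cI(2) \<open>Suc y = c\<close> by auto
      have "D3 = []"
        using D \<open>y = 0\<close> unfolding D12 D3 by (cases D3) (auto simp: dcr_set)
      then have "D = D1 @ [1, 0]"
        using D12 D3 True \<open>c = 1\<close> \<open>y = 0\<close> by simp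
      moreover obtain I3 I4 where "I = I3 @ 1 # I4"
        using cI(1) \<open>c = 1\<close> split_list by metis
      ultimately have "R = D1 @ [1,0] @ I3 @ [1] @ I4"
        by (simp add: RDI)
      moreover have "subseq [1,0,1] ([1,0] @ I3 @ [1] @ I4)"
        by (simp add: subseq_singleton_left)
      ultimately have "subseq [1,0,1] R"
        using subseq_drop_many by metis
      then show False using assms(5) \<open>a = 0\<close> by simp
    qed
    ultimately show ?thesis using D'(1) D by blast
  qed
  then obtain D' where D': "R' = D' @ I'" "dcr D'" "row_ins (rev D') a' c (rev D)" "d = c \<longrightarrow> 1 < c"
    by blast
  have "1 < c \<or> d \<noteq> c" using D'(4) by blast
  have "ck (D @ [c, r]) (a' # D' @ [r])"
  proof (cases "1 < c")
    case True
    show ?thesis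
      using ck_row_ins_dcr[OF D D'(2,3) _ True, of r n] red_appendD1[of n "D @ [c, r]" J] red1 rJ \<open>r \<le> a\<close> cI(2)
      by simp
  next
    case False
    \<comment> \<open>The bumped \<open>0\<close> is the last letter of \<open>D\<close>, so there
      is nothing on its right for \<open>c\<close> to pass.\<close>
    then have "c = 1" "d = 0" using cI(2) \<open>1 < c \<or> d \<noteq> c\<close> d(2) by auto
    have "D2 = []"
      using D \<open>d = 0\<close> unfolding D12 by (cases D2) (auto simp: dcr_set)
    have "R' = map (\<lambda>x. if x = d then c else x) D @ I'" "a' = 0"
      using kr \<open>c = 1\<close> \<open>d = 0\<close> by simp_all
    then have "D' = D1 @ [c]"
      using D'(1) map_replace[of D1 d D2] dcr_distinct[OF D] \<open>D2 = []\<close> by (simp add: D12)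
    then show ?thesis
      using ck_right[OF ck_pass_front[of D1 c 0], of "[r]"] D1 D \<open>c = 1\<close> \<open>D2 = []\<close> \<open>a' = 0\<close> \<open>d = 0\<close>
      by (simp add: D12 dcr_set)
  qed
  from ck_right[OF this, of J] have "ck (D @ c # I') (a' # R')"
    using rJ D'(1) by simp
  with ck1 have "ck (R @ [a]) (a' # R')" by (rule ck_trans)
  then show ?thesis
    using that[OF D'(1) ins[unfolded I_def] D'(3)[unfolded D_def] I' D'(2) red1[unfolded D_def]] by blast
qed

text \<open>The new \<open>0\<close> moves left until it follows \<open>1 0 1\<close>; the
  four-letter braid relation gives \<open>0 1 0 1\<close>, whose leading \<open>0\<close> leaves the
  row while \<open>1 0 1\<close> is restored.\<close>

lemma kr_bump_exceptional:
  assumes "unimodal R" "subseq [1,0,1] R"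
  shows "ck (R @ [0]) (0 # R)"
proof -
  obtain X Y where R: "R = X @ [1,0,1] @ Y" "dcr (X @ [1])" "inc (1 # Y)"
    using subseq_101_unimodal[OF assms(2,1)] .
  have "ck (0 # 1 # Y @ [0]) (0 # 1 # 0 # Y)"
    using R(3) by (intro ck_pass_large) auto
  from ck_left[OF this, of "X @ [1]"] have "ck (R @ [0]) (X @ [1,0,1,0] @ Y)"
    by (simp add: R(1))
  also have "ck (X @ [1,0,1,0] @ Y) (X @ [0,1,0,1] @ Y)"
    by (intro ck_context ck_1010)
  also have "ck (X @ [0,1,0,1] @ Y) (0 # R)"
    using ck_right[OF ck_pass_front[of X 1 0], of "[0,1] @ Y"] R(2) by (simp add: R(1) dcr_set)
  finally show ?thesis .
qed

definition kr_step :: "nat \<Rightarrow> nat list \<Rightarrow> nat \<Rightarrow> nat list \<Rightarrow> nat \<Rightarrow> bool" where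
  "kr_step n R a R' a' \<longleftrightarrow>
     unimodal R \<and> \<not> unimodal (R @ [a]) \<and> red n (R @ [a]) \<and> kr_bump a R = (R', a')"

lemma kr_step_ck: assumes "kr_step n R a R' a'" shows "ck (R @ [a]) (a' # R')"
proof (cases "a = 0 \<and> subseq [1,0,1] R")
  case True
  then show ?thesis
    using assms kr_bump_exceptional[of R] by (auto simp: kr_step_def kr_bump_def)
next
  case False
  then show ?thesis
    using assms kr_bump_row_ins unfolding kr_step_def by metis
qed

lemma kr_step_red: "kr_step n R a R' a' \<Longrightarrow> red n (a' # R')"
  using kr_step_ck red_ck unfolding kr_step_def by blast

lemma kr_step_length: "kr_step n R a R' a' \<Longrightarrow> length R' = length R"
  using kr_step_ck unfolding ck_def by fastforce

lemma kr_step_cases: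
  assumes "kr_step n R a R' a'"
  obtains "a = 0" "a' = 0" "R' = R" "subseq [1,0,1] R"
  | c D' I' where "\<not> (a = 0 \<and> subseq [1,0,1] R)" "R' = D' @ I'" "row_ins (inc_part R) a c I'"
    "row_ins (rev D') a' c (rev (dec_part R))" "inc I'" "dcr D'"
proof (cases "a = 0 \<and> subseq [1,0,1] R")
  case True
  then show ?thesis
    using assms that(1) by (auto simp: kr_step_def kr_bump_def)
next
  case False
  then show ?thesis
    using assms that(2) kr_bump_row_ins[of R a n R' a'] unfolding kr_step_def by metis
qed

text \<open>The two halves are monotone, so only equal letters at the joint could spoil unimodality;
  \<open>a' # R'\<close> is reduced and excludes them.\<close>

lemma kr_step_unimodal: assumes "kr_step n R a R' a'" shows "unimodal R'"
  using assms
proof (cases rule: kr_step_cases)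
  case (2 c D' I')
  have "last D' \<noteq> hd I'" if "D' \<noteq> []" "I' \<noteq> []"
  proof -
    have "a' # R' = (a' # butlast D') @ last D' # hd I' # tl I'"
      using that 2(2) by simp
    then show ?thesis
      using red_distinct_adj kr_step_red[OF assms] by metis
  qed
  then show ?thesis
    using unimodal_split[OF 2(6,5)] 2(2) by blast
qed (use assms in \<open>auto simp: kr_step_def\<close>)

lemma kr_step_bump:
  assumes "kr_step n R a R' a'" "\<not> (a = 0 \<and> subseq [1,0,1] R)"
  shows "bump R a R' a'"
  using assms(1)
proof (cases rule: kr_step_cases)
  case (2 c D' I')
  have "unimodal R" using assms by (simp add: kr_step_def)
  then show ?thesis
    using 2 inc_part_inc[of R] dcr_dec_part[of R] dec_part_inc_part[of R] unfolding bump_def by metis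
qed (use assms in auto)

text \<open>Two ordinary steps are separated by \<open>bump_inj\<close>; an ordinary and an
  exceptional one never share an outcome, and two exceptional ones leave the row as it is.\<close>

lemma kr_step_inj:
  assumes "kr_step n R a R' a'" "kr_step n S b R' a'"
  shows "R = S \<and> a = b"
proof -
  have uni: "unimodal R" "unimodal S" "unimodal R'"
    using assms kr_step_unimodal[OF assms(1)] by (simp_all add: kr_step_def)
  have *: "\<not> (a = 0 \<and> subseq [1,0,1] R)"
    if "kr_step n R a R' a'" "\<not> (b = 0 \<and> subseq [1,0,1] S)" "kr_step n S b R' a'" for R a S b
    using that(1)
  proof (cases rule: kr_step_cases)
    case 1
    have "unimodal S" "unimodal R'" "bump S b R' a'"
      using that(3) kr_step_unimodal[OF that(3)] kr_step_bump[OF that(3,2)] by (simp_all add: kr_step_def)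
    then show ?thesis
      using bump_nonexceptional[of S b R'] 1 that(2) by simp
  qed auto
  show ?thesis
  proof (cases "a = 0 \<and> subseq [1,0,1] R")
    case True
    then have "b = 0 \<and> subseq [1,0,1] S"
      using *[of R a b S] assms by blast
    then show ?thesis
      using True assms unfolding kr_step_def kr_bump_def by simp
  next
    case False
    then have "\<not> (b = 0 \<and> subseq [1,0,1] S)"
      using *[of S b a R] assms by blast
    then show ?thesis
      using bump_inj[of R a R' a' S b] kr_step_bump[OF assms(1)] kr_step_bump[OF assms(2)] False uni by blast
  qed
qed


section \<open>Peaks and maximal unimodal subwords\<close>

text \<open>The ascent \<open>a < b\<close> is inherited by the letters bumped from the increasing
  parts, \<open>c < c'\<close>. Since \<open>c\<close> has entered the decreasing part, the second
  step bumps a letter \<open>b' \<ge> c > a'\<close>. After an exceptional first step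
  \<open>a' = 0\<close>.\<close>

lemma kr_step_peak_up:
  assumes "kr_step n R a R' a'" "kr_step n R' b R'' b'" "a < b"
  shows "a' \<le> b'"
  using assms(1)
proof (cases rule: kr_step_cases)
  case (2 c D' I')
  note A = 2
  have uni: "unimodal R" "unimodal R'" using assms by (simp_all add: kr_step_def)
  have incI: "inc (inc_part R)" "inc (inc_part R')"
    using uni inc_part_inc by auto
  have D: "dcr (dec_part R')" by (rule dcr_dec_part)
  have "D' \<noteq> []" using row_ins_mem[OF A(4)] by auto
  have dec': "dec_part R' = D' \<or> dec_part R' = D' @ [hd I'] \<and> I' \<noteq> []"
    using dec_part_append[OF A(6,5) \<open>D' \<noteq> []\<close>] A(2) by auto
  have "set (inc_part R') \<subseteq> set I'"
    using dec' dec_part_inc_part[of R'] A(2)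
    by (metis append.assoc same_append_eq set_append Un_upper2 order_refl)
  from assms(2) show ?thesis
  proof (cases rule: kr_step_cases)
    case 1
    then show ?thesis using assms(3) by simp
  next
    case (2 c' E J)
    have c': "b < c'" "c' \<in> set I'"
      using row_ins_less[OF 2(3)] row_ins_mem[OF 2(3)] \<open>set (inc_part R') \<subseteq> set I'\<close> by auto
    have "c < c'"
    proof (cases "a \<in> set (inc_part R)")
      case True
      then show ?thesis
        using row_ins_eq[OF A(3) incI(1)] assms(3) c'(1) by simp
    next
      case False
      then have "c' \<noteq> c" using row_ins_set_ne[OF A(3) incI(1)] c'(2) by blast
      then show ?thesis
        using row_ins_next(2)[OF A(3) incI(1)] c' assms(3) by force
    qed
    moreover have "c \<in> set (rev (dec_part R'))"
      using row_ins_mem[OF A(4)] dec' by auto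
    moreover have "inc (rev E)" using 2 by (simp add: sorted_wrt_rev)
    ultimately have "c \<le> b'"
      using row_ins_next(2)[OF 2(4)] by simp
    then show ?thesis
      using row_ins_less[OF A(4)] by simp
  qed
qed simp

text \<open>If a descent \<open>a > b\<close> is turned into an ascent \<open>a' < b'\<close>, then no later letter can be bumped below \<open>b'\<close>.\<close>

lemma kr_step_floor:
  assumes "kr_step n R a R' a'" "kr_step n R' b R'' b'" "b < a" "a' < b'"
  shows "\<exists>x\<in>set (dec_part R''). b' \<le> x \<and> (\<forall>y\<in>set (inc_part R''). x < y)"
  using assms(1)
proof (cases rule: kr_step_cases)
  case 1
  then show ?thesis using assms(3) by simp
next
  case (2 c D' I')
  note A = 2
  have uni: "unimodal R" "unimodal R'" using assms by (simp_all add: kr_step_def)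
  have incI: "inc (inc_part R)" "inc (inc_part R')"
    using uni inc_part_inc by auto
  have "D' \<noteq> []" using row_ins_mem[OF A(4)] by auto
  have incD': "inc (rev D')" using A(6) by (simp add: sorted_wrt_rev)
  define E where "E = dec_part R'"
  define J where "J = inc_part R'"
  \<comment> \<open>\<open>E\<close> and \<open>J\<close> are the canonical halves of the middle
    row; they agree with \<open>D'\<close> and \<open>I'\<close> except that the minimum
    \<open>h\<close> may have changed sides.\<close>
  have EJ: "E = D' \<and> J = I' \<or> (\<exists>h. I' = h # J \<and> E = D' @ [h] \<and> h < last D')"
  proof (cases "I' \<noteq> [] \<and> hd I' < last D'")
    case True
    then have "E = D' @ [hd I']"
      using dec_part_append[OF A(6,5) \<open>D' \<noteq> []\<close>] A(2) by (simp add: E_def)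
    moreover from this have "J = tl I'"
      using dec_part_inc_part[of R'] A(2) True unfolding E_def J_def
      by (metis append.assoc append_Cons append_Nil hd_Cons_tl list.sel(3) same_append_eq)
    ultimately show ?thesis using True by (metis hd_Cons_tl)
  next
    case False
    then have "E = D'"
      using dec_part_append[OF A(6,5) \<open>D' \<noteq> []\<close>] A(2) by (auto simp: E_def)
    then show ?thesis
      using dec_part_inc_part[of R'] A(2) unfolding E_def J_def by simp
  qed
  from assms(2) show ?thesis
  proof (cases rule: kr_step_cases)
    case 1
    then show ?thesis using assms(4) by simp
  next
    case (2 c' E' J')
    note B = 2
    have insJ: "row_ins J b c' J'" and insE: "row_ins (rev E') b' c' (rev E)"
      using B(3,4) by (simp_all add: E_def J_def)
    have incE': "inc (rev E')" using B(6) by (simp add: sorted_wrt_rev)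
    have incE: "inc (rev E)" using row_ins_inc[OF insE] incE' by simp
    have incJ: "inc J" using incI by (simp add: J_def)
    have c': "b < c'" "c' \<in> set J" "b \<in> set J'" "b' < c'" "b' \<in> set E" "c' \<in> set E'"
      using row_ins_less[OF insJ] row_ins_mem[OF insJ] row_ins_less[OF insE] row_ins_mem[OF insE] by auto
    have "E' \<noteq> []" "J' \<noteq> []" using c' by auto
    have next_c': "\<forall>x\<in>set J. b < x \<longrightarrow> c' \<le> x"
      using row_ins_next(1)[OF insJ incJ] .
    have mem: "a \<in> set I'" "a < c" "c \<in> set D'" "a' < c"
      using row_ins_mem[OF A(3)] row_ins_less[OF A(3)] row_ins_mem[OF A(4)] row_ins_less[OF A(4)] by auto
    have above: "\<forall>x\<in>set D'. a' < x \<longrightarrow> c \<le> x"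
      using row_ins_next(1)[OF A(4) incD'] by simp
    \<comment> \<open>If nothing changed sides, \<open>b < a\<close> gives
      \<open>c' \<le> a < c\<close>, so \<open>b'\<close> would be a letter of \<open>D'\<close>
      strictly between \<open>a'\<close> and \<open>c\<close>, where there is none.\<close>
    have "\<exists>h. I' = h # J \<and> E = D' @ [h] \<and> h < last D'"
    proof (rule ccontr)
      assume "\<not> ?thesis"
      then have "E = D'" "J = I'" using EJ by auto
      then have "c' \<le> a" using next_c' mem(1) assms(3) by simp
      then have "b' < c" using c'(4) mem(2) by simp
      then show False
        using above c'(5) \<open>E = D'\<close> assms(4) by force
    qed
    then obtain h where h: "I' = h # J" "E = D' @ [h]" "h < last D'" by blast
    have hJ: "\<forall>x\<in>set J. h < x" using A(5) h(1) by (simp add: inc_set)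
    have hD: "\<forall>x\<in>set D'. h < x" using dcr_last_le[OF A(6)] h(3) by force
    have shift: ?thesis
      if min: "\<forall>x\<in>set E'. hd J' < x" and x: "x = c' \<or> x = hd J'" "b' \<le> x" "\<forall>y\<in>set (tl J'). x < y" for x
    proof -
      have "hd J' < last E'" using min \<open>E' \<noteq> []\<close> by simp
      then have "dec_part R'' = E' @ [hd J']"
        using dec_part_append[OF B(6,5) \<open>E' \<noteq> []\<close>] B(2) \<open>J' \<noteq> []\<close> by simp
      moreover from this have "inc_part R'' = tl J'"
        using dec_part_inc_part[of R''] B(2) \<open>J' \<noteq> []\<close>
        by (metis append.assoc append_Cons append_Nil hd_Cons_tl same_append_eq)
      ultimately show ?thesis using x c'(6) by (intro bexI[of _ x]) auto
    qed
    have first: "\<forall>y\<in>set (tl J'). c' < y" "hd J' = b" if low: "\<forall>x\<in>set J. b < x"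
    proof -
      obtain I1 I2 where "J = I1 @ c' # I2" "J' = I1 @ b # I2" "\<forall>x\<in>set I1. x < b" "\<forall>x\<in>set I2. c' < x"
        using insJ low unfolding row_ins_def by auto
      moreover from this have "I1 = []" using low by (cases I1) (auto dest: less_asym)
      ultimately show "\<forall>y\<in>set (tl J'). c' < y" "hd J' = b" by auto
    qed
    have memE': "x \<in> set E \<or> x = c'" if "x \<in> set E'" for x
    proof (cases "b' \<in> set (rev E')")
      case True
      then show ?thesis using row_ins_eq[OF insE incE'] that by simp
    next
      case False
      then show ?thesis using row_ins_set_ne[OF insE incE'] that by auto
    qed
    \<comment> \<open>If \<open>c' \<ge> c\<close>, then \<open>a\<close> is not in
      \<open>J\<close>, so \<open>h = a\<close>; now \<open>b\<close> becomes the new minimum and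
      \<open>c'\<close> is the floor. If \<open>c' < c\<close>, then \<open>b'\<close> cannot come
      from \<open>D'\<close>, so \<open>b' = h\<close>; the floor is the new minimum or
      \<open>c'\<close>.\<close>
    show ?thesis
    proof (cases "c' < c")
      case False
      then have "a \<notin> set J" using next_c' mem(2) assms(3) by force
      then have "h = a" using mem(1) h(1) by simp
      then have bJ: "\<forall>x\<in>set J. b < x" using hJ assms(3) by force
      have "hd J' < x" if "x \<in> set E'" for x
        using memE'[OF that] h(2) hD \<open>h = a\<close> assms(3) c'(1) first(2)[OF bJ] by force
      then show ?thesis
        using shift[of c'] first(1)[OF bJ] c'(4) by simp
    next
      case True
      have "b' \<notin> set D'"
        using above assms(4) True c'(4) by force
      then have "b' = h" using c'(5) h(2) by simp
      have "c' \<notin> set D'" using above assms(4) True c'(4) by force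
      have E'_ge: "c' \<le> x" if "x \<in> set E'" for x
      proof (cases "b' \<in> set (rev E')")
        case True
        then have "rev E = rev E'" "c' = Suc b'" using row_ins_eq[OF insE incE'] by simp_all
        then have "c' \<in> set E" using c'(6) by (metis set_rev)
        then have "c' = h" using h(2) \<open>c' \<notin> set D'\<close> by simp
        then show ?thesis using \<open>b' = h\<close> c'(4) by simp
      next
        case F: False
        then have "x \<noteq> b'" using that by auto
        then have "x \<in> set D' \<or> x = c'" using memE'[OF that] h(2) \<open>b' = h\<close> by auto
        moreover have "c \<le> x" if "x \<in> set D'"
          using above that hD \<open>b' = h\<close> assms(4) by force
        ultimately show ?thesis using True by force
      qed
      have "hd J' \<le> b" using inc_hd_le[OF B(5) c'(3)] .
      then have min: "\<forall>x\<in>set E'. hd J' < x" using E'_ge c'(1) by force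
      show ?thesis
      proof (cases "h < hd J'")
        case True
        moreover have "\<forall>y\<in>set (tl J'). hd J' < y"
          using B(5) \<open>J' \<noteq> []\<close> by (cases J') (auto simp: inc_set)
        ultimately show ?thesis
          using shift[of "hd J'"] min \<open>b' = h\<close> by simp
      next
        case False
        have "hd J' \<in> set J'" using \<open>J' \<noteq> []\<close> by simp
        moreover have "hd J' \<notin> set J" using hJ False by auto
        ultimately have "hd J' = b"
          using row_ins_eq[OF insJ incJ] row_ins_set_ne[OF insJ incJ] by (cases "b \<in> set J") auto
        then have "\<forall>x\<in>set J. b < x" using hJ False by force
        then show ?thesis
          using shift[of c'] first(1) min c'(4) by simp
      qed
    qed
  qed
qed

text \<open>An ascent \<open>b < c\<close> would give \<open>b' \<le> c'\<close> by
  \<open>kr_step_peak_up\<close>. A descent \<open>b < a\<close> would leave a floor in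
  \<open>R2\<close> that keeps the next bumped letter at \<open>b'\<close> or above.\<close>

lemma kr_step_peak:
  assumes "kr_step n R a R1 a'" "kr_step n R1 b R2 b'" "kr_step n R2 c R3 c'"
    and "a \<noteq> b" "b \<noteq> c" "a' < b'" "c' < b'"
  shows "a < b \<and> c < b"
proof
  show "c < b"
    using kr_step_peak_up[OF assms(2,3)] assms(5,7) by force
  show "a < b"
  proof (rule ccontr)
    assume "\<not> a < b"
    then have "b < a" using assms(4) by simp
    then obtain x where x: "x \<in> set (dec_part R2)" "b' \<le> x" "\<forall>y\<in>set (inc_part R2). x < y"
      using kr_step_floor[OF assms(1,2)] assms(6) by blast
    have "b' \<le> c'"
      using assms(3)
    proof (cases rule: kr_step_cases)
      case 1
      obtain X Y where R2: "R2 = X @ [1,0,1] @ Y" "dcr (X @ [1])" "inc (1 # Y)"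
        using subseq_101_unimodal[OF 1(4)] assms(3) unfolding kr_step_def by blast
      \<comment> \<open>An exceptional third step is impossible: \<open>1\<close> starts the
        increasing part, so the floor would be \<open>0\<close>, and \<open>b'\<close> could not
        exceed \<open>a'\<close>.\<close>
      have "dec_part ((X @ [1,0]) @ 1 # Y) = X @ [1,0]"
        using dec_part_append[of "X @ [1,0]" "1 # Y"] R2(2,3) by (force simp: dcr_set)
      then have "inc_part R2 = 1 # Y"
        using dec_part_inc_part[of R2] R2(1) by simp
      then show ?thesis using x assms(6) by auto
    next
      case (2 d D' I')
      have "x < d" using row_ins_mem[OF 2(3)] x(3) by auto
      moreover have "inc (rev D')" using 2(6) by (simp add: sorted_wrt_rev)
      ultimately show ?thesis
        using row_ins_next(2)[OF 2(4)] x(1,2) by force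
    qed
    then show False using assms(7) by simp
  qed
qed

lemma kr_step_le_last:
  assumes "kr_step n R a R' a'" shows "a \<le> last R'"
  using assms
proof (cases rule: kr_step_cases)
  case (2 c D' I')
  have "a \<in> set I'" using row_ins_mem[OF 2(3)] by simp
  then obtain J y where "I' = J @ [y]" by (cases I' rule: rev_cases) auto
  then show ?thesis
    using \<open>a \<in> set I'\<close> 2(2,5) by (auto simp: inc_set)
qed simp

section \<open>Lengths of unimodal subwords\<close>

definition unimodal_bound :: "nat \<Rightarrow> nat list \<Rightarrow> bool" where
  "unimodal_bound k w \<longleftrightarrow> (\<forall>v. subseq v w \<longrightarrow> unimodal v \<longrightarrow> length v \<le> k)"

lemma unimodal_bound_ck: "unimodal_bound k (u @ x @ v) \<Longrightarrow> ck x y \<Longrightarrow> unimodal_bound k (u @ y @ v)"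
  unfolding unimodal_bound_def ck_def by metis

lemma unimodal_bound_Cons: "unimodal_bound k (a # w) \<Longrightarrow> unimodal_bound k w"
  unfolding unimodal_bound_def by auto

lemma subseq_snocD: "subseq v (w @ [a]) \<Longrightarrow> subseq v w \<or> (\<exists>u. v = u @ [a] \<and> subseq u w)"
proof -
  have single: "u = [] \<or> u = [a]" if "subseq u [a]" for u
    using that by (cases u) (auto split: if_splits)
  assume "subseq v (w @ [a])"
  then obtain v1 v2 where "v = v1 @ v2" "subseq v1 w" "subseq v2 [a]"
    by (auto elim: subseq_appendE)
  then show ?thesis using single[of v2] by auto
qed

lemma sorted_wrt_subseq: "subseq u w \<Longrightarrow> sorted_wrt P w \<Longrightarrow> sorted_wrt P u"
  by (induction rule: list_emb.induct) (auto simp: sorted_wrt.simps(2) dest: list_emb_set)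

lemma unimodal_bound_snoc: "unimodal_bound k w \<Longrightarrow> unimodal_bound (Suc k) (w @ [a])"
  unfolding unimodal_bound_def using unimodal_append_left by (fastforce dest!: subseq_snocD)

text \<open>A unimodal subword ending in \<open>a\<close> is exchanged for one of the same length that avoids \<open>a\<close>.\<close>

lemma unimodal_bound_bump:
  assumes R: "unimodal R" "\<not> unimodal (R @ [a])" "red n (R @ [a])"
    and bound: "unimodal_bound k (S @ R)"
  shows "unimodal_bound k (S @ R @ [a])"
proof -
  note N = not_unimodal_snoc[OF R]
  define t where "t = last R"
  define D where "D = dec_part R"
  define I where "I = inc_part R"
  have RDI: "R = D @ I" by (simp add: D_def I_def dec_part_inc_part)
  have D: "dcr D" and I: "inc I" using dcr_dec_part[of R] inc_part_inc[OF R(1)] by (simp_all add: D_def I_def)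
  have "D \<noteq> []" "I \<noteq> []" using N by (simp_all add: D_def I_def)
  have tI: "t \<in> set I" using N(5) last_in_set[OF \<open>I \<noteq> []\<close>] by (simp add: I_def t_def)
  have DI: "last D < y" if "y \<in> set I" for y
    using inc_hd_le[OF I that] N(6) unfolding D_def I_def by simp
  have "a < t" using N by (simp add: t_def)
  have dD: "D = butlast D @ [last D]" using \<open>D \<noteq> []\<close> by simp
  have "length v \<le> k" if v: "subseq v (S @ R @ [a])" "unimodal v" for v
  proof -
    have "\<exists>v'. subseq v' (S @ R) \<and> unimodal v' \<and> length v' = length v"
    proof (cases "subseq v (S @ R)")
      case True
      then show ?thesis using v by blast
    next
      case False
      then obtain u where u: "v = u @ [a]" "subseq u (S @ R)"
        using subseq_snocD[of v "S @ R" a] v(1) by auto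
      then obtain u1 u2 where u12: "u = u1 @ u2" "subseq u1 S" "subseq u2 R"
        by (auto elim: subseq_appendE)
      have single: "subseq [x] R" if "x \<in> set D \<or> x \<in> set I" for x
        using that RDI by (auto simp: subseq_singleton_left)
      \<comment> \<open>Only the part of the subword inside the row is replaced; it has to gain one
        letter to make up for \<open>a\<close>.\<close>
      have combine: ?thesis if "subseq w R" "unimodal (u1 @ w)" "length w = Suc (length u2)" for w
        using that u(1) u12 by (intro exI[of _ "u1 @ w"]) (auto intro: list_emb_append_mono)
      have "subseq [t] R" using single tI by blast
      consider "u = []" | "u \<noteq> []" "last u < a" "unimodal u" | "u \<noteq> []" "a < last u" "dcr u"
        using v(2) u(1) by (auto simp: unimodal_snoc)
      then show ?thesis
      proof cases
        case 1
        then show ?thesis using combine[of "[t]"] \<open>subseq [t] R\<close> u12(1) by (simp add: unimodal_Cons)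
      next
        case 2
        have "subseq (u2 @ [t]) R"
        proof (cases "u2 = []")
          case False
          then have "last u2 \<noteq> t" using 2 u12(1) \<open>a < t\<close> by simp
          moreover have "R = butlast R @ [t]" using N(1) by (simp add: t_def)
          ultimately have "subseq u2 (butlast R)"
            using subseq_snocD[of u2 "butlast R" t] u12(3) by auto
          then show ?thesis
            using \<open>R = butlast R @ [t]\<close> by (metis list_emb_append_mono subseq_order.order_refl)
        qed (use \<open>subseq [t] R\<close> in simp)
        moreover have "unimodal (u1 @ u2 @ [t])"
          using 2 \<open>a < t\<close> u12(1) unimodal_snoc[of u t] by simp
        ultimately show ?thesis using combine[of "u2 @ [t]"] by simp
      next
        case 3
        \<comment> \<open>A falling \<open>u\<close> meets the increasing part in at most one letter
          \<open>i\<close>, and \<open>last D\<close> is below all letters there. If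
          \<open>i\<close> occurs, \<open>last D\<close> is put before it; otherwise one of
          \<open>t\<close> and \<open>last D\<close> that differs from \<open>last u\<close> is
          appended.\<close>
        obtain E F where EF: "u2 = E @ F" "subseq E D" "subseq F I"
          using u12(3) RDI by (auto elim: subseq_appendE)
        have dcrs: "dcr u1" "dcr E" "dcr F" "dcr (u1 @ E)" "dcr (u1 @ E @ F)"
          using 3(3) u12(1) EF(1) by (auto simp: dcr_set)
        have "inc F" using EF(3) I by (metis sorted_wrt_subseq)
        show ?thesis
        proof (cases F)
          case Nil
          show ?thesis
          proof (cases "E = []")
            case True
            have "\<exists>r. (r \<in> set D \<or> r \<in> set I) \<and> r \<noteq> last u"
              using tI DI[OF tI] \<open>D \<noteq> []\<close> by (metis last_in_set less_irrefl)
            then obtain r where r: "subseq [r] R" "r \<noteq> last u" using single by blast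
            have "unimodal (u1 @ [r])"
              using r(2) 3(1,3) u12(1) EF(1) Nil True
              by (auto simp: unimodal_snoc intro: dcr_imp_unimodal)
            then show ?thesis
              using combine[of "[r]"] r EF(1) Nil True by simp
          next
            case False
            show ?thesis
            proof (cases "last u = t")
              case False
              have "subseq (E @ [t]) R"
                using EF(2) tI RDI by (auto intro!: list_emb_append_mono simp: subseq_singleton_left)
              moreover have "unimodal (u @ [t])"
                using False 3(3) by (auto simp: unimodal_snoc intro: dcr_imp_unimodal)
              ultimately show ?thesis
                using combine[of "E @ [t]"] u12(1) EF(1) Nil by simp
            next
              case True
              have "last E \<noteq> last D"
                using True DI[OF tI] u12(1) EF(1) Nil False by simp
              then have "subseq E (butlast D)"
                using subseq_snocD[of E "butlast D" "last D"] EF(2) dD by auto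
              then have "subseq (E @ [last D]) D"
                using dD by (metis list_emb_append_mono subseq_order.order_refl)
              then have "subseq (E @ [last D]) R"
                using RDI by (simp add: subseq_rev_drop_many)
              moreover have "unimodal (u @ [last D])"
                using True DI[OF tI] 3(3) by (auto simp: unimodal_snoc)
              ultimately show ?thesis
                using combine[of "E @ [last D]"] u12(1) EF(1) Nil by simp
            qed
          qed
        next
          case (Cons i F')
          then have "F' = []"
            using dcrs(3) \<open>inc F\<close> by (cases F') (auto simp: inc_set dcr_set)
          have iI: "i \<in> set I" using EF(3) Cons \<open>F' = []\<close> by (simp add: subseq_singleton_left)
          have big: "\<forall>x\<in>set (u1 @ E). i < x"
            using dcrs(5) Cons \<open>F' = []\<close> by (auto simp: dcr_set)
          have "E = [] \<or> last E \<noteq> last D"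
            using big DI[OF iI] last_in_set[of E] by (metis Un_iff less_asym set_append)
          then have "subseq E (butlast D)"
            using subseq_snocD[of E "butlast D" "last D"] EF(2) dD by auto
          then have "subseq (E @ [last D]) D"
            using dD by (metis list_emb_append_mono subseq_order.order_refl)
          then have "subseq ((E @ [last D]) @ [i]) R"
            using iI RDI by (auto intro!: list_emb_append_mono simp: subseq_singleton_left simp del: append_assoc)
          moreover have "dcr ((u1 @ E) @ [last D])"
            using dcrs(4) big DI[OF iI] by (auto simp: dcr_append_set intro: less_trans[of _ i])
          then have "unimodal ((u1 @ E) @ last D # [i])"
            unfolding unimodal_append_Cons dcr_snoc
            using DI[OF iI] dcrs(4) by (auto simp: unimodal_Cons)
          ultimately show ?thesis
            using combine[of "E @ [last D, i]"] EF(1) Cons \<open>F' = []\<close> by simp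
        qed
      qed
    qed
    then show ?thesis
      using bound unfolding unimodal_bound_def by metis
  qed
  then show ?thesis by (simp add: unimodal_bound_def)
qed

text \<open>If the word falls at the joint, \<open>last S\<close> in front of \<open>R\<close> is
  unimodal, against the bound. If it rises, \<open>hd R\<close> behind \<open>S\<close> is unimodal,
  and the bound gives one letter more than \<open>S\<close> has.\<close>

lemma unimodal_bound_length:
  assumes "unimodal S" "unimodal R" "S \<noteq> []" "R \<noteq> []" "last S \<noteq> hd R"
    and "unimodal_bound (length R) (S @ R)"
  shows "length S < length R"
proof -
  have bound: "length v \<le> length R" if "subseq v (S @ R)" "unimodal v" for v
    using that assms(6) unfolding unimodal_bound_def by blast
  have "last S < hd R \<or> hd R < last S" using assms(5) by auto
  then show ?thesis
  proof
    assume "last S < hd R"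
    then have "unimodal (S @ [hd R])"
      using assms(1) by (simp add: unimodal_snoc)
    moreover have "subseq (S @ [hd R]) (S @ R)"
      using assms(4) by (intro list_emb_append_mono) (auto simp: subseq_singleton_left)
    ultimately show ?thesis using bound by fastforce
  next
    assume "hd R < last S"
    then have "unimodal ([last S] @ R)"
      using assms(2) by (simp add: unimodal_Cons)
    moreover have "subseq ([last S] @ R) (S @ R)"
      using assms(3) by (intro list_emb_append_mono) (auto simp: subseq_singleton_left)
    ultimately show ?thesis using bound by fastforce
  qed
qed


section \<open>Kraskiewicz insertion of a letter\<close>

text \<open>\<open>R\<close> is a subword of \<open>S @ R\<close>, so for a unimodal
  \<open>R\<close> the bound says that it is a unimodal subword of maximal length.\<close>

fun stacked :: "nat list list \<Rightarrow> bool" where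
  "stacked [] = True"
| "stacked [R] = True"
| "stacked (R # S # P) = (unimodal_bound (length R) (S @ R) \<and> stacked (S # P))"

definition decomp_tab :: "nat \<Rightarrow> nat list list \<Rightarrow> bool" where
  "decomp_tab n P \<longleftrightarrow> (\<forall>R\<in>set P. R \<noteq> [] \<and> unimodal R) \<and> stacked P \<and> red n (concat (rev P))"

lemma decomp_tab_ConsD:
  assumes "decomp_tab n (R # P)"
  shows "unimodal R" "R \<noteq> []" "decomp_tab n P"
  using assms red_appendD1[of n "concat (rev P)" R]
  by (auto simp: decomp_tab_def) (cases P; simp)

lemma decomp_tab_dcr: "decomp_tab n P \<Longrightarrow> dcr (map length P)"
proof (induction P rule: stacked.induct)
  case (3 R S P)
  have "red n (concat (rev P) @ (S @ R))" using 3(2) by (simp add: decomp_tab_def)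
  then have "red n (S @ R)" by (rule red_appendD2)
  moreover have ne: "S \<noteq> []" "R \<noteq> []" and "unimodal R" "unimodal S" "unimodal_bound (length R) (S @ R)"
    using 3(2) by (auto simp: decomp_tab_def)
  moreover from \<open>red n (S @ R)\<close> ne have "last S \<noteq> hd R"
  proof -
    have "S @ R = butlast S @ last S # hd R # tl R"
      using \<open>S \<noteq> []\<close> \<open>R \<noteq> []\<close> by (cases S rule: rev_cases) auto
    then show ?thesis using red_distinct_adj \<open>red n (S @ R)\<close> by metis
  qed
  ultimately have "length S < length R"
    by (intro unimodal_bound_length) auto
  moreover have "dcr (map length (S # P))"
    using 3 decomp_tab_ConsD(3) by blast
  ultimately show ?case by (simp add: dcr_Cons)
qed simp_all

section \<open>Boxes of a tableau given by its rows\<close>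

fun row_boxes :: "nat \<Rightarrow> nat list list \<Rightarrow> box set" where
  "row_boxes i [] = {}"
| "row_boxes i (R # P) = {(i, c) |c. i \<le> c \<and> c < i + length R} \<union> row_boxes (Suc i) P"

lemma row_boxes_ge: "b \<in> row_boxes i P \<Longrightarrow> i \<le> fst b \<and> fst b \<le> snd b"
  by (induction i P rule: row_boxes.induct) auto

lemma finite_row_boxes: "finite (row_boxes i P)"
proof (induction i P rule: row_boxes.induct)
  case (2 i R P)
  have "{(i, c) |c. i \<le> c \<and> c < i + length R} = Pair i ` {i..<i + length R}" by auto
  then show ?case using 2 by simp
qed simp

lemma row_boxes_closed:
  assumes "dcr (map length P)" "(r, c) \<in> row_boxes i P"
  shows "r < c \<Longrightarrow> (r, c - 1) \<in> row_boxes i P" "i < r \<Longrightarrow> (r - 1, c) \<in> row_boxes i P"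
proof -
  have "(r < c \<longrightarrow> (r, c - 1) \<in> row_boxes i P) \<and> (i < r \<longrightarrow> (r - 1, c) \<in> row_boxes i P)"
    using assms
  proof (induction i P rule: row_boxes.induct)
    case (2 i R P)
    show ?case
    proof (cases "(r, c) \<in> row_boxes (Suc i) P")
      case False
      then show ?thesis using 2 by auto
    next
      case True
      then have IH: "(r < c \<longrightarrow> (r, c - 1) \<in> row_boxes (Suc i) P) \<and> (Suc i < r \<longrightarrow> (r - 1, c) \<in> row_boxes (Suc i) P)"
        using 2 by (auto simp: dcr_Cons)
      have "Suc i \<le> r" "r \<le> c" using row_boxes_ge[OF True] by auto
      have "(r - 1, c) \<in> row_boxes i (R # P)" if "r = Suc i"
      proof -
        obtain S P' where P: "P = S # P'" using True by (cases P) auto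
        then have "length S < length R" using 2(2) by (simp add: dcr_Cons)
        moreover have "c < Suc i + length S"
          using True that P row_boxes_ge[of "(r, c)" "Suc (Suc i)" P'] by auto
        ultimately show ?thesis using that \<open>r \<le> c\<close> by auto
      qed
      with IH \<open>Suc i \<le> r\<close> show ?thesis
        by (cases "r = Suc i") auto
    qed
  qed simp
  then show "r < c \<Longrightarrow> (r, c - 1) \<in> row_boxes i P" "i < r \<Longrightarrow> (r - 1, c) \<in> row_boxes i P" by auto
qed

definition ins_row :: "nat list \<Rightarrow> nat \<Rightarrow> nat list" where
  "ins_row R a = (if unimodal (R @ [a]) then R @ [a] else fst (kr_bump a R))"

lemma kr_insert_hd:
  "kr_insert i a P = (P', bx) \<Longrightarrow> P' \<noteq> [] \<and> hd P' = ins_row (case P of [] \<Rightarrow> [] | R # _ \<Rightarrow> R) a"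
  by (cases P) (auto simp: ins_row_def unimodal_Cons split: if_splits prod.splits)

text \<open>The bound for \<open>S R\<close> survives appending \<open>a\<close>, and the moves
  carry it to \<open>S a' R'\<close>. If \<open>a'\<close> is bumped further, more moves give
  \<open>a'' S' R'\<close>, and the letter in front may be dropped.\<close>

lemma unimodal_bound_ins_row:
  assumes "kr_step n R a R' a'" "unimodal S" "red n (S @ a' # R')" "unimodal_bound (length R) (S @ R)"
  shows "unimodal_bound (length R') (ins_row S a' @ R')"
proof -
  have "unimodal_bound (length R) (S @ R @ [a])"
    using assms(1,4) unimodal_bound_bump unfolding kr_step_def by blast
  then have b: "unimodal_bound (length R') (S @ a' # R')"
    using unimodal_bound_ck[of _ S "R @ [a]" "[]" "a' # R'"] kr_step_ck[OF assms(1)] kr_step_length[OF assms(1)] by simp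
  show ?thesis
  proof (cases "unimodal (S @ [a'])")
    case True
    then show ?thesis using b by (simp add: ins_row_def)
  next
    case False
    obtain S' a'' where S': "kr_bump a' S = (S', a'')" by fastforce
    then have "kr_step n S a' S' a''"
      using False assms(2,3) red_appendD1[of n "S @ [a']" R'] by (simp add: kr_step_def)
    then have "ck (S @ [a']) (a'' # S')" by (rule kr_step_ck)
    then have "unimodal_bound (length R') (a'' # S' @ R')"
      using unimodal_bound_ck[of _ "[]" "S @ [a']" R' "a'' # S'"] b by simp
    then show ?thesis
      using unimodal_bound_Cons False S' by (simp add: ins_row_def)
  qed
qed

lemma kr_insert_Cons_cases:
  assumes "kr_insert i a (R # P) = (P', bx)" "decomp_tab n (R # P)" "red n (concat (rev (R # P)) @ [a])"
  obtains (stop) "unimodal (R @ [a])" "P' = (R @ [a]) # P" "bx = (i, i + length R)"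
  | (pass) R' a' Q where "kr_step n R a R' a'" "kr_insert (Suc i) a' P = (Q, bx)" "P' = R' # Q"
     "red n (concat (rev P) @ a' # R')" "red n (concat (rev P) @ [a'])"
proof (cases "unimodal (R @ [a])")
  case True
  then show ?thesis using assms stop by simp
next
  case False
  obtain R' a' where R': "kr_bump a R = (R', a')" by fastforce
  obtain Q bx' where Q: "kr_insert (Suc i) a' P = (Q, bx')" by (meson surj_pair)
  have eq: "P' = R' # Q" "bx = bx'"
    using assms(1) False R' Q by simp_all
  have red: "red n (concat (rev P) @ R @ [a])" using assms(3) by simp
  then have step: "kr_step n R a R' a'"
    using False R' decomp_tab_ConsD[OF assms(2)] red_appendD2 by (simp add: kr_step_def)
  have r: "red n (concat (rev P) @ a' # R')"
    using red_ck[OF red ck_left[OF kr_step_ck[OF step]]] .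
  then have "red n (concat (rev P) @ [a'])"
    using red_appendD1[of n "concat (rev P) @ [a']" R'] by simp
  then show ?thesis using pass step Q eq r by blast
qed

lemma kr_insert_decomp_tab:
  assumes "kr_insert i a P = (P', bx)" "decomp_tab n P" "red n (concat (rev P) @ [a])"
  shows "decomp_tab n P' \<and> ck (concat (rev P) @ [a]) (concat (rev P'))"
  using assms
proof (induction P arbitrary: i a P' bx)
  case Nil
  then show ?case by (auto simp: decomp_tab_def unimodal_Cons)
next
  case (Cons R P)
  note tab = decomp_tab_ConsD[OF Cons.prems(2)]
  from Cons.prems show ?case
  proof (cases rule: kr_insert_Cons_cases)
    case stop
    have "stacked ((R @ [a]) # P)"
    proof (cases P)
      case (Cons S P2)
      then have "unimodal_bound (length R) (S @ R)" "stacked (S # P2)"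
        using Cons.prems(2) by (auto simp: decomp_tab_def)
      then show ?thesis
        using unimodal_bound_snoc[of "length R" "S @ R" a] Cons by simp
    qed simp
    then show ?thesis
      using stop Cons.prems tab by (auto simp: decomp_tab_def)
  next
    case (pass R' a' Q)
    have IH: "decomp_tab n Q" "ck (concat (rev P) @ [a']) (concat (rev Q))"
      using Cons.IH[OF pass(2) tab(3) pass(5)] by auto
    have "ck (concat (rev P) @ R @ [a]) (concat (rev P) @ a' # R')"
      using ck_left[OF kr_step_ck[OF pass(1)]] .
    also have "ck (concat (rev P) @ a' # R') (concat (rev Q) @ R')"
      using ck_right[OF IH(2), of R'] by simp
    finally have ck: "ck (concat (rev (R # P)) @ [a]) (concat (rev P'))"
      using pass(3) by simp
    have R': "unimodal R'" "R' \<noteq> []"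
      using kr_step_unimodal[OF pass(1)] kr_step_length[OF pass(1)] tab(2) by auto
    define S where "S = (case P of [] \<Rightarrow> [] | S # _ \<Rightarrow> S)"
    have Q: "Q \<noteq> []" "hd Q = ins_row S a'"
      using kr_insert_hd[OF pass(2)] by (auto simp: S_def)
    have "unimodal_bound (length R') (ins_row S a' @ R')"
    proof (rule unimodal_bound_ins_row[OF pass(1)])
      show "unimodal S" using tab(3) by (auto simp: S_def decomp_tab_def split: list.splits)
      show "red n (S @ a' # R')"
        using pass(4) red_appendD2 by (cases P) (auto simp: S_def)
      show "unimodal_bound (length R) (S @ R)"
      proof (cases P)
        case Nil
        then show ?thesis using list_emb_length by (auto simp: S_def unimodal_bound_def)
      qed (use Cons.prems(2) in \<open>auto simp: S_def decomp_tab_def\<close>)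
    qed
    then have "stacked (R' # Q)"
      using IH(1) Q by (cases Q) (auto simp: decomp_tab_def)
    then have "decomp_tab n P'"
      using pass(3) IH(1) R' red_ck[OF Cons.prems(3) ck] by (auto simp: decomp_tab_def)
    with ck show ?thesis by blast
  qed
qed

lemma kr_insert_boxes:
  assumes "kr_insert i a P = (P', bx)" "decomp_tab n P" "red n (concat (rev P) @ [a])"
  shows "bx \<notin> row_boxes i P \<and> row_boxes i P' = insert bx (row_boxes i P) \<and> i \<le> fst bx"
  using assms
proof (induction P arbitrary: i a P' bx)
  case Nil
  then show ?case by auto
next
  case (Cons R P)
  note tab = decomp_tab_ConsD[OF Cons.prems(2)]
  from Cons.prems show ?case
  proof (cases rule: kr_insert_Cons_cases)
    case stop
    then show ?thesis using row_boxes_ge[of bx "Suc i" P] by auto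
  next
    case (pass R' a' Q)
    have "length R' = length R" using kr_step_length[OF pass(1)] .
    then show ?thesis
      using Cons.IH[OF pass(2) tab(3) pass(5)] pass(3) by auto
  qed
qed

text \<open>The row of the new box tells how many rows were passed; the steps are then undone from
  the deepest row upwards by \<open>kr_step_inj\<close>.\<close>

lemma kr_insert_inj:
  assumes "kr_insert i a P = (P', bx)" "decomp_tab n P" "red n (concat (rev P) @ [a])"
    and "kr_insert i b Q = (P', bx)" "decomp_tab n Q" "red n (concat (rev Q) @ [b])"
  shows "P = Q \<and> a = b"
  using assms
proof (induction P arbitrary: i a b P' bx Q)
  case Nil
  then have eq: "P' = [[a]]" "bx = (i, i)" by auto
  show ?case
  proof (cases Q)
    case Nil
    then show ?thesis using eq \<open>kr_insert i b Q = _\<close> by simp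
  next
    case (Cons S Q')
    then show ?thesis
      using eq \<open>kr_insert i b Q = _\<close> kr_insert_boxes[OF Nil.prems(4-6)] decomp_tab_ConsD(2)[of n S Q'] Nil.prems(5)
      by fastforce
  qed
next
  case (Cons R P)
  note tab = decomp_tab_ConsD[OF Cons.prems(2)]
  show ?case
  proof (cases Q)
    case Nil
    then have "bx = (i, i)" using Cons.prems by simp
    then show ?thesis
      using kr_insert_boxes[OF Cons.prems(1-3)] tab(2) by fastforce
  next
    case Q: (Cons S Q')
    note tabQ = decomp_tab_ConsD[OF Cons.prems(5)[unfolded Q]]
    from Cons.prems(1-3) show ?thesis
    proof (cases rule: kr_insert_Cons_cases)
      case stop
      from Cons.prems(4-6)[unfolded Q] show ?thesis
      proof (cases rule: kr_insert_Cons_cases)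
        case stop': stop
        then show ?thesis using stop Q by simp
      next
        case (pass R' a' Q2)
        then show ?thesis
          using kr_insert_boxes[OF pass(2) tabQ(3) pass(5)] stop by simp
      qed
    next
      case (pass R' a' P2)
      note pass1 = pass
      from Cons.prems(4-6)[unfolded Q] show ?thesis
      proof (cases rule: kr_insert_Cons_cases)
        case stop
        then show ?thesis
          using kr_insert_boxes[OF pass1(2) tab(3) pass1(5)] by simp
      next
        case (pass S' b' Q2)
        then have eq: "S' = R'" "Q2 = P2" using pass1 by auto
        have "P = Q' \<and> a' = b'"
          using Cons.IH[OF pass1(2) tab(3) pass1(5)] pass(2,5) tabQ(3) eq by blast
        moreover from this have "R = S \<and> a = b"
          using kr_step_inj[OF pass1(1)] pass(1) eq by blast
        ultimately show ?thesis using Q by simp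
      qed
    qed
  qed
qed

lemma kr_insert_red_snoc:
  assumes "kr_insert i a P = (P1, b1)" "decomp_tab n P" "red n (concat (rev P) @ a # w)"
  shows "decomp_tab n P1" "red n (concat (rev P) @ [a])" "red n (concat (rev P1) @ w)"
proof -
  show r: "red n (concat (rev P) @ [a])"
    using assms(3) red_appendD1[of n "concat (rev P) @ [a]" w] by simp
  then have "ck (concat (rev P) @ [a]) (concat (rev P1))" and t: "decomp_tab n P1"
    using kr_insert_decomp_tab[OF assms(1,2)] by auto
  from ck_right[OF this(1), of w] show "red n (concat (rev P1) @ w)"
    using assms(3) red_ck by simp
  show "decomp_tab n P1" by (rule t)
qed

lemma not_unimodal_snoc_dcr:
  "unimodal w \<Longrightarrow> w \<noteq> [] \<Longrightarrow> \<not> unimodal (w @ [c]) \<Longrightarrow> c \<noteq> last w \<Longrightarrow> c < last w \<and> \<not> dcr w"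
  by (auto simp: unimodal_snoc)

lemma unimodal_snoc_ascent:
  "unimodal (w @ [b]) \<Longrightarrow> \<not> dcr (w @ [b]) \<Longrightarrow> last w < b"
  by (auto simp: unimodal_snoc dcr_snoc)

text \<open>In the row where \<open>y\<close> is created the second letter stops and the third is
  bumped, which exhibits the peak there; \<open>kr_step_peak\<close> carries it back through the
  rows that all three letters have passed.\<close>

lemma kr_insert_peak:
  assumes "decomp_tab n P" "red n (concat (rev P) @ [a, b, c])"
    and "kr_insert i a P = (P1, x)" "kr_insert i b P1 = (P2, y)" "kr_insert i c P2 = (P3, z)"
    and "fst y \<le> fst x" "fst y < fst z"
  shows "a < b \<and> c < b"
  using assms
proof (induction P arbitrary: i a b c P1 P2 P3 x y z)
  case Nil
  have "a \<noteq> b" "b \<noteq> c"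
    using red_distinct_adj[of n "[]" a b "[c]"] red_distinct_adj[of n "[a]" b c "[]"] Nil.prems(2) by auto
  have P1: "P1 = [[a]]" "x = (i, i)" using Nil.prems by auto
  have "unimodal [a, b]" using \<open>a \<noteq> b\<close> by (auto simp: unimodal_Cons inc_Cons)
  then have P2: "P2 = [[a, b]]" "y = (i, Suc i)" using Nil.prems(4) P1 by auto
  then have "\<not> unimodal [a, b, c]"
    using Nil.prems(5,7) by (auto split: if_splits)
  then show ?case
    using \<open>a \<noteq> b\<close> \<open>b \<noteq> c\<close> by (auto simp: unimodal_Cons inc_Cons)
next
  case (Cons R P)
  note tab = decomp_tab_ConsD[OF Cons.prems(1)]
  note t1 = kr_insert_red_snoc[OF Cons.prems(3,1,2)]
  note t2 = kr_insert_red_snoc[OF Cons.prems(4) t1(1,3)]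
  note t3 = kr_insert_red_snoc[OF Cons.prems(5) t2(1,3)]
  have neq: "a \<noteq> b" "b \<noteq> c"
    using red_distinct_adj[of n "concat (rev (R # P))" a b "[c]"]
      red_distinct_adj[of n "concat (rev (R # P)) @ [a]" b c "[]"] Cons.prems(2) by auto
  have later: "i < fst bx" if "kr_insert (Suc i) a' Q = (Q', bx)" "decomp_tab n Q" "red n (concat (rev Q) @ [a'])" for a' Q Q' bx
    using kr_insert_boxes[OF that] by simp
  have tab_cons: "P1' = S # Q \<Longrightarrow> decomp_tab n P1' \<Longrightarrow> decomp_tab n Q" for P1' S Q
    using decomp_tab_ConsD(3) by blast
  from Cons.prems(3,1) t1(2) show ?case
  proof (cases rule: kr_insert_Cons_cases)
    case stop
    have "kr_insert i b ((R @ [a]) # P) = (P2, y)" using Cons.prems(4) stop by simp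
    from this t1(1)[unfolded stop(2)] t2(2)[unfolded stop(2)] show ?thesis
    proof (cases rule: kr_insert_Cons_cases)
      case stop2: stop
      have "kr_insert i c ((R @ [a, b]) # P) = (P3, z)" using Cons.prems(5) stop2 by simp
      then have "\<not> unimodal (R @ [a, b, c])"
        using Cons.prems(7) stop2(3) by (auto split: if_splits)
      then have "c < b \<and> \<not> dcr ((R @ [a]) @ [b])"
        using not_unimodal_snoc_dcr[OF stop2(1), of c] neq(2) by simp
      then show ?thesis
        using unimodal_snoc_ascent[OF stop2(1)] by simp
    next
      case (pass R' a' Q)
      then show ?thesis
        using later[OF pass(2) tab(3) pass(5)] Cons.prems(6) stop(3) by simp
    qed
  next
    case (pass R1 a' Q1)
    note p1 = pass
    have tQ1: "decomp_tab n Q1" using tab_cons[OF p1(3) t1(1)] .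
    have "kr_insert i b (R1 # Q1) = (P2, y)" using Cons.prems(4) p1 by simp
    from this t1(1)[unfolded p1(3)] t2(2)[unfolded p1(3)] show ?thesis
    proof (cases rule: kr_insert_Cons_cases)
      case stop
      have "kr_insert i c ((R1 @ [b]) # Q1) = (P3, z)" using Cons.prems(5) stop by simp
      then have *: "\<not> unimodal ((R1 @ [b]) @ [c])"
        using Cons.prems(7) stop(3) by (auto split: if_splits)
      have "R1 \<noteq> []" using kr_step_length[OF p1(1)] tab(2) by auto
      \<comment> \<open>The third letter does not fit, so \<open>b\<close> was reached by a rise;
        its predecessor in the row is at least \<open>a\<close>.\<close>
      have "c < b \<and> \<not> dcr (R1 @ [b])"
        using not_unimodal_snoc_dcr[OF stop(1) _ *] neq(2) by simp
      then show ?thesis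
        using kr_step_le_last[OF p1(1)] unimodal_snoc_ascent[OF stop(1)] by simp
    next
      case (pass R2 b' Q2)
      note p2 = pass
      have tQ2: "decomp_tab n Q2" using tab_cons[OF p2(3) t2(1)] .
      have ly: "i < fst y" using later[OF p2(2) tQ1 p2(5)] .
      have "kr_insert i c (R2 # Q2) = (P3, z)" using Cons.prems(5) p2 by simp
      from this t2(1)[unfolded p2(3)] t3(2)[unfolded p2(3)] show ?thesis
      proof (cases rule: kr_insert_Cons_cases)
        case stop
        then show ?thesis using ly Cons.prems(7) by simp
      next
        case (pass R3 c' Q3)
        note p3 = pass
        have "red n (concat (rev P) @ R @ [a, b, c])" using Cons.prems(2) by simp
        moreover have "ck (concat (rev P) @ R @ [a, b, c]) (concat (rev P) @ a' # R1 @ [b, c])"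
          using ck_context[OF kr_step_ck[OF p1(1)], of "concat (rev P)" "[b, c]"] by simp
        moreover have "ck (concat (rev P) @ a' # R1 @ [b, c]) (concat (rev P) @ a' # b' # R2 @ [c])"
          using ck_context[OF kr_step_ck[OF p2(1)], of "concat (rev P) @ [a']" "[c]"] by simp
        moreover have "ck (concat (rev P) @ a' # b' # R2 @ [c]) (concat (rev P) @ a' # b' # c' # R3)"
          using ck_context[OF kr_step_ck[OF p3(1)], of "concat (rev P) @ [a', b']" "[]"] by simp
        ultimately have "red n (concat (rev P) @ a' # b' # c' # R3)"
          using red_ck by blast
        then have "red n (concat (rev P) @ [a', b', c'])"
          using red_appendD1[of n "concat (rev P) @ [a', b', c']" R3] by simp
        then have "a' < b' \<and> c' < b'"
          using Cons.IH[OF tab(3) _ p1(2) p2(2) p3(2)] Cons.prems(6,7) by blast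
        then show ?thesis
          using kr_step_peak[OF p1(1) p2(1) p3(1) neq] by blast
      qed
    qed
  qed
qed


section \<open>Primed Kraskiewicz insertion\<close>

definition down_step :: "box \<Rightarrow> box \<Rightarrow> bool" where
  "down_step x y \<longleftrightarrow> fst x < fst y \<and> snd y \<le> snd x"

definition right_step :: "box \<Rightarrow> box \<Rightarrow> bool" where
  "right_step x y \<longleftrightarrow> fst y \<le> fst x \<and> snd x < snd y"

definition turns_at :: "nat \<Rightarrow> box list \<Rightarrow> bool" where
  "turns_at k bxs \<longleftrightarrow>
     k < length bxs \<and> sorted_wrt down_step (take (Suc k) bxs) \<and> sorted_wrt right_step (drop k bxs)"

lemma sorted_wrt_conj:
  "sorted_wrt (\<lambda>x y. P x y \<and> Q x y) xs \<longleftrightarrow> sorted_wrt P xs \<and> sorted_wrt Q xs"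
  by (induction xs) (auto simp: sorted_wrt.simps(2))

lemma turns_at_alt:
  "turns_at k bxs \<longleftrightarrow> k < length bxs \<and>
     sorted_wrt (<) (map fst (take (Suc k) bxs)) \<and> sorted_wrt (\<ge>) (map fst (drop k bxs)) \<and>
     sorted_wrt (\<ge>) (map snd (take (Suc k) bxs)) \<and> sorted_wrt (<) (map snd (drop k bxs))"
  unfolding turns_at_def down_step_def right_step_def sorted_wrt_conj sorted_wrt_map by blast

lemma turns_at_down: "turns_at k bxs \<Longrightarrow> p < q \<Longrightarrow> q \<le> k \<Longrightarrow> down_step (bxs ! p) (bxs ! q)"
proof -
  assume *: "turns_at k bxs" "p < q" "q \<le> k"
  then have "\<forall>i j. i < j \<longrightarrow> j < length (take (Suc k) bxs) \<longrightarrow> down_step (take (Suc k) bxs ! i) (take (Suc k) bxs ! j)"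
    unfolding turns_at_def sorted_wrt_iff_nth_less by blast
  from this[rule_format, of p q] * show "down_step (bxs ! p) (bxs ! q)"
    by (simp add: turns_at_def)
qed

lemma turns_at_right:
  assumes "turns_at k bxs" "k \<le> p" "p < q" "q < length bxs"
  shows "right_step (bxs ! p) (bxs ! q)"
proof -
  have "\<forall>i j. i < j \<longrightarrow> j < length (drop k bxs) \<longrightarrow> right_step (drop k bxs ! i) (drop k bxs ! j)"
    using assms(1) unfolding turns_at_def sorted_wrt_iff_nth_less by blast
  from this[rule_format, of "p - k" "q - k"] show ?thesis
    using assms by simp
qed

text \<open>Two turning indices \<open>i < j\<close> would make the step from box \<open>i\<close>
  to box \<open>i + 1\<close> both a right step and a down step.\<close>

lemma turn_index_eq: assumes "turns_at k bxs" shows "turn_index bxs = k"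
  unfolding turn_index_def turns_at_alt[symmetric]
proof (rule the_equality)
  fix l assume l: "turns_at l bxs"
  have False if "turns_at i bxs" "turns_at j bxs" "i < j" for i j
    using turns_at_down[OF that(2), of i "Suc i"] turns_at_right[OF that(1), of i "Suc i"] that
    by (auto simp: down_step_def right_step_def turns_at_def)
  then show "l = k" using l assms by (meson linorder_neqE_nat)
qed (rule assms)

definition shifted_shape :: "box set \<Rightarrow> bool" where
  "shifted_shape D \<longleftrightarrow> finite D \<and> (\<forall>(r, c)\<in>D. 1 \<le> r \<and> r \<le> c) \<and>
     (\<forall>r c. (r, c) \<in> D \<longrightarrow> (r < c \<longrightarrow> (r, c - 1) \<in> D) \<and> (1 < r \<longrightarrow> (r - 1, c) \<in> D))"

lemma shifted_shape_pos: "shifted_shape D \<Longrightarrow> (r, c) \<in> D \<Longrightarrow> 1 \<le> r \<and> r \<le> c"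
  by (auto simp: shifted_shape_def)

lemma shifted_shape_row_boxes: "decomp_tab n P \<Longrightarrow> shifted_shape (row_boxes 1 P)"
  unfolding shifted_shape_def
  using finite_row_boxes row_boxes_closed[OF decomp_tab_dcr, of n P _ _ 1] row_boxes_ge[of _ 1 P] by fastforce

lemma shifted_shape_le:
  assumes "shifted_shape D" "(r, c) \<in> D" "1 \<le> r'" "r' \<le> r" "c' \<le> c" "r' \<le> c'"
  shows "(r', c') \<in> D"
proof -
  have up: "1 \<le> r - k \<Longrightarrow> (r - k, c) \<in> D" for k
  proof (induction k)
    case (Suc k)
    then have "(r - k, c) \<in> D" "1 < r - k" by auto
    then have "(r - k - 1, c) \<in> D"
      using assms(1) unfolding shifted_shape_def by blast
    then show ?case by simp
  qed (use assms(2) in simp)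
  have "(r', c) \<in> D" using up[of "r - r'"] assms by simp
  have "r' \<le> c - k \<Longrightarrow> (r', c - k) \<in> D" for k
  proof (induction k)
    case (Suc k)
    then have "(r', c - k) \<in> D" "r' < c - k" using assms(3) by auto
    then have "(r', c - k - 1) \<in> D"
      using assms(1) unfolding shifted_shape_def by blast
    then show ?case by simp
  qed (use \<open>(r', c) \<in> D\<close> in simp)
  from this[of "c - c'"] show ?thesis using assms by simp
qed

text \<open>If both coordinates grew, closure of the shapes would put \<open>(r, c')\<close> into
  \<open>D\<close>, and then \<open>x\<close> itself; if neither grew, \<open>y\<close> would
  already be present.\<close>

lemma successive_boxes:
  assumes "shifted_shape (insert x D)" "shifted_shape (insert y (insert x D))" "shifted_shape D"
    "x \<notin> D" "y \<notin> insert x D"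
  shows "down_step x y \<or> right_step x y"
proof -
  obtain r c r' c' where xy: "x = (r, c)" "y = (r', c')" by fastforce
  have pos: "1 \<le> r" "r \<le> c" "1 \<le> r'" "r' \<le> c'"
    using assms(2) unfolding xy shifted_shape_def by auto
  have "\<not> (r < r' \<and> c < c')"
  proof
    assume *: "r < r' \<and> c < c'"
    then have "(r, c') \<in> insert y (insert x D)"
      using shifted_shape_le[OF assms(2), of r' c' r c'] pos xy by simp
    then have "(r, c') \<in> D" using * xy by auto
    then show False
      using shifted_shape_le[OF assms(3), of r c' r c] * pos xy assms(4) by simp
  qed
  moreover have "\<not> (r' \<le> r \<and> c' \<le> c)"
    using shifted_shape_le[OF assms(1), of r c r' c'] pos xy assms(5) by auto
  ultimately show ?thesis
    unfolding down_step_def right_step_def xy by auto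
qed

lemma kr_insert_shape:
  assumes "kr_insert 1 a P = (P', bx)" "decomp_tab n P" "red n (concat (rev P) @ [a])"
  shows "bx \<notin> row_boxes 1 P" "row_boxes 1 P' = insert bx (row_boxes 1 P)"
    "shifted_shape (insert bx (row_boxes 1 P))"
  using kr_insert_boxes[OF assms] kr_insert_decomp_tab[OF assms] shifted_shape_row_boxes by metis+

lemma kr_insert_word_Cons:
  assumes "kr_insert_word (a # w) P = (P', bxs)" "decomp_tab n P" "red n (concat (rev P) @ a # w)"
  obtains P1 bx bxs' where "kr_insert 1 a P = (P1, bx)" "kr_insert_word w P1 = (P', bxs')"
    "bxs = bx # bxs'" "decomp_tab n P1" "red n (concat (rev P1) @ w)" "red n (concat (rev P) @ [a])"
proof -
  obtain P1 bx where 1: "kr_insert 1 a P = (P1, bx)" by (meson surj_pair)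
  obtain P2 bxs' where 2: "kr_insert_word w P1 = (P2, bxs')" by (meson surj_pair)
  show ?thesis
    using that[OF 1] 2 assms(1) 1 kr_insert_red_snoc[OF 1 assms(2,3)] by auto
qed

lemma kr_insert_word_decomp_tab:
  assumes "kr_insert_word w P = (P', bxs)" "decomp_tab n P" "red n (concat (rev P) @ w)"
  shows "decomp_tab n P' \<and> ck (concat (rev P) @ w) (concat (rev P')) \<and> length bxs = length w"
  using assms
proof (induction w arbitrary: P bxs)
  case (Cons a w)
  from Cons.prems obtain P1 bx bxs' where *: "kr_insert 1 a P = (P1, bx)" "kr_insert_word w P1 = (P', bxs')"
    "bxs = bx # bxs'" "decomp_tab n P1" "red n (concat (rev P1) @ w)" "red n (concat (rev P) @ [a])"
    by (rule kr_insert_word_Cons)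
  have "ck (concat (rev P) @ [a]) (concat (rev P1))"
    using kr_insert_decomp_tab[OF *(1) Cons.prems(2) *(6)] by simp
  from ck_right[OF this, of w] have "ck (concat (rev P) @ a # w) (concat (rev P1) @ w)"
    by simp
  with Cons.IH[OF *(2,4,5)] *(3) show ?case
    using ck_trans by auto
qed simp

lemma kr_insert_word_shape:
  assumes "kr_insert_word w P = (P', bxs)" "decomp_tab n P" "red n (concat (rev P) @ w)"
  shows "row_boxes 1 P' = row_boxes 1 P \<union> set bxs \<and> distinct bxs \<and> set bxs \<inter> row_boxes 1 P = {} \<and>
     (\<forall>j\<le>length bxs. shifted_shape (row_boxes 1 P \<union> set (take j bxs)))"
  using assms
proof (induction w arbitrary: P bxs)
  case Nil
  then show ?case using shifted_shape_row_boxes by auto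
next
  case (Cons a w)
  from Cons.prems obtain P1 bx bxs' where *: "kr_insert 1 a P = (P1, bx)" "kr_insert_word w P1 = (P', bxs')"
    "bxs = bx # bxs'" "decomp_tab n P1" "red n (concat (rev P1) @ w)" "red n (concat (rev P) @ [a])"
    by (rule kr_insert_word_Cons)
  note sh = kr_insert_shape[OF *(1) Cons.prems(2) *(6)]
  note IH = Cons.IH[OF *(2,4,5)]
  have "shifted_shape (row_boxes 1 P \<union> set (take j bxs))" if "j \<le> length bxs" for j
  proof (cases j)
    case 0
    then show ?thesis using shifted_shape_row_boxes[OF Cons.prems(2)] by simp
  next
    case (Suc i)
    then have "shifted_shape (row_boxes 1 P1 \<union> set (take i bxs'))"
      using IH that *(3) by simp
    then show ?thesis using sh(2) Suc *(3) by simp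
  qed
  then show ?case using IH sh *(3) by auto
qed

lemma kr_insert_word_inj:
  assumes "kr_insert_word w P = (P', bxs)" "decomp_tab n P" "red n (concat (rev P) @ w)"
    and "kr_insert_word v Q = (P', bxs)" "decomp_tab n Q" "red n (concat (rev Q) @ v)"
  shows "P = Q \<and> w = v"
  using assms
proof (induction w arbitrary: P bxs v Q)
  case Nil
  then show ?case
    using kr_insert_word_decomp_tab[OF Nil.prems(4-6)] by auto
next
  case (Cons a w)
  from Cons.prems(1-3) obtain P1 bx bxs' where *: "kr_insert 1 a P = (P1, bx)" "kr_insert_word w P1 = (P', bxs')"
    "bxs = bx # bxs'" "decomp_tab n P1" "red n (concat (rev P1) @ w)" "red n (concat (rev P) @ [a])"
    by (rule kr_insert_word_Cons)
  obtain b v' where v: "v = b # v'"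
    using kr_insert_word_decomp_tab[OF Cons.prems(4-6)] *(3) by (cases v) auto
  from Cons.prems(4-6)[unfolded v] obtain Q1 bx2 bxs2 where **: "kr_insert 1 b Q = (Q1, bx2)" "kr_insert_word v' Q1 = (P', bxs2)"
    "bxs = bx2 # bxs2" "decomp_tab n Q1" "red n (concat (rev Q1) @ v')" "red n (concat (rev Q) @ [b])"
    by (rule kr_insert_word_Cons)
  have "P1 = Q1 \<and> w = v'"
    using Cons.IH[OF *(2,4,5)] **(2-5) *(3) by simp
  moreover from this have "P = Q \<and> a = b"
    using kr_insert_inj[OF *(1) Cons.prems(2) *(6), of b Q] ** *(3) Cons.prems(5) by simp
  ultimately show ?case using v by simp
qed

lemma transp_steps: "transp down_step" "transp right_step"
  by (auto simp: transp_def down_step_def right_step_def)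

lemma kr_insert_word_turns:
  assumes "kr_insert_word w P = (P', bxs)" "decomp_tab n P" "red n (concat (rev P) @ w)"
    and "unimodal w" "w \<noteq> []"
  shows "\<exists>k. turns_at k bxs"
  using assms
proof (induction w arbitrary: P bxs)
  case (Cons a w)
  from Cons.prems(1-3) obtain P1 x bxs1 where 1: "kr_insert 1 a P = (P1, x)" "kr_insert_word w P1 = (P', bxs1)"
    "bxs = x # bxs1" "decomp_tab n P1" "red n (concat (rev P1) @ w)" "red n (concat (rev P) @ [a])"
    by (rule kr_insert_word_Cons)
  note sh = kr_insert_shape[OF 1(1) Cons.prems(2) 1(6)]
  show ?case
  proof (cases w)
    case Nil
    then show ?thesis using 1(2,3) by (auto simp: turns_at_def sorted_wrt.simps)
  next
    case w: (Cons b w')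
    have "unimodal w"
      using Cons.prems(4) unimodal_append_right[of "[a]" w] by simp
    then obtain k where k: "turns_at k bxs1"
      using Cons.IH[OF 1(2,4,5)] w by blast
    from 1(2,4,5)[unfolded w] obtain P2 y bxs2 where 2: "kr_insert 1 b P1 = (P2, y)" "kr_insert_word w' P2 = (P', bxs2)"
      "bxs1 = y # bxs2" "decomp_tab n P2" "red n (concat (rev P2) @ w')" "red n (concat (rev P1) @ [b])"
      by (rule kr_insert_word_Cons)
    have step: "down_step x y \<or> right_step x y"
      using successive_boxes[of x "row_boxes 1 P" y] sh kr_insert_shape[OF 2(1) 1(4) 2(6)]
        shifted_shape_row_boxes[OF Cons.prems(2)] by simp
    have down: "turns_at (Suc k) bxs" if "down_step x y"
      using k that 1(3) 2(3) sorted_wrt2[OF transp_steps(1), of x y "take k bxs2"]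
      unfolding turns_at_def by simp
    show ?thesis
    proof (cases "down_step x y")
      case True
      then show ?thesis using down by blast
    next
      case False
      then have right: "right_step x y" using step by simp
      \<comment> \<open>Otherwise the right step to \<open>y\<close> is followed by a down step to
        \<open>z\<close>, and \<open>b\<close> is a peak of a unimodal word.\<close>
      have "k = 0"
      proof (rule ccontr)
        assume "k \<noteq> 0"
        then obtain c w'' where w': "w' = c # w''"
          using k 2 unfolding turns_at_def by (cases w') auto
        from 2(2,4,5)[unfolded w'] obtain P3 z bxs3 where 3: "kr_insert 1 c P2 = (P3, z)" "kr_insert_word w'' P3 = (P', bxs3)"
          "bxs2 = z # bxs3" "decomp_tab n P3" "red n (concat (rev P3) @ w'')" "red n (concat (rev P2) @ [c])"
          by (rule kr_insert_word_Cons)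
        have "down_step y z"
          using turns_at_down[OF k, of 0 1] \<open>k \<noteq> 0\<close> 2(3) 3(3) by simp
        moreover have "red n (concat (rev P) @ [a, b, c])"
          using Cons.prems(3) red_appendD1[of n "concat (rev P) @ [a, b, c]" w''] w w' by simp
        ultimately have "a < b \<and> c < b"
          using kr_insert_peak[OF Cons.prems(2) _ 1(1) 2(1) 3(1)] right
          by (simp add: down_step_def right_step_def)
        then show False
          using Cons.prems(4) w w' by (auto simp: unimodal_Cons inc_Cons)
      qed
      then have "turns_at 0 bxs"
        using k right 1(3) 2(3) sorted_wrt2[OF transp_steps(2), of x y bxs2]
        unfolding turns_at_def by (simp add: sorted_wrt.simps)
      then show ?thesis by blast
    qed
  qed
qed simp

text \<open>Primes are allowed on the diagonal: these are the signed primed tableaux. The rule on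
  repeated letters is stated for neighbours, so that it can be checked box by box.\<close>

definition semistandard :: "ptab \<Rightarrow> bool" where
  "semistandard T \<longleftrightarrow> shifted_shape (dom T) \<and>
     (\<forall>r c x y. T (r, c) = Some x \<and> T (r, Suc c) = Some y \<longrightarrow> x < y \<or> x = y \<and> x = Plain (val x)) \<and>
     (\<forall>r c x y. T (r, c) = Some x \<and> T (Suc r, c) = Some y \<longrightarrow> x < y \<or> x = y \<and> x = Primed (val x))"

lemma map_upds_nth:
  "distinct xs \<Longrightarrow> length xs = length ys \<Longrightarrow> j < length xs \<Longrightarrow> (T(xs [\<mapsto>] ys)) (xs ! j) = Some (ys ! j)"
proof (induction xs arbitrary: T ys j)
  case (Cons x xs)
  then obtain y ys' where "ys = y # ys'" by (cases ys) auto
  with Cons show ?case by (cases j) auto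
qed simp

lemma length_rec_labels [simp]: "length (rec_labels i s bxs) = length bxs"
  by (simp add: rec_labels_def)

lemma rec_labels_nth: "turns_at k bxs \<Longrightarrow> j < length bxs \<Longrightarrow>
    rec_labels i s bxs ! j = (if j < k \<or> j = k \<and> s = SMinus then Primed i else Plain i)"
  by (simp add: rec_labels_def turn_index_eq)

lemma KR_snoc: "KR (A @ [(s, a)]) = KR_step (KR A) (Suc (length A), s, a)"
  by (simp add: KR_def enumerate_append_eq)

lemma KR_Nil: "KR [] = ([], Map.empty)"
  by (simp add: KR_def)

text \<open>New labels exceed old ones, so only two new neighbouring boxes matter, and of these the
  left or upper one is created first. Boxes of one row are not joined by a down step, so the later
  one lies past the turn and is plain; boxes of one column are not joined by a right step, so the
  earlier one lies before the turn and is primed.\<close>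

lemma semistandard_extend:
  assumes T: "semistandard T" "\<forall>b x. T b = Some x \<longrightarrow> val x < i"
    and turn: "bxs \<noteq> [] \<Longrightarrow> turns_at k bxs" and "distinct bxs" "set bxs \<inter> dom T = {}"
    and shape: "\<forall>j\<le>length bxs. shifted_shape (dom T \<union> set (take j bxs))"
  shows "semistandard (T(bxs [\<mapsto>] rec_labels i s bxs))"
proof -
  let ?T = "T(bxs [\<mapsto>] rec_labels i s bxs)"
  have new: "?T (bxs ! j) = Some (rec_labels i s bxs ! j)" if "j < length bxs" for j
    using map_upds_nth[of bxs "rec_labels i s bxs" j T] assms(4) that by simp
  have old: "?T b = T b" if "b \<notin> set bxs" for b
    using that by simp
  have label: "rec_labels i s bxs ! j = (if j < k \<or> j = k \<and> s = SMinus then Primed i else Plain i)" if "j < length bxs" for j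
    using rec_labels_nth[OF turn that] that by force
  have before: "p < q" if "q < length bxs" "p < length bxs" "bxs ! p = (r, c)"
    "bxs ! q = (r, Suc c) \<or> bxs ! q = (Suc r, c)" for p q r c
  proof -
    have S: "shifted_shape (dom T \<union> set (take (Suc q) bxs))" using shape that(1) by simp
    have "bxs ! q \<in> set (take (Suc q) bxs)" using that(1) by (auto simp: take_Suc_conv_app_nth)
    moreover have "1 \<le> r \<and> r \<le> c"
    proof -
      have "shifted_shape (dom T \<union> set (take (length bxs) bxs))" using shape by blast
      then show ?thesis using shifted_shape_pos[of _ r c] that(3) nth_mem[OF that(2)] by simp
    qed
    ultimately have "bxs ! p \<in> dom T \<union> set (take (Suc q) bxs)"
      using shifted_shape_le[OF S, of r "Suc c" r c] shifted_shape_le[OF S, of "Suc r" c r c] that(3,4)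
      by (metis UnI2 le_SucI le_refl)
    then have "bxs ! p \<in> set (take (Suc q) bxs)"
      using assms(5) nth_mem[OF that(2)] by blast
    then obtain j where "j < Suc q" "j < length bxs" "bxs ! j = bxs ! p"
      by (auto simp: in_set_conv_nth)
    then have "p \<le> q" using assms(4) that(2) by (auto simp: nth_eq_iff_index_eq)
    moreover have "p \<noteq> q" using that(3,4) by auto
    ultimately show "p < q" by simp
  qed
  have dom: "dom ?T = dom T \<union> set bxs" by auto
  have shape': "shifted_shape (dom ?T)"
    using shape[rule_format, of "length bxs"] unfolding dom by simp
  have closed: "b \<notin> set bxs" if "b' \<in> dom T" "b = (r, c)" "b' = (r, Suc c) \<or> b' = (Suc r, c)" "1 \<le> r" "r \<le> c" for b b' r c
  proof -
    have "b \<in> dom T"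
      using shifted_shape_le[of "dom T"] T(1) that unfolding semistandard_def by (metis le_SucI le_refl)
    then show ?thesis using assms(5) by blast
  qed
  have pos: "1 \<le> r \<and> r \<le> c" if "?T (r, c) = Some x" for r c x
    using shape' that unfolding shifted_shape_def by blast
  have pair: "b \<in> set bxs \<and> b' \<in> set bxs \<or> x < y \<or> T b = Some x \<and> T b' = Some y"
    if "?T b = Some x" "?T b' = Some y" "b = (r, c)" "b' = (r, Suc c) \<or> b' = (Suc r, c)" for b b' x y r c
  proof (cases "b' \<in> set bxs")
    case True
    show ?thesis
    proof (cases "b \<in> set bxs")
      case False
      then have "T b = Some x" using old that(1) by simp
      then have "val x < i" using T(2) by blast
      obtain j where "j < length bxs" "bxs ! j = b'" using True by (auto simp: in_set_conv_nth)
      then have "y = rec_labels i s bxs ! j" using new[of j] that(2) by simp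
      then have "val y = i" using label[OF \<open>j < length bxs\<close>] by auto
      then show ?thesis using \<open>val x < i\<close> by (simp add: less_letter_def)
    qed (use True in simp)
  next
    case False
    then have "T b' = Some y" using old that(2) by simp
    then have "b \<notin> set bxs" using closed[of b' b r c] that pos by blast
    then show ?thesis using old that \<open>T b' = Some y\<close> by simp
  qed
  have row: "x < y \<or> x = y \<and> x = Plain (val x)" if tt: "?T (r, c) = Some x" "?T (r, Suc c) = Some y" for r c x y
  proof -
    consider "(r, c) \<in> set bxs" "(r, Suc c) \<in> set bxs" | "x < y" | "T (r, c) = Some x" "T (r, Suc c) = Some y"
      using pair[OF tt refl] by blast
    then show ?thesis
    proof cases
      case 1
      then obtain p q where pq: "p < length bxs" "q < length bxs" "bxs ! p = (r, c)" "bxs ! q = (r, Suc c)"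
        by (auto simp: in_set_conv_nth)
      then have "p < q" using before by blast
      have "\<not> q \<le> k"
        using turns_at_down[of k bxs p q] turn \<open>p < q\<close> pq by (cases "bxs = []") (auto simp: down_step_def)
      moreover have "x = rec_labels i s bxs ! p" "y = rec_labels i s bxs ! q"
        using tt new[OF pq(1)] new[OF pq(2)] pq(3,4) by simp_all
      ultimately show ?thesis
        using label[OF pq(1)] label[OF pq(2)] by (auto simp: less_letter_def)
    qed (use T(1) in \<open>auto simp: semistandard_def\<close>)
  qed
  have col: "x < y \<or> x = y \<and> x = Primed (val x)" if tt: "?T (r, c) = Some x" "?T (Suc r, c) = Some y" for r c x y
  proof -
    consider "(r, c) \<in> set bxs" "(Suc r, c) \<in> set bxs" | "x < y" | "T (r, c) = Some x" "T (Suc r, c) = Some y"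
      using pair[OF tt refl] by blast
    then show ?thesis
    proof cases
      case 1
      then obtain p q where pq: "p < length bxs" "q < length bxs" "bxs ! p = (r, c)" "bxs ! q = (Suc r, c)"
        by (auto simp: in_set_conv_nth)
      then have "p < q" using before by blast
      have "\<not> k \<le> p"
        using turns_at_right[of k bxs p q] turn \<open>p < q\<close> pq by (cases "bxs = []") (auto simp: right_step_def)
      moreover have "x = rec_labels i s bxs ! p" "y = rec_labels i s bxs ! q"
        using tt new[OF pq(1)] new[OF pq(2)] pq(3,4) by simp_all
      ultimately show ?thesis
        using label[OF pq(1)] label[OF pq(2)] by (auto simp: less_letter_def)
    qed (use T(1) in \<open>auto simp: semistandard_def\<close>)
  qed
  show ?thesis
    unfolding semistandard_def using shape' row col by blast
qed

definition signed_factors :: "factorization \<Rightarrow> bool" where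
  "signed_factors A \<longleftrightarrow> (\<forall>(s, a)\<in>set A. unimodal a \<and> (s = SZero \<longleftrightarrow> a = []))"

lemma KR_invariant:
  assumes "signed_factors A" "red n (concat (map snd A))" "KR A = (P, T)"
  shows "decomp_tab n P \<and> ck (concat (map snd A)) (concat (rev P)) \<and> dom T = row_boxes 1 P \<and>
    semistandard T \<and> (\<forall>b x. T b = Some x \<longrightarrow> 1 \<le> val x \<and> val x \<le> length A)"
  using assms
proof (induction A arbitrary: P T rule: rev_induct)
  case Nil
  then show ?case
    by (auto simp: KR_Nil decomp_tab_def semistandard_def shifted_shape_def)
next
  case (snoc f A)
  obtain s a where f: "f = (s, a)" by fastforce
  obtain P0 T0 where KR0: "KR A = (P0, T0)" by fastforce
  obtain P1 bxs where ins: "kr_insert_word a P0 = (P1, bxs)" by fastforce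
  have PT: "P = P1" "T = T0(bxs [\<mapsto>] rec_labels (Suc (length A)) s bxs)"
    using snoc.prems(3) KR0 ins unfolding f KR_snoc by (simp_all add: KR_step_def)
  have red: "red n (concat (map snd A) @ a)" using snoc.prems(2) f by simp
  have IH: "decomp_tab n P0" "ck (concat (map snd A)) (concat (rev P0))" "dom T0 = row_boxes 1 P0"
    "semistandard T0" "\<forall>b x. T0 b = Some x \<longrightarrow> 1 \<le> val x \<and> val x \<le> length A"
    using snoc.IH[OF _ red_appendD1[OF red] KR0] snoc.prems(1) by (auto simp: signed_factors_def)
  have ck: "ck (concat (map snd A) @ a) (concat (rev P0) @ a)"
    using ck_right[OF IH(2)] .
  then have red': "red n (concat (rev P0) @ a)" using red red_ck by blast
  note tab = kr_insert_word_decomp_tab[OF ins IH(1) red']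
  note sh = kr_insert_word_shape[OF ins IH(1) red']
  have "unimodal a" using snoc.prems(1) f by (simp add: signed_factors_def)
  then obtain k where "bxs \<noteq> [] \<longrightarrow> turns_at k bxs"
    using kr_insert_word_turns[OF ins IH(1) red'] tab by fastforce
  then have ss: "semistandard T"
    unfolding PT using semistandard_extend[OF IH(4), of "Suc (length A)" bxs k s] IH(3,5) sh by fastforce
  have "1 \<le> val x \<and> val x \<le> Suc (length A)" if "T b = Some x" for b x
  proof (cases "b \<in> set bxs")
    case False
    then have "T0 b = Some x" using that unfolding PT by simp
    then show ?thesis using IH(5) by (metis le_SucI)
  next
    case True
    then obtain j where j: "j < length bxs" "bxs ! j = b" by (auto simp: in_set_conv_nth)
    then have "T b = Some (rec_labels (Suc (length A)) s bxs ! j)"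
      unfolding PT using map_upds_nth[of bxs "rec_labels (Suc (length A)) s bxs" j T0] sh by simp
    then show ?thesis using that j(1) by (auto simp: rec_labels_def)
  qed
  moreover have "dom T = row_boxes 1 P" unfolding PT using sh IH(3) by auto
  moreover have "ck (concat (map snd (A @ [f]))) (concat (rev P))"
    using ck_trans[OF ck] tab f PT(1) by simp
  ultimately show ?case using tab ss PT(1) by simp
qed

section \<open>Recovering a factorization from its two tableaux\<close>

lemma sorted_wrt_asym_unique:
  assumes "sorted_wrt R xs" "sorted_wrt R ys" "set xs = set ys" "\<And>x y. R x y \<Longrightarrow> \<not> R y x"
  shows "xs = ys"
  using assms(1-3)
proof (induction xs arbitrary: ys)
  case (Cons x xs)
  then obtain y ys' where ys: "ys = y # ys'" by (cases ys) auto
  have "x = y"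
  proof (rule ccontr)
    assume "x \<noteq> y"
    then have "x \<in> set ys'" "y \<in> set xs" using Cons.prems(3) ys by auto
    then have "R y x" "R x y" using Cons.prems(1,2) ys by (auto simp: sorted_wrt.simps)
    then show False using assms(4) by blast
  qed
  moreover have "x \<notin> set xs" "y \<notin> set ys'"
    using Cons.prems(1,2) ys assms(4)[of x x] assms(4)[of y y] by (auto simp: sorted_wrt.simps)
  ultimately have "set xs = set ys'"
    using Cons.prems(3) ys by (metis Diff_insert_absorb list.simps(15))
  then show ?case
    using Cons.IH[of ys'] Cons.prems(1,2) ys \<open>x = y\<close> by (simp add: sorted_wrt.simps)
qed simp

text \<open>The order of creation of the boxes of one factor, recovered from their labels.\<close>

definition creation_order :: "ptab \<Rightarrow> box \<Rightarrow> box \<Rightarrow> bool" where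
  "creation_order T x y \<longleftrightarrow>
     (\<exists>i. T x = Some (Primed i) \<and> T y = Some (Plain i)) \<or>
     (\<exists>i. T x = Some (Primed i) \<and> T y = Some (Primed i) \<and> fst x < fst y) \<or>
     (\<exists>i. T x = Some (Plain i) \<and> T y = Some (Plain i) \<and> snd x < snd y)"

lemma creation_order_asym: "creation_order T x y \<Longrightarrow> \<not> creation_order T y x"
  unfolding creation_order_def by auto

lemma sorted_creation_order:
  assumes "turns_at k bxs" "distinct bxs" "T = T0(bxs [\<mapsto>] rec_labels i s bxs)"
  shows "sorted_wrt (creation_order T) bxs"
  unfolding sorted_wrt_iff_nth_less
proof (intro allI impI)
  fix p q assume pq: "p < q" "q < length bxs"
  have new: "T (bxs ! j) = Some (if j < k \<or> j = k \<and> s = SMinus then Primed i else Plain i)" if "j < length bxs" for j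
    using map_upds_nth[of bxs "rec_labels i s bxs" j T0] rec_labels_nth[OF assms(1) that] assms(2,3) that by simp
  have "down_step (bxs ! p) (bxs ! q)" if "q \<le> k"
    using turns_at_down[OF assms(1)] pq that by blast
  moreover have "right_step (bxs ! p) (bxs ! q)" if "k \<le> p"
    using turns_at_right[OF assms(1)] pq that by blast
  ultimately show "creation_order T (bxs ! p) (bxs ! q)"
    using new[of p] new[of q] pq unfolding creation_order_def down_step_def right_step_def
    by (auto split: if_splits)
qed

text \<open>The boxes with label \<open>i\<close> are those of the last factor. Their labels
  determine the order of creation, and the label at the turning box determines the sign; undoing the
  insertion along these boxes returns the factor and the earlier pair.\<close>

lemma KR_inj:
  assumes "signed_factors A" "red n (concat (map snd A))" "signed_factors B" "red n (concat (map snd B))"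
    and "length A = length B" "KR A = KR B"
  shows "A = B"
  using assms
proof (induction A arbitrary: B rule: rev_induct)
  case (snoc f A)
  obtain s a where f: "f = (s, a)" by fastforce
  obtain g B' where B: "B = B' @ [g]" using snoc.prems(5) by (cases B rule: rev_cases) auto
  obtain t b where g: "g = (t, b)" by fastforce
  have len: "length A = length B'" using snoc.prems(5) B by simp
  obtain PA TA where KRA: "KR A = (PA, TA)" by fastforce
  obtain PB TB where KRB: "KR B' = (PB, TB)" by fastforce
  obtain P1 xs where insA: "kr_insert_word a PA = (P1, xs)" by fastforce
  obtain P2 ys where insB: "kr_insert_word b PB = (P2, ys)" by fastforce
  define i where "i = Suc (length A)"
  define T where "T = TA(xs [\<mapsto>] rec_labels i s xs)"
  have "KR (A @ [f]) = (P1, T)" "KR B = (P2, TB(ys [\<mapsto>] rec_labels i t ys))"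
    using KRA KRB insA insB f g B len unfolding KR_snoc T_def i_def by (simp_all add: KR_snoc KR_step_def)
  then have eq: "P2 = P1" "T = TB(ys [\<mapsto>] rec_labels i t ys)" using snoc.prems(6) by simp_all
  have redA: "red n (concat (map snd A) @ a)" and redB: "red n (concat (map snd B') @ b)"
    using snoc.prems(2,4) f g B by simp_all
  have sA: "signed_factors A" and sB: "signed_factors B'"
    using snoc.prems(1,3) B by (auto simp: signed_factors_def)
  note invA = KR_invariant[OF sA red_appendD1[OF redA] KRA]
  note invB = KR_invariant[OF sB red_appendD1[OF redB] KRB]
  have redA': "red n (concat (rev PA) @ a)" and redB': "red n (concat (rev PB) @ b)"
    using red_ck[OF redA ck_right] red_ck[OF redB ck_right] invA invB by blast+
  have tA: "decomp_tab n PA" and tB: "decomp_tab n PB"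
    using invA invB by blast+
  have vA: "\<forall>b x. TA b = Some x \<longrightarrow> 1 \<le> val x \<and> val x \<le> length A"
    and vB: "\<forall>b x. TB b = Some x \<longrightarrow> 1 \<le> val x \<and> val x \<le> length A"
    unfolding len using invA invB len by simp_all
  note shA = kr_insert_word_shape[OF insA tA redA'] and shB = kr_insert_word_shape[OF insB tB redB']
  have lenxs: "length xs = length a" and lenys: "length ys = length b"
    using kr_insert_word_decomp_tab[OF insA tA redA'] kr_insert_word_decomp_tab[OF insB tB redB'] by blast+
  have new: "z \<in> set zs \<longleftrightarrow> (\<exists>x. T z = Some x \<and> val x = i)"
    if "T = T0(zs [\<mapsto>] rec_labels i u zs)" "distinct zs" "\<forall>b x. T0 b = Some x \<longrightarrow> 1 \<le> val x \<and> val x \<le> length A" for T0 zs u z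
  proof (cases "z \<in> set zs")
    case True
    then obtain j where "j < length zs" "zs ! j = z" by (auto simp: in_set_conv_nth)
    then show ?thesis
      using map_upds_nth[of zs "rec_labels i u zs" j T0] that True by (auto simp: rec_labels_def)
  next
    case False
    then have "T z = T0 z" using that(1) by simp
    then show ?thesis using False that(3) by (metis Suc_n_not_le_n i_def)
  qed
  have "set xs = set ys"
  proof (rule set_eqI)
    fix z
    have "distinct xs" "distinct ys" using shA shB by simp_all
    then show "z \<in> set xs \<longleftrightarrow> z \<in> set ys"
      using new[OF T_def _ vA, of z] new[OF eq(2) _ vB, of z] by simp
  qed
  have uni: "unimodal a" "unimodal b" "s = SZero \<longleftrightarrow> a = []" "t = SZero \<longleftrightarrow> b = []"
    using snoc.prems(1,3) f g B by (auto simp: signed_factors_def)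
  have "xs = ys \<and> s = t"
  proof (cases "xs = []")
    case True
    then have "a = []" "b = []" "ys = []" using lenxs lenys \<open>set xs = set ys\<close> by auto
    then show ?thesis using True uni by simp
  next
    case False
    then have "ys \<noteq> []" using \<open>set xs = set ys\<close> by auto
    then have ne: "a \<noteq> []" "b \<noteq> []" using False lenxs lenys by auto
    obtain k where k: "turns_at k xs"
      using kr_insert_word_turns[OF insA tA redA' uni(1) ne(1)] by blast
    obtain l where l: "turns_at l ys"
      using kr_insert_word_turns[OF insB tB redB' uni(2) ne(2)] by blast
    have "xs = ys"
      using sorted_wrt_asym_unique[OF sorted_creation_order[OF k _ T_def] sorted_creation_order[OF l _ eq(2)]
          \<open>set xs = set ys\<close> creation_order_asym] shA shB by blast
    moreover have "k = l" using turn_index_eq k l calculation by blast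
    moreover have "T (xs ! k) = Some (if s = SMinus then Primed i else Plain i)"
      unfolding T_def using map_upds_nth[of xs "rec_labels i s xs" k TA] rec_labels_nth[OF k, of k i s] k shA
      by (simp add: turns_at_def)
    moreover have "T (ys ! l) = Some (if t = SMinus then Primed i else Plain i)"
      unfolding eq(2) using map_upds_nth[of ys "rec_labels i t ys" l TB] rec_labels_nth[OF l, of l i t] l shB
      by (simp add: turns_at_def)
    \<comment> \<open>A nonempty factor has sign plus or minus, and the turning box tells the two
      apart.\<close>
    ultimately show ?thesis
      using uni(3,4) ne by (cases s; cases t) auto
  qed
  then have xs: "ys = xs" "t = s" by simp_all
  then have PAB: "PA = PB \<and> a = b"
    using kr_insert_word_inj[OF insA tA redA' _ tB redB'] insB eq(1) xs by blast
  have "TA = TB"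
  proof
    fix z
    show "TA z = TB z"
    proof (cases "z \<in> set xs")
      case True
      then have "z \<notin> dom TA" "z \<notin> dom TB" using shA shB invA invB xs by auto
      then show ?thesis by (simp add: domIff)
    next
      case False
      then have "T z = TA z" "T z = TB z"
        using fun_cong[OF T_def, of z] fun_cong[OF eq(2), of z] xs by simp_all
      then show ?thesis by simp
    qed
  qed
  then have "A = B'"
    using snoc.IH[OF sA red_appendD1[OF redA] sB red_appendD1[OF redB] len] KRA KRB PAB by simp
  then show ?case using B f g xs PAB by simp
qed simp


section \<open>Surjectivity of mixed insertion\<close>

lemma hm_box_RowI:
  assumes "i \<le> j" "\<And>y. T (i, j) = Some y \<Longrightarrow> x < y"
    and "\<And>j'. i \<le> j' \<Longrightarrow> j' < j \<Longrightarrow> \<exists>y. T (i, j') = Some y \<and> y \<le> x"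
  shows "hm_box (Row i) x T = (i, j)"
proof -
  have "(LEAST j. i \<le> j \<and> (\<forall>y. T (i, j) = Some y \<longrightarrow> x < y)) = j"
  proof (rule Least_equality)
    fix k assume k: "i \<le> k \<and> (\<forall>y. T (i, k) = Some y \<longrightarrow> x < y)"
    then show "j \<le> k" using assms(3)[of k] by (meson not_le)
  qed (use assms in auto)
  then show ?thesis by simp
qed

lemma hm_box_ColI:
  assumes "1 \<le> i" "\<And>y. T (i, j) = Some y \<Longrightarrow> x < y"
    and "\<And>i'. 1 \<le> i' \<Longrightarrow> i' < i \<Longrightarrow> \<exists>y. T (i', j) = Some y \<and> y \<le> x"
  shows "hm_box (Col j) x T = (i, j)"
proof -
  have "(LEAST i. 1 \<le> i \<and> (\<forall>y. T (i, j) = Some y \<longrightarrow> x < y)) = i"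
  proof (rule Least_equality)
    fix k assume k: "1 \<le> k \<and> (\<forall>y. T (k, j) = Some y \<longrightarrow> x < y)"
    then show "i \<le> k" using assms(3)[of k] by (meson not_le)
  qed (use assms in auto)
  then show ?thesis by simp
qed

lemma semistandard_row:
  "semistandard T \<Longrightarrow> T (r, c) = Some x \<Longrightarrow> T (r, Suc c) = Some y \<Longrightarrow> x < y \<or> x = y \<and> x = Plain (val x)"
  unfolding semistandard_def by blast

lemma semistandard_col:
  "semistandard T \<Longrightarrow> T (r, c) = Some x \<Longrightarrow> T (Suc r, c) = Some y \<Longrightarrow> x < y \<or> x = y \<and> x = Primed (val x)"
  unfolding semistandard_def by blast

lemma semistandard_shape: "semistandard T \<Longrightarrow> shifted_shape (dom T)"
  unfolding semistandard_def by blast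

lemma semistandard_fill:
  assumes "semistandard T" "T (r, c) = Some x" "1 \<le> r'" "r' \<le> r" "c' \<le> c" "r' \<le> c'"
  shows "\<exists>y. T (r', c') = Some y"
  using shifted_shape_le[OF semistandard_shape[OF assms(1)], of r c r' c'] assms by auto

lemma semistandard_row_le:
  assumes "semistandard T" "T (r, c) = Some x" "T (r, c + k) = Some y"
  shows "x \<le> y"
  using assms(3)
proof (induction k arbitrary: y)
  case 0
  then show ?case using assms(2) by simp
next
  case (Suc k)
  have "1 \<le> r \<and> r \<le> c"
    using shifted_shape_pos[OF semistandard_shape[OF assms(1)], of r c] assms(2) by blast
  then obtain z where "T (r, c + k) = Some z"
    using semistandard_fill[OF assms(1) Suc.prems, of r "c + k"] by auto
  then show ?case
    using Suc.IH semistandard_row[OF assms(1), of r "c + k" z y] Suc.prems by fastforce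
qed

lemma semistandard_col_le:
  assumes "semistandard T" "T (r, c) = Some x" "T (r + k, c) = Some y"
  shows "x \<le> y"
  using assms(3)
proof (induction k arbitrary: y)
  case 0
  then show ?case using assms(2) by simp
next
  case (Suc k)
  have "1 \<le> r" "r + Suc k \<le> c"
    using shifted_shape_pos[OF semistandard_shape[OF assms(1)], of r c] assms(2)
      shifted_shape_pos[OF semistandard_shape[OF assms(1)], of "r + Suc k" c] Suc.prems by blast+
  then obtain z where "T (r + k, c) = Some z"
    using semistandard_fill[OF assms(1) Suc.prems, of "r + k" c] by auto
  then show ?case
    using Suc.IH semistandard_col[OF assms(1), of "r + k" c z y] Suc.prems by fastforce
qed

lemma semistandard_before:
  assumes "semistandard T" "T (r, c) = Some w"
  shows "r \<le> c' \<Longrightarrow> c' < c \<Longrightarrow> \<exists>y. T (r, c') = Some y \<and> y \<le> w"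
    and "1 \<le> r' \<Longrightarrow> r' < r \<Longrightarrow> \<exists>y. T (r', c) = Some y \<and> y \<le> w"
proof -
  have pos: "1 \<le> r" "r \<le> c"
    using shifted_shape_pos[OF semistandard_shape[OF assms(1)], of r c] assms(2) by auto
  show "\<exists>y. T (r, c') = Some y \<and> y \<le> w" if hyp: "r \<le> c'" "c' < c"
  proof -
    obtain y where "T (r, c') = Some y"
      using semistandard_fill[OF assms, of r c'] pos hyp by auto
    then show ?thesis
      using semistandard_row_le[OF assms(1), of r c' y "c - c'" w] assms(2) hyp by simp
  qed
  show "\<exists>y. T (r', c) = Some y \<and> y \<le> w" if hyp: "1 \<le> r'" "r' < r"
  proof -
    obtain y where "T (r', c) = Some y"
      using semistandard_fill[OF assms, of r' c] pos hyp by auto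
    then show ?thesis
      using semistandard_col_le[OF assms(1), of r' c y "r - r'" w] assms(2) hyp by simp
  qed
qed

text \<open>Equal neighbours are primed in a column and plain in a row, so these neighbours are
  strictly smaller. They are the ones that \<open>reversible\<close> asks for.\<close>

lemma semistandard_smaller:
  assumes "semistandard T" "T (r, c) = Some w"
  shows "w = Plain (val w) \<Longrightarrow> 1 < r \<Longrightarrow> \<exists>v. T (r - 1, c) = Some v \<and> v < w"
    and "w \<noteq> Plain (val w) \<Longrightarrow> r < c \<Longrightarrow> \<exists>v. T (r, c - 1) = Some v \<and> v < w"
proof -
  show "\<exists>v. T (r - 1, c) = Some v \<and> v < w" if hyp: "w = Plain (val w)" "1 < r"
  proof -
    have "1 \<le> r - 1" "r - 1 < r" using hyp(2) by linarith+
    then obtain y where y: "T (r - 1, c) = Some y"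
      using semistandard_before(2)[OF assms, of "r - 1"] by blast
    then show ?thesis
      using semistandard_col[OF assms(1) y, of w] assms(2) hyp by (cases w) auto
  qed
  show "\<exists>v. T (r, c - 1) = Some v \<and> v < w" if hyp: "w \<noteq> Plain (val w)" "r < c"
  proof -
    have "r \<le> c - 1" "c - 1 < c" using hyp(2) by linarith+
    then obtain y where y: "T (r, c - 1) = Some y"
      using semistandard_before(1)[OF assms, of "c - 1"] by blast
    then show ?thesis
      using semistandard_row[OF assms(1) y, of w] assms(2) hyp by (cases w) auto
  qed
qed

section \<open>Reverse mixed insertion\<close>

definition plain_diag :: "ptab \<Rightarrow> bool" where
  "plain_diag T \<longleftrightarrow> (\<forall>i x. T (i, i) = Some x \<longrightarrow> x = Plain (val x))"

lemma semistandard_update: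
  assumes T: "semistandard T" and b: "T (r, c) \<noteq> None"
    and "\<And>x. T (r, c - 1) = Some x \<Longrightarrow> 0 < c \<Longrightarrow> x < z \<or> x = z \<and> z = Plain (val z)"
    and "\<And>y. T (r, Suc c) = Some y \<Longrightarrow> z < y \<or> z = y \<and> z = Plain (val z)"
    and "\<And>x. T (r - 1, c) = Some x \<Longrightarrow> 0 < r \<Longrightarrow> x < z \<or> x = z \<and> z = Primed (val z)"
    and "\<And>y. T (Suc r, c) = Some y \<Longrightarrow> z < y \<or> z = y \<and> z = Primed (val z)"
  shows "semistandard (T((r, c) \<mapsto> z))"
  unfolding semistandard_def
proof (intro conjI allI impI; (elim conjE)?)
  have "dom (T((r, c) \<mapsto> z)) = dom T" using b by auto
  then show "shifted_shape (dom (T((r, c) \<mapsto> z)))" using semistandard_shape[OF T] by metis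
next
  fix r' c' x y
  assume *: "(T((r, c) \<mapsto> z)) (r', c') = Some x" "(T((r, c) \<mapsto> z)) (r', Suc c') = Some y"
  consider "(r', c') = (r, c)" | "(r', Suc c') = (r, c)" | "(r', c') \<noteq> (r, c)" "(r', Suc c') \<noteq> (r, c)" by blast
  then show "x < y \<or> x = y \<and> x = Plain (val x)"
  proof cases
    case 1
    then show ?thesis using assms(4)[of y] * by simp
  next
    case 2
    then show ?thesis using assms(3)[of x] * by auto
  next
    case 3
    then have "T (r', c') = Some x" "T (r', Suc c') = Some y" using * by (auto split: if_splits)
    then show ?thesis by (rule semistandard_row[OF T])
  qed
next
  fix r' c' x y
  assume *: "(T((r, c) \<mapsto> z)) (r', c') = Some x" "(T((r, c) \<mapsto> z)) (Suc r', c') = Some y"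
  consider "(r', c') = (r, c)" | "(Suc r', c') = (r, c)" | "(r', c') \<noteq> (r, c)" "(Suc r', c') \<noteq> (r, c)" by blast
  then show "x < y \<or> x = y \<and> x = Primed (val x)"
  proof cases
    case 1
    then show ?thesis using assms(6)[of y] * by simp
  next
    case 2
    then show ?thesis using assms(5)[of x] * by auto
  next
    case 3
    then have "T (r', c') = Some x" "T (Suc r', c') = Some y" using * by (auto split: if_splits)
    then show ?thesis by (rule semistandard_col[OF T])
  qed
qed

lemma hm_insert_new: "hm_box l x T = b \<Longrightarrow> T b = None \<Longrightarrow> hm_insert l x T = (T(b \<mapsto> x), b)"
  by (subst hm_insert.simps) simp

lemma hm_insert_diag: "hm_box l x T = (i, i) \<Longrightarrow> T (i, i) = Some y \<Longrightarrow>
    hm_insert l x T = hm_insert (Col (Suc i)) (Primed (val y)) (T((i, i) \<mapsto> x))"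
  by (subst hm_insert.simps) simp

lemma hm_insert_plain: "hm_box l x T = (i, j) \<Longrightarrow> i \<noteq> j \<Longrightarrow> T (i, j) = Some (Plain k) \<Longrightarrow>
    hm_insert l x T = hm_insert (Row (Suc i)) (Plain k) (T((i, j) \<mapsto> x))"
  by (subst hm_insert.simps) simp

lemma hm_insert_primed: "hm_box l x T = (i, j) \<Longrightarrow> i \<noteq> j \<Longrightarrow> T (i, j) = Some (Primed k) \<Longrightarrow>
    hm_insert l x T = hm_insert (Col (Suc j)) (Primed k) (T((i, j) \<mapsto> x))"
  by (subst hm_insert.simps) simp

text \<open>The invariant of reverse insertion: the letter \<open>z\<close> is about to enter line \<open>l\<close> of \<open>S\<close> at its landing box,
  and hyp box has a smaller neighbour in the preceding line.\<close>

definition reversible :: "line \<Rightarrow> letter \<Rightarrow> ptab \<Rightarrow> bool" where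
  "reversible l z S \<longleftrightarrow>
     (case l of
        Row i \<Rightarrow> 1 \<le> i \<and> z = Plain (val z) \<and> (1 < i \<longrightarrow>
          (\<exists>p w. i \<le> p \<and> (\<forall>y. S (i, p) = Some y \<longrightarrow> z < y) \<and> S (i - 1, p) = Some w \<and> w < z))
      | Col j \<Rightarrow> z = Primed (val z) \<and>
          (\<exists>p w. 1 \<le> p \<and> p < j \<and> (\<forall>y. S (p, j) = Some y \<longrightarrow> z < y) \<and> S (p, j - 1) = Some w \<and> w < z))"

text \<open>An order embedding for induction on letters; its parity separates primed from
  plain.\<close>

fun rank :: "letter \<Rightarrow> nat" where
  "rank (Primed k) = 2 * k"
| "rank (Plain k) = 2 * k + 1"

lemma rank_less: "x < y \<longleftrightarrow> rank x < rank y"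
  by (cases x; cases y) (auto simp: less_letter_def)

text \<open>A plain \<open>w\<close> is to be inserted into its row and a primed \<open>w\<close>
  into its column. Everything before its box in that line is at most \<open>w\<close>, and the box
  now holds \<open>z' > w\<close>, so forward insertion lands there again.\<close>

lemma reversible_bumped:
  assumes S: "semistandard S" "plain_diag S" and w: "S (r, c) = Some w" and z: "w < z" "z' = Plain (val z) \<or> z' = z"
  defines "S' \<equiv> S((r, c) \<mapsto> z')"
  defines "l' \<equiv> (if w = Plain (val w) then Row r else Col c)"
  shows "reversible l' w S'" "hm_box l' w S' = (r, c)"
proof -
  have pos: "1 \<le> r" "r \<le> c"
    using shifted_shape_pos[OF semistandard_shape[OF S(1)], of r c] w by auto
  have wz: "w < z'"
    using z by (cases z; cases w) (auto simp: less_letter_def)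
  have S'b: "S' (r, c) = Some z'" by (simp add: S'_def)
  have row: "\<exists>y. S' (r, c') = Some y \<and> y \<le> w" if hyp: "r \<le> c'" "c' < c" for c'
    using semistandard_before(1)[OF S(1) w hyp] hyp by (simp add: S'_def)
  have col: "\<exists>y. S' (r', c) = Some y \<and> y \<le> w" if hyp: "1 \<le> r'" "r' < r" for r'
    using semistandard_before(2)[OF S(1) w hyp] hyp by (simp add: S'_def)
  show "hm_box l' w S' = (r, c)"
  proof (cases "w = Plain (val w)")
    case True
    then show ?thesis
      unfolding l'_def using hm_box_RowI[of r c S' w] row wz S'b pos by simp
  next
    case False
    then show ?thesis
      unfolding l'_def using hm_box_ColI[of r S' c w] col wz S'b pos by simp
  qed
  show "reversible l' w S'"
  proof (cases "w = Plain (val w)")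
    case True
    have "\<exists>v. S' (r - 1, c) = Some v \<and> v < w" if hyp: "1 < r"
      using semistandard_smaller(1)[OF S(1) w True hyp] hyp by (auto simp: S'_def)
    then show ?thesis
      using True wz S'b pos unfolding l'_def reversible_def by fastforce
  next
    case False
    then have "r \<noteq> c" using S(2) w unfolding plain_diag_def by blast
    then have "r < c" using pos by simp
    then obtain y where "S (r, c - 1) = Some y \<and> y < w"
      using semistandard_smaller(2)[OF S(1) w False] by blast
    then have "S' (r, c - 1) = Some y \<and> y < w" using \<open>r < c\<close> by (auto simp: S'_def)
    moreover have "w = Primed (val w)" using False by (cases w) auto
    ultimately show ?thesis
      using False wz S'b pos \<open>r < c\<close> unfolding l'_def reversible_def by (simp, intro exI[of _ r]) simp
  qed
qed

text \<open>Of the boxes in the preceding line with an entry below \<open>z\<close> the last one is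
  chosen: the entries beyond it are at least \<open>z\<close>, so \<open>z\<close> fits there. On
  the diagonal it becomes plain, because forward insertion primes what it bumps from the
  diagonal.\<close>

lemma reverse_step:
  assumes S: "semistandard S" "plain_diag S" and rev: "reversible l z S" "l \<noteq> Row 1"
  obtains l' w S' where "semistandard S'" "plain_diag S'" "reversible l' w S'" "w < z" "dom S' = dom S"
    "hm_insert l' w S' = hm_insert l z S" "\<exists>b. S' = S(b \<mapsto> z) \<or> S' = S(b \<mapsto> Plain (val z))" "\<exists>b. S b = Some w"
proof (cases l)
  case (Row i)
  then obtain p w0 where z: "z = Plain (val z)" and i: "1 < i" and p: "i \<le> p" "\<forall>y. S (i, p) = Some y \<longrightarrow> z < y"
    "S (i - 1, p) = Some w0" "w0 < z"
    using rev unfolding reversible_def by (auto simp: le_less)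
  let ?C = "{c. \<exists>w. S (i - 1, c) = Some w \<and> w < z}"
  have "?C \<subseteq> snd ` dom S" by force
  then have "finite ?C" using semistandard_shape[OF S(1)] finite_subset unfolding shifted_shape_def by blast
  define c where "c = Max ?C"
  have "c \<in> ?C" "p \<le> c" using Max_in[OF \<open>finite ?C\<close>] Max_ge[OF \<open>finite ?C\<close>] p(3,4) unfolding c_def by auto
  then obtain w where w: "S (i - 1, c) = Some w" "w < z" by blast
  define S' where "S' = S((i - 1, c) \<mapsto> z)"
  have right: "z \<le> y" if hyp: "S (i - 1, Suc c) = Some y" for y
  proof (rule ccontr)
    assume "\<not> z \<le> y"
    then have "Suc c \<in> ?C" using hyp by auto
    then have "Suc c \<le> c" using Max_ge[OF \<open>finite ?C\<close>] unfolding c_def by blast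
    then show False by simp
  qed
  \<comment> \<open>As \<open>p \<le> c\<close>, an entry below the chosen box is at least the entry
    at \<open>(i, p)\<close>, which exceeds \<open>z\<close>.\<close>
  have below: "z < y" if hyp: "S (i, c) = Some y" for y
  proof -
    obtain y0 where y0: "S (i, p) = Some y0"
      using semistandard_fill[OF S(1) hyp, of i p] p(1) \<open>p \<le> c\<close> i by auto
    then show ?thesis
      using semistandard_row_le[OF S(1) y0, of "c - p" y] hyp p(2) \<open>p \<le> c\<close> by fastforce
  qed
  have left: "x \<le> w" if hyp: "S (i - 1, c - 1) = Some x" "0 < c" for x
    using semistandard_row_le[OF S(1) hyp(1), of 1 w] w(1) hyp(2) by simp
  have above: "x \<le> w" if hyp: "S (i - 1 - 1, c) = Some x" "0 < i - 1" for x
  proof -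
    have "i - 1 - 1 + 1 = i - 1" using hyp(2) by simp
    then show ?thesis using semistandard_col_le[OF S(1) hyp(1), of 1 w] w(1) by metis
  qed
  have ss: "semistandard S'"
    unfolding S'_def using S(1)
  proof (rule semistandard_update)
    show "S (i - 1, c) \<noteq> None" using w by simp
    show "x < z \<or> x = z \<and> z = Plain (val z)" if hyp: "S (i - 1, c - 1) = Some x" "0 < c" for x
      using left[OF hyp] w(2) by auto
    show "z < y \<or> z = y \<and> z = Plain (val z)" if hyp: "S (i - 1, Suc c) = Some y" for y
      using right[OF hyp] z by auto
    show "x < z \<or> x = z \<and> z = Primed (val z)" if hyp: "S (i - 1 - 1, c) = Some x" "0 < i - 1" for x
      using above[OF hyp] w(2) by auto
    show "z < y \<or> z = y \<and> z = Primed (val z)" if hyp: "S (Suc (i - 1), c) = Some y" for y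
      using below hyp i by simp
  qed
  have "i - 1 \<noteq> c" using p(1) \<open>p \<le> c\<close> i by simp
  then have pd: "plain_diag S'" using S(2) unfolding plain_diag_def S'_def by auto
  define l' where "l' = (if w = Plain (val w) then Row (i - 1) else Col c)"
  note R = reversible_bumped[OF S w, of z, folded S'_def l'_def]
  have "hm_insert l' w S' = hm_insert (Row (Suc (i - 1))) (Plain (val z)) (S'((i - 1, c) \<mapsto> w))"
    using hm_insert_plain[OF R(2) \<open>i - 1 \<noteq> c\<close>, of "val z"] z by (simp add: S'_def)
  moreover have "S'((i - 1, c) \<mapsto> w) = S" using w by (auto simp: S'_def)
  ultimately have ins: "hm_insert l' w S' = hm_insert l z S" using Row z i by simp
  show ?thesis
    using that[OF ss pd R(1) w(2) _ ins] w S'_def by auto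
next
  case (Col j)
  then obtain p w0 where z: "z = Primed (val z)" and p: "1 \<le> p" "p < j" "\<forall>y. S (p, j) = Some y \<longrightarrow> z < y"
    "S (p, j - 1) = Some w0" "w0 < z"
    using rev unfolding reversible_def by auto
  let ?C = "{r. \<exists>w. S (r, j - 1) = Some w \<and> w < z}"
  have "?C \<subseteq> fst ` dom S" by force
  then have "finite ?C" using semistandard_shape[OF S(1)] finite_subset unfolding shifted_shape_def by blast
  define r where "r = Max ?C"
  have "r \<in> ?C" "p \<le> r" using Max_in[OF \<open>finite ?C\<close>] Max_ge[OF \<open>finite ?C\<close>] p(4,5) unfolding r_def by auto
  then obtain w where w: "S (r, j - 1) = Some w" "w < z" by blast
  have rj: "1 \<le> r" "r \<le> j - 1"
    using shifted_shape_pos[OF semistandard_shape[OF S(1)], of r "j - 1"] w by auto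
  define z' where "z' = (if r = j - 1 then Plain (val z) else z)"
  define S' where "S' = S((r, j - 1) \<mapsto> z')"
  have "z \<le> z'" using z by (cases z) (auto simp: z'_def less_eq_letter_def less_letter_def)
  have next_z: "z' \<le> y" if hyp: "z < y" for y
    using z hyp by (cases z; cases y) (auto simp: z'_def less_eq_letter_def less_letter_def)
  have below: "z \<le> y" if hyp: "S (Suc r, j - 1) = Some y" for y
  proof (rule ccontr)
    assume "\<not> z \<le> y"
    then have "Suc r \<in> ?C" using hyp by auto
    then have "Suc r \<le> r" using Max_ge[OF \<open>finite ?C\<close>] unfolding r_def by blast
    then show False by simp
  qed
  have right: "z < y" if hyp: "S (r, j) = Some y" for y
  proof -
    obtain y0 where y0: "S (p, j) = Some y0"
      using semistandard_fill[OF S(1) hyp, of p j] p \<open>p \<le> r\<close> by auto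
    then show ?thesis
      using semistandard_col_le[OF S(1) y0, of "r - p" y] hyp p(3) \<open>p \<le> r\<close> by fastforce
  qed
  have left: "x \<le> w" if hyp: "S (r, j - 1 - 1) = Some x" "0 < j - 1" for x
  proof -
    have "j - 1 - 1 + 1 = j - 1" using hyp(2) by simp
    then show ?thesis using semistandard_row_le[OF S(1) hyp(1), of 1 w] w(1) by metis
  qed
  have above: "x \<le> w" if hyp: "S (r - 1, j - 1) = Some x" "0 < r" for x
    using semistandard_col_le[OF S(1) hyp(1), of 1 w] w(1) hyp(2) by simp
  have ss: "semistandard S'"
    unfolding S'_def using S(1)
  proof (rule semistandard_update)
    show "S (r, j - 1) \<noteq> None" using w by simp
    show "x < z' \<or> x = z' \<and> z' = Plain (val z')" if hyp: "S (r, j - 1 - 1) = Some x" "0 < j - 1" for x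
      using left[OF hyp] w(2) \<open>z \<le> z'\<close> by auto
    show "z' < y \<or> z' = y \<and> z' = Plain (val z')" if hyp: "S (r, Suc (j - 1)) = Some y" for y
      using next_z[OF right, of y] right[of y] hyp p z by (auto simp: z'_def)
    show "x < z' \<or> x = z' \<and> z' = Primed (val z')" if hyp: "S (r - 1, j - 1) = Some x" "0 < r" for x
      using above[OF hyp] w(2) \<open>z \<le> z'\<close> by auto
    show "z' < y \<or> z' = y \<and> z' = Primed (val z')" if hyp: "S (Suc r, j - 1) = Some y" for y
    proof -
      have "Suc r \<le> j - 1"
        using shifted_shape_pos[OF semistandard_shape[OF S(1)], of "Suc r" "j - 1"] hyp by blast
      then show ?thesis using below[OF hyp] z by (auto simp: z'_def)
    qed
  qed
  have pd: "plain_diag S'" using S(2) unfolding plain_diag_def S'_def z'_def by auto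
  define l' where "l' = (if w = Plain (val w) then Row r else Col (j - 1))"
  have "z' = Plain (val z) \<or> z' = z" by (simp add: z'_def)
  note R = reversible_bumped[OF S w this, folded S'_def l'_def]
  have restore: "S'((r, j - 1) \<mapsto> w) = S" using w by (auto simp: S'_def)
  have "hm_insert l' w S' = hm_insert (Col (Suc (j - 1))) (Primed (val z)) (S'((r, j - 1) \<mapsto> w))"
  proof (cases "r = j - 1")
    case True
    then show ?thesis
      using hm_insert_diag[of l' w S' r z'] R(2) by (simp add: S'_def z'_def)
  next
    case False
    then show ?thesis
      using hm_insert_primed[OF R(2) False, of "val z"] z by (simp add: S'_def z'_def)
  qed
  then have ins: "hm_insert l' w S' = hm_insert l z S" using Col z restore p by simp
  have updated: "\<exists>b. S' = S(b \<mapsto> z) \<or> S' = S(b \<mapsto> Plain (val z))"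
    unfolding S'_def z'_def by (rule exI[of _ "(r, j - 1)"]) simp
  show ?thesis
  proof (rule that[OF ss pd R(1) w(2) _ ins updated])
    show "dom S' = dom S" using w(1) by (auto simp: S'_def)
    show "\<exists>b. S b = Some w" using w(1) by blast
  qed
qed

text \<open>Every step back makes the letter strictly smaller, so the process ends, and it can end
  only in row 1.\<close>

lemma reverse_insertion:
  assumes "semistandard S" "plain_diag S" "reversible l z S"
    and "\<forall>b x. S b = Some x \<longrightarrow> 1 \<le> val x \<and> val x \<le> m" "1 \<le> val z" "val z \<le> m"
  shows "\<exists>S' k. semistandard S' \<and> plain_diag S' \<and> dom S' = dom S \<and> 1 \<le> k \<and> k \<le> m \<and>
    hm_insert (Row 1) (Plain k) S' = hm_insert l z S \<and>
    (\<forall>b x. S' b = Some x \<longrightarrow> 1 \<le> val x \<and> val x \<le> m)"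
  using assms
proof (induction "rank z" arbitrary: S l z rule: less_induct)
  case less
  show ?case
  proof (cases "l = Row 1")
    case True
    then have "z = Plain (val z)" using less.prems(3) by (simp add: reversible_def)
    then show ?thesis using less.prems True by metis
  next
    case False
    obtain l' w S' where *: "semistandard S'" "plain_diag S'" "reversible l' w S'" "w < z" "dom S' = dom S"
      "hm_insert l' w S' = hm_insert l z S" "\<exists>b. S' = S(b \<mapsto> z) \<or> S' = S(b \<mapsto> Plain (val z))" "\<exists>b. S b = Some w"
      using reverse_step[OF less.prems(1-3) False] .
    have "\<forall>b x. S' b = Some x \<longrightarrow> 1 \<le> val x \<and> val x \<le> m"
      using *(7) less.prems(4-6) by (auto split: if_splits)
    moreover have "1 \<le> val w" "val w \<le> m" using *(8) less.prems(4) by blast+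
    ultimately show ?thesis
      using less.hyps[OF _ *(1-3)] *(4-6) by (metis rank_less)
  qed
qed

lemma semistandard_remove_corner:
  assumes T: "semistandard T" "plain_diag T" "T (r, c) = Some z" "T (r, Suc c) = None" "T (Suc r, c) = None"
  defines "S \<equiv> T((r, c) := None)"
  defines "l \<equiv> (if z = Plain (val z) then Row r else Col c)"
  shows "semistandard S" "plain_diag S" "reversible l z S" "hm_insert l z S = (T, (r, c))"
proof -
  have pos: "1 \<le> r" "r \<le> c"
    using shifted_shape_pos[OF semistandard_shape[OF T(1)], of r c] T(3) by auto
  have "shifted_shape (dom S)"
    unfolding shifted_shape_def
  proof (intro conjI allI impI ballI)
    show "finite (dom S)"
      using semistandard_shape[OF T(1)] unfolding shifted_shape_def by (simp add: S_def)
    fix x assume "x \<in> dom S"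
    then show "case x of (r, c) \<Rightarrow> 1 \<le> r \<and> r \<le> c"
      using semistandard_shape[OF T(1)] unfolding shifted_shape_def S_def by (auto split: if_splits)
  next
    fix r' c' assume *: "(r', c') \<in> dom S" "r' < c'"
    then have "(r', c' - 1) \<in> dom T"
      using semistandard_shape[OF T(1)] unfolding shifted_shape_def S_def by (auto split: if_splits)
    moreover have "(r', c' - 1) \<noteq> (r, c)"
      using * T(4) unfolding S_def by (auto split: if_splits)
    ultimately show "(r', c' - 1) \<in> dom S" unfolding S_def by auto
  next
    fix r' c' assume *: "(r', c') \<in> dom S" "1 < r'"
    then have "(r' - 1, c') \<in> dom T"
      using semistandard_shape[OF T(1)] unfolding shifted_shape_def S_def by (auto split: if_splits)
    moreover have "(r' - 1, c') \<noteq> (r, c)"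
      using * T(5) unfolding S_def by (auto split: if_splits)
    ultimately show "(r' - 1, c') \<in> dom S" unfolding S_def by auto
  qed
  then show "semistandard S"
    using T(1) unfolding semistandard_def S_def by (auto split: if_splits)
  show "plain_diag S" using T(2) unfolding plain_diag_def S_def by (auto split: if_splits)
  have Sb: "S (r, c) = None" by (simp add: S_def)
  have row: "\<exists>y. S (r, c') = Some y \<and> y \<le> z" if hyp: "r \<le> c'" "c' < c" for c'
    using semistandard_before(1)[OF T(1,3) hyp] hyp by (simp add: S_def)
  have col: "\<exists>y. S (r', c) = Some y \<and> y \<le> z" if hyp: "1 \<le> r'" "r' < r" for r'
    using semistandard_before(2)[OF T(1,3) hyp] hyp by (simp add: S_def)
  have "hm_box l z S = (r, c)"
    unfolding l_def using hm_box_RowI[of r c S z] hm_box_ColI[of r S c z] row col Sb pos by simp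
  moreover have "S((r, c) \<mapsto> z) = T" using T(3) by (auto simp: S_def)
  ultimately show "hm_insert l z S = (T, (r, c))"
    using hm_insert_new Sb by metis
  show "reversible l z S"
  proof (cases "z = Plain (val z)")
    case True
    have "\<exists>v. S (r - 1, c) = Some v \<and> v < z" if hyp: "1 < r"
      using semistandard_smaller(1)[OF T(1,3) True hyp] hyp by (auto simp: S_def)
    then show ?thesis
      using True Sb pos unfolding l_def reversible_def by fastforce
  next
    case False
    then have "r \<noteq> c" using T(2,3) unfolding plain_diag_def by blast
    then have "r < c" using pos by simp
    then obtain y where "T (r, c - 1) = Some y \<and> y < z"
      using semistandard_smaller(2)[OF T(1,3) False] by blast
    then have "S (r, c - 1) = Some y \<and> y < z" using \<open>r < c\<close> by (auto simp: S_def)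
    moreover have "z = Primed (val z)" using False by (cases z) auto
    ultimately show ?thesis
      using False Sb pos \<open>r < c\<close> unfolding l_def reversible_def by (simp, intro exI[of _ r]) simp
  qed
qed

lemma HM_snoc: "HM (b @ [x]) = HM_step (HM b) (Suc (length b), x)"
  by (simp add: HM_def enumerate_append_eq)

text \<open>The box with the largest entry of \<open>Q\<close> is a corner. Removing it and running
  the insertion backwards gives the last letter of the word; induction gives the others.\<close>

lemma HM_surj:
  assumes "semistandard T" "plain_diag T" "\<forall>b x. T b = Some x \<longrightarrow> 1 \<le> val x \<and> val x \<le> m"
    and "dom Q = dom T" "bij_betw (\<lambda>b. the (Q b)) (dom T) {1..card (dom T)}"
    and "\<forall>i j x y. Q (i, j) = Some x \<and> Q (i, Suc j) = Some y \<longrightarrow> x < y"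
    and "\<forall>i j x y. Q (i, j) = Some x \<and> Q (Suc i, j) = Some y \<longrightarrow> x < y"
  shows "\<exists>b\<in>lists {1..m}. HM b = (T, Q) \<and> length b = card (dom T)"
  using assms
proof (induction "card (dom T)" arbitrary: T Q)
  case 0
  have "finite (dom T)" using semistandard_shape[OF 0(2)] by (simp add: shifted_shape_def)
  then have "dom T = {}" using 0(1) by simp
  then have "T = Map.empty" "Q = Map.empty" using 0(5) by simp_all
  then show ?case by (intro bexI[of _ "[]"]) (auto simp: HM_def)
next
  case (Suc N)
  have fin: "finite (dom T)" using semistandard_shape[OF Suc.prems(1)] by (simp add: shifted_shape_def)
  have bij: "bij_betw (\<lambda>b. the (Q b)) (dom T) {1..Suc N}" using Suc.prems(5) Suc.hyps(2) by simp
  have "Suc N \<in> (\<lambda>b. the (Q b)) ` dom T"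
    using bij unfolding bij_betw_def by simp
  then obtain b0 where "b0 \<in> dom T" "the (Q b0) = Suc N" by (metis imageE)
  then obtain r c where rc: "(r, c) \<in> dom T" "the (Q (r, c)) = Suc N" by (cases b0) blast
  then have Qrc: "Q (r, c) = Some (Suc N)" using Suc.prems(4) by (metis domD option.sel)
  have le: "y \<le> Suc N" if hyp: "Q b = Some y" for b y
  proof -
    have "b \<in> dom T" using hyp Suc.prems(4) by auto
    then have "the (Q b) \<in> {1..Suc N}" using bij unfolding bij_betw_def by blast
    then show ?thesis using hyp by simp
  qed
  have "Q (r, Suc c) = None" "Q (Suc r, c) = None"
    using Suc.prems(6)[rule_format, of r c "Suc N"] Suc.prems(7)[rule_format, of r c "Suc N"] Qrc le
    by (meson not_less not_None_eq)+
  then have corner: "T (r, Suc c) = None" "T (Suc r, c) = None"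
    using Suc.prems(4) by (metis domIff)+
  obtain z where z: "T (r, c) = Some z" using rc by auto
  define S where "S = T((r, c) := None)"
  define l where "l = (if z = Plain (val z) then Row r else Col c)"
  note C = semistandard_remove_corner[OF Suc.prems(1,2) z corner, folded S_def l_def]
  have Sval: "\<forall>b x. S b = Some x \<longrightarrow> 1 \<le> val x \<and> val x \<le> m"
    using Suc.prems(3) unfolding S_def by (auto split: if_splits)
  have "1 \<le> val z" "val z \<le> m" using Suc.prems(3) z by blast+
  then obtain S' k where S': "semistandard S'" "plain_diag S'" "dom S' = dom S" "1 \<le> k" "k \<le> m"
    "hm_insert (Row 1) (Plain k) S' = (T, (r, c))" "\<forall>b x. S' b = Some x \<longrightarrow> 1 \<le> val x \<and> val x \<le> m"
    using reverse_insertion[OF C(1-3) Sval] C(4) by metis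
  define Q' where "Q' = Q((r, c) := None)"
  have dS: "dom S' = dom T - {(r, c)}" using S'(3) by (simp add: S_def)
  have card: "card (dom S') = N" using dS rc(1) fin Suc.hyps(2) by simp
  have "bij_betw (\<lambda>b. the (Q b)) (dom T - {(r, c)}) ({1..Suc N} - {the (Q (r, c))})"
    using bij rc(1) by (intro bij_betw_DiffI) (auto simp: bij_betw_def rc(2))
  moreover have "{1..Suc N} - {Suc N} = {1..N}" by auto
  ultimately have "bij_betw (\<lambda>b. the (Q b)) (dom S') {1..N}" using rc(2) dS by simp
  then have bij': "bij_betw (\<lambda>b. the (Q' b)) (dom S') {1..N}"
    by (rule bij_betw_cong[THEN iffD1, rotated]) (auto simp: Q'_def dS)
  have "\<exists>b\<in>lists {1..m}. HM b = (S', Q') \<and> length b = card (dom S')"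
  proof (rule Suc.hyps(1))
    show "N = card (dom S')" using card by simp
    show "dom Q' = dom S'" using Suc.prems(4) dS by (simp add: Q'_def)
    show "bij_betw (\<lambda>b. the (Q' b)) (dom S') {1..card (dom S')}" using bij' card by simp
    show "\<forall>i j x y. Q' (i, j) = Some x \<and> Q' (i, Suc j) = Some y \<longrightarrow> x < y"
      using Suc.prems(6) by (auto simp: Q'_def split: if_splits)
    show "\<forall>i j x y. Q' (i, j) = Some x \<and> Q' (Suc i, j) = Some y \<longrightarrow> x < y"
      using Suc.prems(7) by (auto simp: Q'_def split: if_splits)
  qed (use S' in auto)
  then obtain b where b: "b \<in> lists {1..m}" "HM b = (S', Q')" "length b = N" using card by auto
  have "Q'((r, c) \<mapsto> Suc N) = Q" using Qrc by (auto simp: Q'_def)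
  then have "HM (b @ [k]) = (T, Q)"
    using b(2,3) S'(6) by (simp add: HM_snoc HM_step_def)
  then show ?case
    using b(1,3) S'(4,5) Suc.hyps(2) by (intro bexI[of _ "b @ [k]"]) auto
qed


section \<open>The odd operator under mixed insertion\<close>

text \<open>The graph of the terminating runs of the partial function \<open>hm_insert\<close>,
  which supplies an induction rule. Each bump records that the bumped letter is larger;
  \<open>hm_run_total\<close> provides existence on finite tableaux.\<close>

inductive hm_run :: "line \<Rightarrow> letter \<Rightarrow> ptab \<Rightarrow> ptab \<Rightarrow> box \<Rightarrow> bool" where
  new: "hm_box l x T = b \<Longrightarrow> T b = None \<Longrightarrow> hm_run l x T (T(b \<mapsto> x)) b"
| diag: "hm_box l x T = (i, i) \<Longrightarrow> T (i, i) = Some y \<Longrightarrow> x < y \<Longrightarrow>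
    hm_run (Col (Suc i)) (Primed (val y)) (T((i, i) \<mapsto> x)) T' b \<Longrightarrow> hm_run l x T T' b"
| plain: "hm_box l x T = (i, j) \<Longrightarrow> i \<noteq> j \<Longrightarrow> T (i, j) = Some (Plain k) \<Longrightarrow> x < Plain k \<Longrightarrow>
    hm_run (Row (Suc i)) (Plain k) (T((i, j) \<mapsto> x)) T' b \<Longrightarrow> hm_run l x T T' b"
| primed: "hm_box l x T = (i, j) \<Longrightarrow> i \<noteq> j \<Longrightarrow> T (i, j) = Some (Primed k) \<Longrightarrow> x < Primed k \<Longrightarrow>
    hm_run (Col (Suc j)) (Primed k) (T((i, j) \<mapsto> x)) T' b \<Longrightarrow> hm_run l x T T' b"

lemma hm_run_insert: "hm_run l x T T' b \<Longrightarrow> hm_insert l x T = (T', b)"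
proof (induction rule: hm_run.induct)
  case (new l x T b)
  show ?case by (rule hm_insert_new[OF new])
next
  case (diag l x T i y T' b)
  show ?case by (rule trans[OF hm_insert_diag[OF diag(1,2)] diag(5)])
next
  case (plain l x T i j k T' b)
  show ?case by (rule trans[OF hm_insert_plain[OF plain(1-3)] plain(6)])
next
  case (primed l x T i j k T' b)
  show ?case by (rule trans[OF hm_insert_primed[OF primed(1-3)] primed(6)])
qed

lemma hm_run_finite: "hm_run l x T T' b \<Longrightarrow> finite (dom T) \<Longrightarrow> finite (dom T')"
  by (induction rule: hm_run.induct) simp_all

text \<open>A letter bumped from the diagonal is lowered by its prime, but not below the letter that
  bumped it; so the inserted letters weakly increase along a run.\<close>

lemma Primed_val_ge: "x < y \<Longrightarrow> x \<le> Primed (val y)"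
  by (cases x; cases y) (auto simp: less_letter_def less_eq_letter_def)

lemma hm_run_entries: "hm_run l x T T' b \<Longrightarrow> T' p = Some y \<Longrightarrow> T p = Some y \<or> x \<le> y"
proof (induction rule: hm_run.induct)
  case (new l x T b)
  then show ?case by (cases "p = b") auto
next
  case (diag l x T i z T' b)
  have "(T((i, i) \<mapsto> x)) p = Some y \<or> Primed (val z) \<le> y" by (rule diag(5)[OF diag(6)])
  then show ?case using Primed_val_ge[OF diag(3)] by (cases "p = (i, i)") (auto intro: order_trans)
next
  case (plain l x T i j k T' b)
  have "(T((i, j) \<mapsto> x)) p = Some y \<or> Plain k \<le> y" by (rule plain(6)[OF plain(7)])
  then show ?case using plain(4) by (cases "p = (i, j)") (auto intro: order_trans)
next
  case (primed l x T i j k T' b)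
  have "(T((i, j) \<mapsto> x)) p = Some y \<or> Primed k \<le> y" by (rule primed(6)[OF primed(7)])
  then show ?case using primed(4) by (cases "p = (i, j)") (auto intro: order_trans)
qed

lemma hm_box_bound:
  assumes "\<And>y. T (hm_box l x T) = Some y \<Longrightarrow> x < y" "T \<beta> = Some e" "e \<le> x" "e' \<le> x"
  shows "hm_box l x (T(\<beta> \<mapsto> e')) = hm_box l x T \<and> hm_box l x T \<noteq> \<beta>"
proof -
  have "(\<forall>y. (T(\<beta> \<mapsto> e')) p = Some y \<longrightarrow> x < y) \<longleftrightarrow> (\<forall>y. T p = Some y \<longrightarrow> x < y)" for p
    using assms(2-4) by (cases "p = \<beta>") (auto simp: not_less)
  then have "hm_box l x (T(\<beta> \<mapsto> e')) = hm_box l x T" by (cases l) simp_all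
  moreover have "hm_box l x T \<noteq> \<beta>" using assms by fastforce
  ultimately show ?thesis by simp
qed

text \<open>Insertion of \<open>x\<close> looks only for entries greater than \<open>x\<close>, and
  the letters of a run never get smaller; a box whose entry is at most \<open>x\<close> before and
  after the change is invisible to the whole run.\<close>

lemma hm_run_parallel:
  "hm_run l x T T' b \<Longrightarrow> T \<beta> = Some e \<Longrightarrow> e \<le> x \<Longrightarrow> e' \<le> x \<Longrightarrow>
     hm_run l x (T(\<beta> \<mapsto> e')) (T'(\<beta> \<mapsto> e')) b \<and> T' \<beta> = Some e"
proof (induction rule: hm_run.induct)
  case (new l x T b)
  have *: "hm_box l x (T(\<beta> \<mapsto> e')) = hm_box l x T \<and> hm_box l x T \<noteq> \<beta>"
    by (rule hm_box_bound) (use new in auto)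
  then have run: "hm_run l x (T(\<beta> \<mapsto> e')) ((T(\<beta> \<mapsto> e'))(b \<mapsto> x)) b"
    using new by (intro hm_run.new) auto
  have twist: "(T(\<beta> \<mapsto> e'))(b \<mapsto> x) = (T(b \<mapsto> x))(\<beta> \<mapsto> e')"
    using * new(1) by (auto simp: fun_upd_twist)
  have "(T(b \<mapsto> x)) \<beta> = Some e" using * new by auto
  with run[unfolded twist] show ?case by (rule conjI)
next
  case (diag l x T i y T' b)
  have *: "hm_box l x (T(\<beta> \<mapsto> e')) = hm_box l x T \<and> hm_box l x T \<noteq> \<beta>"
    by (rule hm_box_bound) (use diag in auto)
  have ne: "(i, i) \<noteq> \<beta>" using * diag(1) by simp
  have le: "x \<le> Primed (val y)" using Primed_val_ge[OF diag(3)] by simp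
  have IH: "hm_run (Col (Suc i)) (Primed (val y)) ((T((i, i) \<mapsto> x))(\<beta> \<mapsto> e')) (T'(\<beta> \<mapsto> e')) b \<and> T' \<beta> = Some e"
    using diag.prems ne le by (intro diag(5)) (auto intro: order_trans)
  moreover have "(T((i, i) \<mapsto> x))(\<beta> \<mapsto> e') = (T(\<beta> \<mapsto> e'))((i, i) \<mapsto> x)"
    using ne by (auto simp: fun_upd_twist)
  ultimately have "hm_run l x (T(\<beta> \<mapsto> e')) (T'(\<beta> \<mapsto> e')) b \<and> T' \<beta> = Some e"
    using hm_run.diag[of l x "T(\<beta> \<mapsto> e')" i y] diag(1-3) * ne by simp
  then show ?case .
next
  case (plain l x T i j k T' b)
  have *: "hm_box l x (T(\<beta> \<mapsto> e')) = hm_box l x T \<and> hm_box l x T \<noteq> \<beta>"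
    by (rule hm_box_bound) (use plain in auto)
  have ne: "(i, j) \<noteq> \<beta>" using * plain(1) by simp
  have le: "x \<le> Plain k" using plain(4) by simp
  have IH: "hm_run (Row (Suc i)) (Plain k) ((T((i, j) \<mapsto> x))(\<beta> \<mapsto> e')) (T'(\<beta> \<mapsto> e')) b \<and> T' \<beta> = Some e"
    using plain.prems ne le by (intro plain(6)) (auto intro: order_trans)
  moreover have "(T((i, j) \<mapsto> x))(\<beta> \<mapsto> e') = (T(\<beta> \<mapsto> e'))((i, j) \<mapsto> x)"
    using ne by (auto simp: fun_upd_twist)
  ultimately have "hm_run l x (T(\<beta> \<mapsto> e')) (T'(\<beta> \<mapsto> e')) b \<and> T' \<beta> = Some e"
    using hm_run.plain[of l x "T(\<beta> \<mapsto> e')" i j k] plain(1-4) * ne by simp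
  then show ?case .
next
  case (primed l x T i j k T' b)
  have *: "hm_box l x (T(\<beta> \<mapsto> e')) = hm_box l x T \<and> hm_box l x T \<noteq> \<beta>"
    by (rule hm_box_bound) (use primed in auto)
  have ne: "(i, j) \<noteq> \<beta>" using * primed(1) by simp
  have le: "x \<le> Primed k" using primed(4) by simp
  have IH: "hm_run (Col (Suc j)) (Primed k) ((T((i, j) \<mapsto> x))(\<beta> \<mapsto> e')) (T'(\<beta> \<mapsto> e')) b \<and> T' \<beta> = Some e"
    using primed.prems ne le by (intro primed(6)) (auto intro: order_trans)
  moreover have "(T((i, j) \<mapsto> x))(\<beta> \<mapsto> e') = (T(\<beta> \<mapsto> e'))((i, j) \<mapsto> x)"
    using ne by (auto simp: fun_upd_twist)
  ultimately have "hm_run l x (T(\<beta> \<mapsto> e')) (T'(\<beta> \<mapsto> e')) b \<and> T' \<beta> = Some e"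
    using hm_run.primed[of l x "T(\<beta> \<mapsto> e')" i j k] primed(1-4) * ne by simp
  then show ?case .
qed

lemma hm_box_less:
  assumes "finite (dom T)" "T (hm_box l x T) = Some y"
  shows "x < y"
proof (cases l)
  case (Row i)
  let ?N = "Max (insert i (snd ` dom T))"
  have "T (i, Suc ?N) = None"
  proof (rule ccontr)
    assume "T (i, Suc ?N) \<noteq> None"
    then have "Suc ?N \<in> insert i (snd ` dom T)" by force
    then have "Suc ?N \<le> ?N" using assms(1) by (intro Max_ge) auto
    then show False by simp
  qed
  moreover have "i \<le> Suc ?N" using assms(1) by (intro le_SucI Max_ge) auto
  ultimately have "\<exists>j. i \<le> j \<and> (\<forall>y. T (i, j) = Some y \<longrightarrow> x < y)" by (intro exI[of _ "Suc ?N"]) simp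
  from LeastI_ex[OF this] have "\<forall>y. T (hm_box l x T) = Some y \<longrightarrow> x < y"
    unfolding Row hm_box.simps by (rule conjunct2)
  then show ?thesis using assms(2) by blast
next
  case (Col j)
  let ?N = "Max (insert 0 (fst ` dom T))"
  have "T (Suc ?N, j) = None"
  proof (rule ccontr)
    assume "T (Suc ?N, j) \<noteq> None"
    then have "Suc ?N \<in> insert 0 (fst ` dom T)" by force
    then have "Suc ?N \<le> ?N" using assms(1) by (intro Max_ge) auto
    then show False by simp
  qed
  then have "\<exists>i. 1 \<le> i \<and> (\<forall>y. T (i, j) = Some y \<longrightarrow> x < y)" by (intro exI[of _ "Suc ?N"]) simp
  from LeastI_ex[OF this] have "\<forall>y. T (hm_box l x T) = Some y \<longrightarrow> x < y"
    unfolding Col hm_box.simps by (rule conjunct2)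
  then show ?thesis using assms(2) by blast
qed

text \<open>The inserted letter never decreases; it can stay the same only when a primed letter bumps a diagonal
  entry, and then the column moves to the right.\<close>

lemma hm_run_total:
  assumes "finite (dom T)" "\<forall>i. l = Row i \<longrightarrow> x = Plain (val x)"
  shows "\<exists>T' b. hm_run l x T T' b"
proof -
  define C where "C = Max (insert 0 (snd ` dom T))"
  define K where "K = Max (insert 0 (rank ` ran T))"
  \<comment> \<open>Lexicographic: the letter grows, or else the column index does. \<open>K\<close>
    and \<open>C\<close> bound them, and both bounds survive a bump, which leaves the domain as it
    is.\<close>
  let ?M = "measures [\<lambda>(l, x, T). Suc K - rank x, \<lambda>(l, x, T). case l of Row _ \<Rightarrow> 0 | Col j \<Rightarrow> Suc C - j]"
  have fin: "finite (ran T)" using assms(1) by (rule finite_ran)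
  have "\<forall>b\<in>dom T. snd b \<le> C"
    using assms(1) by (auto simp: C_def intro!: Max_ge image_eqI)
  moreover have "\<forall>y\<in>ran T. rank y \<le> K"
    using fin by (auto simp: K_def intro!: Max_ge)
  ultimately show ?thesis
    using assms
  proof (induction "(l, x, T)" arbitrary: l x T
      rule: wf_induct_rule[OF wf_measures[of "[\<lambda>(l, x, T). Suc K - rank x, \<lambda>(l, x, T). case l of Row _ \<Rightarrow> 0 | Col j \<Rightarrow> Suc C - j]"]])
    case (1 l x T)
    obtain i j where b: "hm_box l x T = (i, j)" by fastforce
    show ?case
    proof (cases "T (i, j)")
      case None
      then show ?thesis using hm_run.new[OF b] by blast
    next
      case (Some y)
      then have "x < y" using hm_box_less[OF 1(4), of l x y] b by simp
      have yK: "rank y \<le> K" using 1(3) Some by (auto simp: ran_def)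
      have dom: "dom (T((i, j) \<mapsto> x)) = dom T" using Some by auto
      have "ran (T((i, j) \<mapsto> x)) \<subseteq> insert x (ran T)" by (auto simp: ran_def)
      moreover have "rank x \<le> K" using \<open>x < y\<close> yK by (simp add: rank_less)
      ultimately have ran: "\<forall>y\<in>ran (T((i, j) \<mapsto> x)). rank y \<le> K" using 1(3) by blast
      have next_run: "\<exists>T' b. hm_run l' x' (T((i, j) \<mapsto> x)) T' b"
        if "((l', x', T((i, j) \<mapsto> x)), (l, x, T)) \<in> ?M"
          "\<forall>i. l' = Row i \<longrightarrow> x' = Plain (val x')" for l' x'
        using 1(1)[OF that(1)] 1(2,4) ran that(2) unfolding dom by blast
      have up: "((l', y, T((i, j) \<mapsto> x)), (l, x, T)) \<in> ?M" for l'
      proof -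
        have "Suc K - rank y < Suc K - rank x"
          using \<open>x < y\<close> yK unfolding rank_less by linarith
        then show ?thesis by simp
      qed
      show ?thesis
      proof (cases "i = j")
        case True
        have "rank x \<le> rank (Primed (val y))"
          using Primed_val_ge[OF \<open>x < y\<close>] by (metis le_less rank_less less_imp_le)
        \<comment> \<open>A letter entering a row is plain and has odd rank; primed letters have
          even rank.\<close>
        moreover have "rank x \<noteq> rank (Primed (val y))" if "l = Row k" for k
          using 1(5) that by (cases x) (auto, presburger)
        moreover have "rank (Primed (val y)) \<le> K" using yK by (cases y) auto
        moreover have "j \<le> C" using 1(2) Some by force
        moreover have "j = k" if "l = Col k" for k using b that by simp
        ultimately have "((Col (Suc i), Primed (val y), T((i, j) \<mapsto> x)), (l, x, T)) \<in> ?M"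
          using True by (cases l) (auto simp: le_less simp del: rank.simps)
        then obtain T' b' where "hm_run (Col (Suc i)) (Primed (val y)) (T((i, j) \<mapsto> x)) T' b'"
          using next_run by blast
        then show ?thesis
          using hm_run.diag[of l x T i y] b Some \<open>x < y\<close> True by blast
      next
        case False
        show ?thesis
        proof (cases y)
          case (Plain k)
          then obtain T' b' where "hm_run (Row (Suc i)) (Plain k) (T((i, j) \<mapsto> x)) T' b'"
            using next_run[OF up[of "Row (Suc i)"]] by auto
          then show ?thesis
            using hm_run.plain[of l x T i j k] b Some \<open>x < y\<close> False Plain by blast
        next
          case (Primed k)
          then obtain T' b' where "hm_run (Col (Suc j)) (Primed k) (T((i, j) \<mapsto> x)) T' b'"
            using next_run[OF up[of "Col (Suc j)"]] by auto
          then show ?thesis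
            using hm_run.primed[of l x T i j k] b Some \<open>x < y\<close> False Primed by blast
        qed
      qed
    qed
  qed
qed

lemma hm_insert_run:
  assumes "finite (dom T)" "\<forall>i. l = Row i \<longrightarrow> x = Plain (val x)"
  shows "hm_run l x T (fst (hm_insert l x T)) (snd (hm_insert l x T))"
  using hm_run_total[OF assms] hm_run_insert by fastforce

section \<open>The first row of the mixed insertion tableau\<close>

definition P_HM :: "nat list \<Rightarrow> ptab" where
  "P_HM b = fst (HM b)"

lemma P_HM_Nil [simp]: "P_HM [] = Map.empty"
  by (simp add: P_HM_def HM_def)

lemma P_HM_snoc: "P_HM (b @ [x]) = fst (hm_insert (Row 1) (Plain x) (P_HM b))"
  by (simp add: P_HM_def HM_snoc HM_step_def split: prod.splits)

lemma finite_P_HM: "finite (dom (P_HM b))"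
proof (induction b rule: rev_induct)
  case (snoc x b)
  then show ?case
    using hm_run_finite[OF hm_insert_run[of "P_HM b" "Row 1" "Plain x"]] by (simp add: P_HM_snoc)
qed simp

lemma P_HM_run: "hm_run (Row 1) (Plain x) (P_HM b) (P_HM (b @ [x])) (snd (hm_insert (Row 1) (Plain x) (P_HM b)))"
  using hm_insert_run[OF finite_P_HM, of "Row 1" "Plain x" b] by (simp add: P_HM_snoc)

lemma hm_run_keep: "hm_run l x T T' b \<Longrightarrow> T p = Some e \<Longrightarrow> e \<le> x \<Longrightarrow> T' p = Some e"
  using hm_run_parallel[of l x T T' b p e e] by blast

lemma Plain_le: "Plain i \<le> Plain j \<longleftrightarrow> i \<le> j" "Primed i \<le> Plain j \<longleftrightarrow> i \<le> j" "Plain i \<le> Primed j \<longleftrightarrow> i < j"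
  "Primed i \<le> Primed j \<longleftrightarrow> i \<le> j"
  by (auto simp: less_eq_letter_def less_letter_def)

lemma Plain_less: "Plain i < Plain j \<longleftrightarrow> i < j" "Primed i < Plain j \<longleftrightarrow> i \<le> j" "Plain i < Primed j \<longleftrightarrow> i < j"
  "Primed i < Primed j \<longleftrightarrow> i < j"
  by (auto simp: less_letter_def)

lemma P_HM_lower: "\<forall>x\<in>set b. v \<le> x \<Longrightarrow> P_HM b p = Some y \<Longrightarrow> Plain v \<le> y"
proof (induction b arbitrary: p y rule: rev_induct)
  case (snoc x b)
  have "P_HM b p = Some y \<or> Plain x \<le> y"
    using hm_run_entries[OF P_HM_run snoc.prems(2)] .
  moreover have "Plain v \<le> Plain x" using snoc.prems(1) by (simp add: Plain_le)
  ultimately show ?case using snoc.IH[of p y] snoc.prems(1) by (auto intro: order_trans)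
qed simp

lemma hm_insert_first:
  assumes "\<And>y. T (1, 1) = Some y \<Longrightarrow> x < y"
  shows "hm_box (Row 1) x T = (1, 1)"
  using assms by (intro hm_box_RowI) auto

text \<open>For \<open>k \<ge> 1\<close> this is the first row when a \<open>1\<close> occurs and no
  \<open>2\<close> precedes the leftmost one; \<open>head_ones_primed\<close> is the pattern when a
  \<open>2\<close> does.\<close>

definition head_ones :: "nat \<Rightarrow> ptab \<Rightarrow> bool" where
  "head_ones k T \<longleftrightarrow> (\<forall>j. 1 \<le> j \<and> j \<le> k \<longrightarrow> T (1, j) = Some (Plain 1)) \<and>
     (\<forall>j y. k < j \<and> T (1, j) = Some y \<longrightarrow> Primed 2 < y)"

definition head_ones_primed :: "nat \<Rightarrow> ptab \<Rightarrow> bool" where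
  "head_ones_primed k T \<longleftrightarrow> 1 < k \<and> (\<forall>j. 1 \<le> j \<and> j < k \<longrightarrow> T (1, j) = Some (Plain 1)) \<and>
     T (1, k) = Some (Primed 2) \<and> (\<forall>j y. k < j \<and> T (1, j) = Some y \<longrightarrow> Primed 2 < y)"

text \<open>The diagonal carries no primes, so the changed letter is \<open>2'\<close> only off the
  diagonal.\<close>

definition twin :: "nat \<Rightarrow> letter" where
  "twin k = (if k = 1 then Plain 2 else Primed 2)"

lemma P_HM_two_first:
  assumes "\<forall>x\<in>set u. 2 \<le> x" "2 \<in> set u"
  shows "P_HM u (1, 1) = Some (Plain 2)"
  using assms
proof (induction u rule: rev_induct)
  case (snoc x u)
  show ?case
  proof (cases "2 \<in> set u")
    case True
    then show ?thesis
      using hm_run_keep[OF P_HM_run, of u "(1, 1)" "Plain 2" x] snoc by (simp add: Plain_le)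
  next
    case False
    then have "x = 2" using snoc.prems by simp
    have "\<forall>y\<in>set u. 3 \<le> y"
    proof
      fix y assume "y \<in> set u"
      then have "2 \<le> y" "y \<noteq> 2" using snoc.prems(1) False by auto
      then show "3 \<le> y" by simp
    qed
    then have low: "Plain 3 \<le> y" if "P_HM u p = Some y" for p y using P_HM_lower that by blast
    have box: "hm_box (Row 1) (Plain 2) (P_HM u) = (1, 1)"
    proof (rule hm_insert_first)
      show "Plain 2 < y" if "P_HM u (1, 1) = Some y" for y
        using low[OF that] by (rule less_le_trans[rotated]) (simp add: Plain_less)
    qed
    from P_HM_run[of 2 u] show ?thesis
    proof (cases rule: hm_run.cases)
      case (diag i y)
      have "Plain 2 \<le> Primed (val y)" using Primed_val_ge diag(3) by blast
      then show ?thesis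
        using hm_run_keep[OF diag(4), of "(1, 1)" "Plain 2"] diag(1) box \<open>x = 2\<close> by simp
    qed (use box \<open>x = 2\<close> in auto)
  qed
qed simp

text \<open>Two insertions that land in the same box bump the same letter \<open>y\<close>, and both
  new entries are at most \<open>y\<close>; from there \<open>hm_run_parallel\<close> applies. With
  two equal insertions it describes a single one.\<close>

lemma hm_insert_after_ones:
  assumes "finite (dom T)" "1 \<le> k" "\<And>y. T (1, Suc k) = Some y \<Longrightarrow> Primed 2 < y"
    and "hm_box l e T = (1, Suc k)" "hm_box l' e' T = (1, Suc k)" "e \<le> Primed 2" "e' \<le> Primed 2"
  shows "\<exists>S b. hm_insert l e T = (S, b) \<and> hm_insert l' e' T = (S((1, Suc k) \<mapsto> e'), b) \<and> S (1, Suc k) = Some e \<and>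
    (\<forall>p z. S p = Some z \<and> p \<noteq> (1, Suc k) \<longrightarrow> T p = Some z \<or> Plain 2 \<le> z) \<and>
    (\<forall>p z. T p = Some z \<and> z \<le> Primed 2 \<and> p \<noteq> (1, Suc k) \<longrightarrow> S p = Some z)"
proof (cases "T (1, Suc k)")
  case None
  then show ?thesis
    using hm_insert_new[OF assms(4)] hm_insert_new[OF assms(5)] by auto
next
  case (Some y)
  define l2 where "l2 = (case y of Plain _ \<Rightarrow> Row 2 | Primed _ \<Rightarrow> Col (Suc (Suc k)))"
  define T1 where "T1 = T((1, Suc k) \<mapsto> e)"
  have y: "Primed 2 < y" using assms(3)[OF Some] .
  have off: "(1::nat) \<noteq> Suc k" using assms(2) by simp
  have 1: "hm_insert l e T = hm_insert l2 y T1"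
    using hm_insert_plain[OF assms(4) off] hm_insert_primed[OF assms(4) off] Some
    by (cases y) (simp_all add: l2_def T1_def numeral_2_eq_2)
  have 2: "hm_insert l' e' T = hm_insert l2 y (T1((1, Suc k) \<mapsto> e'))"
    using hm_insert_plain[OF assms(5) off] hm_insert_primed[OF assms(5) off] Some
    by (cases y) (simp_all add: l2_def T1_def numeral_2_eq_2)
  obtain S b where Sb: "hm_insert l2 y T1 = (S, b)" by (meson surj_pair)
  have "finite (dom T1)" using assms(1) by (simp add: T1_def)
  then have run: "hm_run l2 y T1 S b"
    using hm_insert_run[of T1 l2 y] Sb by (cases y) (simp_all add: l2_def)
  have "e \<le> y" "e' \<le> y" using y assms(6,7) by auto
  then have par: "hm_run l2 y (T1((1, Suc k) \<mapsto> e')) (S((1, Suc k) \<mapsto> e')) b" "S (1, Suc k) = Some e"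
    using hm_run_parallel[OF run, of "(1, Suc k)" e e'] by (simp_all add: T1_def)
  have "Plain 2 \<le> y" using y by (cases y) (auto simp: Plain_less Plain_le)
  then have "T p = Some z \<or> Plain 2 \<le> z" if "S p = Some z" "p \<noteq> (1, Suc k)" for p z
    using hm_run_entries[OF run that(1)] that(2) by (auto simp: T1_def intro: order_trans)
  moreover have "S p = Some z" if "T p = Some z" "z \<le> Primed 2" "p \<noteq> (1, Suc k)" for p z
    using hm_run_keep[OF run, of p z] that y by (simp add: T1_def)
  ultimately show ?thesis
    using 1 2 Sb hm_run_insert[OF par(1)] par(2) by auto
qed

lemma head_ones_primed_Suc:
  assumes "finite (dom T)" "1 \<le> k" "head_ones k T"
  shows "head_ones_primed (Suc k) (fst (hm_insert (Col (Suc k)) (Primed 2) T))"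
proof -
  have next_big: "Primed 2 < y" if "T (1, Suc k) = Some y" for y
    using that assms(3) by (auto simp: head_ones_def)
  have box: "hm_box (Col (Suc k)) (Primed 2) T = (1, Suc k)"
    using next_big by (intro hm_box_ColI) auto
  obtain S b where S: "hm_insert (Col (Suc k)) (Primed 2) T = (S, b)" "S (1, Suc k) = Some (Primed 2)"
    "\<forall>p z. S p = Some z \<and> p \<noteq> (1, Suc k) \<longrightarrow> T p = Some z \<or> Plain 2 \<le> z"
    "\<forall>p z. T p = Some z \<and> z \<le> Primed 2 \<and> p \<noteq> (1, Suc k) \<longrightarrow> S p = Some z"
    using hm_insert_after_ones[OF assms(1,2) next_big box box] by auto
  have "S (1, j) = Some (Plain 1)" if "1 \<le> j" "j < Suc k" for j
    using S(4) that assms(3) by (auto simp: Plain_le head_ones_def)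
  moreover have "Primed 2 < y" if "Suc k < j" "S (1, j) = Some y" for j y
  proof -
    have "T (1, j) = Some y \<or> Plain 2 \<le> y" using S(3) that by auto
    then show ?thesis
      using that(1) assms(3) by (auto simp: head_ones_def Plain_less dest: Suc_lessD intro: less_le_trans[of _ "Plain 2"])
  qed
  ultimately show ?thesis
    using S(1,2) assms(2) unfolding head_ones_primed_def by auto
qed

text \<open>The \<open>1\<close> evicts \<open>2\<close> from the diagonal; primed, it enters the
  second column and settles in the first row.\<close>

lemma hm_insert_one_diag_two:
  assumes T: "finite (dom T)" "T (1, 1) = Some (Plain 2)" "\<And>p y. T p = Some y \<Longrightarrow> Plain 2 \<le> y"
  shows "head_ones_primed 2 (fst (hm_insert (Row 1) (Plain 1) T))"
proof -
  define T1 where "T1 = T((1, 1) \<mapsto> Plain 1)"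
  have box: "hm_box (Row 1) (Plain 1) T = (1, 1)"
    using T by (intro hm_insert_first) (auto simp: Plain_less)
  have "Primed 2 < y" if "T p = Some y" for p y
    using T(3)[OF that] by (auto simp: Plain_less intro: less_le_trans[of _ "Plain 2"])
  then have "head_ones 1 T1" by (auto simp: T1_def head_ones_def)
  moreover have "finite (dom T1)" using T(1) by (simp add: T1_def)
  ultimately have "head_ones_primed (Suc 1) (fst (hm_insert (Col (Suc 1)) (Primed 2) T1))"
    by (intro head_ones_primed_Suc) auto
  then show ?thesis
    using hm_insert_diag[OF box T(2)] by (simp add: T1_def numeral_2_eq_2)
qed

lemma head_ones_large:
  assumes "hm_run l x T T' b" "Plain 2 \<le> x" "head_ones k T" shows "head_ones k T'"
  unfolding head_ones_def
proof (intro conjI allI impI; elim conjE)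
  fix j assume "1 \<le> j" "j \<le> k"
  then have "T (1, j) = Some (Plain 1)" using assms(3) by (simp add: head_ones_def)
  moreover have "Plain 1 \<le> x" using assms(2) by (rule order_trans[rotated]) (simp add: Plain_le)
  ultimately show "T' (1, j) = Some (Plain 1)" using hm_run_keep[OF assms(1)] by blast
next
  fix j y assume *: "k < j" "T' (1, j) = Some y"
  have "Primed 2 < x" using assms(2) by (rule less_le_trans[rotated]) (simp add: Plain_less)
  then show "Primed 2 < y"
    using hm_run_entries[OF assms(1) *(2)] assms(3) *(1) unfolding head_ones_def by (auto intro: less_le_trans)
qed

lemma head_ones_primed_large:
  assumes "hm_run l x T T' b" "Plain 2 \<le> x" "head_ones_primed k T" shows "head_ones_primed k T'"
  unfolding head_ones_primed_def
proof (intro conjI allI impI; (elim conjE)?)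
  fix j assume "1 \<le> j" "j < k"
  then have "T (1, j) = Some (Plain 1)" using assms(3) by (simp add: head_ones_primed_def)
  moreover have "Plain 1 \<le> x" using assms(2) by (rule order_trans[rotated]) (simp add: Plain_le)
  ultimately show "T' (1, j) = Some (Plain 1)" using hm_run_keep[OF assms(1)] by blast
next
  have *: "Primed 2 < x" using assms(2) by (rule less_le_trans[rotated]) (simp add: Plain_less)
  then show "T' (1, k) = Some (Primed 2)"
    using hm_run_keep[OF assms(1)] assms(3) by (auto simp: head_ones_primed_def)
  fix j y assume **: "k < j" "T' (1, j) = Some y"
  show "Primed 2 < y"
    using hm_run_entries[OF assms(1) **(2)] assms(3) **(1) * unfolding head_ones_primed_def by (auto intro: less_le_trans)
qed (use assms(3) in \<open>simp add: head_ones_primed_def\<close>)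

text \<open>Each further \<open>1\<close> takes the place of \<open>2'\<close>, which moves one
  column to the right and stays in the first row.\<close>

lemma head_ones_primed_one:
  assumes "finite (dom T)" "head_ones_primed k T"
  shows "head_ones_primed (Suc k) (fst (hm_insert (Row 1) (Plain 1) T))"
proof -
  have k: "1 < k" using assms(2) by (simp add: head_ones_primed_def)
  define T1 where "T1 = T((1, k) \<mapsto> Plain 1)"
  have box: "hm_box (Row 1) (Plain 1) T = (1, k)"
  proof (rule hm_box_RowI)
    show "Plain 1 < y" if "T (1, k) = Some y" for y
      using that assms(2) by (auto simp: head_ones_primed_def Plain_less)
    show "\<exists>y. T (1, j') = Some y \<and> y \<le> Plain 1" if "1 \<le> j'" "j' < k" for j'
      using that assms(2) by (auto simp: head_ones_primed_def)
  qed (use k in simp)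
  have eq: "hm_insert (Row 1) (Plain 1) T = hm_insert (Col (Suc k)) (Primed 2) T1"
    using hm_insert_primed[OF box] k assms(2) by (simp add: T1_def head_ones_primed_def)
  have "head_ones k T1"
    using assms(2) by (auto simp: T1_def head_ones_def head_ones_primed_def)
  moreover have "finite (dom T1)" using assms(1) by (simp add: T1_def)
  ultimately show ?thesis
    unfolding eq using k by (intro head_ones_primed_Suc) auto
qed

lemma P_HM_ones_primed:
  assumes "\<forall>x\<in>set u. 2 \<le> x" "2 \<in> set u" "\<forall>x\<in>set v. 1 \<le> x"
  shows "\<exists>k. head_ones_primed k (P_HM (u @ 1 # v))"
  using assms(3)
proof (induction v rule: rev_induct)
  case Nil
  have "head_ones_primed 2 (P_HM (u @ [1]))"
    unfolding P_HM_snoc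
    using P_HM_two_first[OF assms(1,2)] P_HM_lower[OF assms(1)] finite_P_HM by (intro hm_insert_one_diag_two)
  then show ?case by blast
next
  case (snoc x v)
  then obtain k where k: "head_ones_primed k (P_HM (u @ 1 # v))" by auto
  have eq: "u @ 1 # v @ [x] = (u @ 1 # v) @ [x]" by simp
  show ?case
  proof (cases "x = 1")
    case True
    then show ?thesis
      unfolding eq using head_ones_primed_one[OF finite_P_HM k] by (metis P_HM_snoc)
  next
    case False
    then have "Plain 2 \<le> Plain x" using snoc.prems by (auto simp: Plain_le)
    then show ?thesis
      unfolding eq using head_ones_primed_large[OF P_HM_run _ k] by blast
  qed
qed

lemma twin_le: "twin k \<le> Plain 2" "Plain 1 < twin k"
  by (auto simp: twin_def Plain_le Plain_less)

text \<open>Throughout, the two tableaux differ only in the box \<open>(1, k)\<close>. A later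
  letter at least \<open>2\<close> does not see the difference. A later \<open>1\<close> lands in
  \<open>(1, k + 1)\<close> of the one; in the other it evicts the twin, which goes as
  \<open>2'\<close> to that very box.\<close>

lemma P_HM_change_first_one:
  assumes "\<forall>x\<in>set u. 3 \<le> x" "\<forall>x\<in>set v. 1 \<le> x"
  shows "\<exists>k\<ge>1. head_ones k (P_HM (u @ 1 # v)) \<and> P_HM (u @ 2 # v) = (P_HM (u @ 1 # v))((1, k) \<mapsto> twin k)"
  using assms(2)
proof (induction v rule: rev_induct)
  case Nil
  let ?T = "P_HM u"
  have low: "Plain 3 \<le> y" if "?T p = Some y" for p y using P_HM_lower assms(1) that by blast
  have low': "Plain 2 < y" if "?T p = Some y" for p y
    using low[OF that] by (rule less_le_trans[rotated]) (simp add: Plain_less)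
  have box1: "hm_box (Row 1) (Plain 1) ?T = (1, 1)"
    by (intro hm_insert_first) (auto simp: Plain_less dest!: low' intro: less_trans[of _ "Plain 2"])
  have box2: "hm_box (Row 1) (Plain 2) ?T = (1, 1)"
    by (intro hm_insert_first) (auto dest!: low')
  show ?case
  proof (cases "?T (1, 1)")
    case None
    have "P_HM (u @ [1]) = ?T((1, 1) \<mapsto> Plain 1)" "P_HM (u @ [2]) = ?T((1, 1) \<mapsto> Plain 2)"
      unfolding P_HM_snoc using hm_insert_new[OF box1] hm_insert_new[OF box2] None by simp_all
    moreover have "head_ones 1 (?T((1, 1) \<mapsto> Plain 1))"
      unfolding head_ones_def by (auto dest!: low' intro: less_trans[of _ "Plain 2"] simp: Plain_less)
    moreover have "?T((1, 1) \<mapsto> Plain 2) = (?T((1, 1) \<mapsto> Plain 1))((1, 1) \<mapsto> twin 1)"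
      by (simp add: twin_def)
    ultimately have "head_ones 1 (P_HM (u @ [1])) \<and> P_HM (u @ [2]) = (P_HM (u @ [1]))((1, 1) \<mapsto> twin 1)"
      by metis
    then show ?thesis by blast
  next
    case (Some y)
    define T1 where "T1 = ?T((1, 1) \<mapsto> Plain 1)"
    define z where "z = Primed (val y)"
    \<comment> \<open>All entries have value at least \<open>3\<close>, so the bumped letter stays
      above \<open>1\<close> and \<open>2\<close> even when primed.\<close>
    have z: "Plain 2 \<le> z" using Primed_val_ge[OF low'[OF Some]] by (simp add: z_def)
    have z1: "Plain 1 \<le> z" using z by (rule order_trans[rotated]) (simp add: Plain_le)
    have fin: "finite (dom T1)" by (simp add: T1_def finite_P_HM)
    obtain S b where Sb: "hm_insert (Col 2) z T1 = (S, b)" by (meson surj_pair)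
    have run: "hm_run (Col 2) z T1 S b"
      using hm_insert_run[OF fin, of "Col 2" z] Sb by simp
    have par: "hm_run (Col 2) z (T1((1, 1) \<mapsto> Plain 2)) (S((1, 1) \<mapsto> Plain 2)) b" "S (1, 1) = Some (Plain 1)"
      using hm_run_parallel[OF run, of "(1, 1)" "Plain 1" "Plain 2"] z z1 by (simp_all add: T1_def)
    have "P_HM (u @ [1]) = S"
      unfolding P_HM_snoc using hm_insert_diag[OF box1 Some] Sb by (simp add: T1_def z_def numeral_2_eq_2)
    moreover have "P_HM (u @ [2]) = S((1, 1) \<mapsto> Plain 2)"
      unfolding P_HM_snoc using hm_insert_diag[OF box2 Some] hm_run_insert[OF par(1)]
      by (simp add: T1_def z_def numeral_2_eq_2)
    moreover have "head_ones 1 S"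
      unfolding head_ones_def
    proof (intro conjI allI impI; elim conjE)
      fix j :: nat assume "1 \<le> j" "j \<le> 1"
      then have "j = 1" by simp
      then show "S (1, j) = Some (Plain 1)" using par(2) by simp
    next
      fix j y assume "1 < j" "S (1, j) = Some y"
      then have "?T (1, j) = Some y \<or> z \<le> y"
        using hm_run_entries[OF run, of "(1, j)" y] by (auto simp: T1_def)
      moreover have "Primed 2 < z" using z by (rule less_le_trans[rotated]) (simp add: Plain_less)
      ultimately show "Primed 2 < y"
        using low' by (auto simp: Plain_less intro: less_trans[of _ "Plain 2"] less_le_trans)
    qed
    ultimately show ?thesis by (intro exI[of _ 1]) (simp add: twin_def)
  qed
next
  case (snoc x v)
  define T where "T = P_HM (u @ 1 # v)"
  define T' where "T' = P_HM (u @ 2 # v)"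
  have "\<exists>k\<ge>1. head_ones k T \<and> T' = T((1, k) \<mapsto> twin k)"
    unfolding T_def T'_def using snoc.prems by (intro snoc.IH) simp
  then obtain k where k: "1 \<le> k" "head_ones k T" "T' = T((1, k) \<mapsto> twin k)"
    by blast
  have fin: "finite (dom T)" "finite (dom T')" by (simp_all add: T_def T'_def finite_P_HM)
  have eq: "P_HM (u @ 1 # v @ [x]) = fst (hm_insert (Row 1) (Plain x) T)"
    "P_HM (u @ 2 # v @ [x]) = fst (hm_insert (Row 1) (Plain x) T')"
    using P_HM_snoc[of "u @ 1 # v" x] P_HM_snoc[of "u @ 2 # v" x] by (simp_all add: T_def T'_def)
  have Tk: "T (1, k) = Some (Plain 1)" using k by (simp add: head_ones_def)
  show ?case
  proof (cases "x = 1")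
    case False
    then have x: "Plain 2 \<le> Plain x" using snoc.prems by (auto simp: Plain_le)
    obtain S b where Sb: "hm_insert (Row 1) (Plain x) T = (S, b)" by (meson surj_pair)
    have run: "hm_run (Row 1) (Plain x) T S b"
      using hm_insert_run[OF fin(1), of "Row 1" "Plain x"] Sb by simp
    have "Plain 1 \<le> Plain x" "twin k \<le> Plain x"
      using x twin_le(1)[of k] by (auto simp: Plain_le intro: order_trans)
    then have "hm_run (Row 1) (Plain x) T' (S((1, k) \<mapsto> twin k)) b"
      using hm_run_parallel[OF run Tk] k(3) by blast
    then have "hm_insert (Row 1) (Plain x) T' = (S((1, k) \<mapsto> twin k), b)" by (rule hm_run_insert)
    then show ?thesis
      unfolding eq using Sb k(1) head_ones_large[OF run x k(2)] by auto
  next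
    case True
    have next_big: "Primed 2 < y" if "T (1, Suc k) = Some y" for y
      using that k(2) by (auto simp: head_ones_def)
    have box: "hm_box (Row 1) (Plain 1) T = (1, Suc k)"
    proof (rule hm_box_RowI)
      show "Plain 1 < y" if "T (1, Suc k) = Some y" for y
        using next_big[OF that] by (rule less_trans[rotated]) (simp add: Plain_less)
      show "\<exists>y. T (1, j) = Some y \<and> y \<le> Plain 1" if "1 \<le> j" "j < Suc k" for j
        using that k(2) by (auto simp: head_ones_def)
    qed simp
    have box': "hm_box (Row 1) (Plain 1) T' = (1, k)"
    proof (rule hm_box_RowI)
      show "Plain 1 < y" if "T' (1, k) = Some y" for y
        using that k(3) twin_le(2)[of k] by simp
      show "\<exists>y. T' (1, j) = Some y \<and> y \<le> Plain 1" if "1 \<le> j" "j < k" for j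
        using that k by (auto simp: head_ones_def)
    qed (rule k(1))
    have box2: "hm_box (Col (Suc k)) (Primed 2) T = (1, Suc k)"
      using next_big by (intro hm_box_ColI) auto
    \<comment> \<open>Evicting the twin makes the tableaux equal again; what remains is to compare
      \<open>2'\<close> entering column \<open>k + 1\<close> with \<open>1\<close> entering the
      first row.\<close>
    have restore: "T'((1, k) \<mapsto> Plain 1) = T" using k(3) Tk by (auto simp: fun_eq_iff)
    have "hm_insert (Row 1) (Plain 1) T' = hm_insert (Col (Suc k)) (Primed 2) T"
    proof (cases "k = 1")
      case True
      then show ?thesis
        using hm_insert_diag[of "Row 1" "Plain 1" T' 1 "Plain 2"] box' k(3) restore by (simp add: twin_def)
    next
      case False
      then show ?thesis
        using hm_insert_primed[of "Row 1" "Plain 1" T' 1 k 2] box' k(3) restore by (simp add: twin_def)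
    qed
    moreover obtain S b where S: "hm_insert (Row 1) (Plain 1) T = (S, b)"
      "hm_insert (Col (Suc k)) (Primed 2) T = (S((1, Suc k) \<mapsto> Primed 2), b)"
      "S (1, Suc k) = Some (Plain 1)"
      "\<forall>p z. S p = Some z \<and> p \<noteq> (1, Suc k) \<longrightarrow> T p = Some z \<or> Plain 2 \<le> z"
      "\<forall>p z. T p = Some z \<and> z \<le> Primed 2 \<and> p \<noteq> (1, Suc k) \<longrightarrow> S p = Some z"
      using hm_insert_after_ones[OF fin(1) k(1) next_big box box2] by (auto simp: Plain_le)
    moreover have "head_ones (Suc k) S"
      unfolding head_ones_def
    proof (intro conjI allI impI; elim conjE)
      fix j assume j: "1 \<le> j" "j \<le> Suc k"
      show "S (1, j) = Some (Plain 1)"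
      proof (cases "j = Suc k")
        case False
        then have "T (1, j) = Some (Plain 1)" using k(2) j by (simp add: head_ones_def)
        then show ?thesis using S(5) False by (auto simp: Plain_le)
      qed (use S(3) in simp)
    next
      fix j y assume j: "Suc k < j" "S (1, j) = Some y"
      then have "T (1, j) = Some y \<or> Plain 2 \<le> y" using S(4) by auto
      then show "Primed 2 < y"
        using k(2) j(1) by (auto simp: head_ones_def Plain_less dest: Suc_lessD intro: less_le_trans[of _ "Plain 2"])
    qed
    moreover have "twin (Suc k) = Primed 2" using k(1) by (simp add: twin_def)
    ultimately show ?thesis
      unfolding eq using True by (intro exI[of _ "Suc k"]) simp
  qed
qed


section \<open>The odd operator on factorizations\<close>

lemma row_boxes_iff:
  "(r, c) \<in> row_boxes i P \<longleftrightarrow> i \<le> r \<and> r < i + length P \<and> r \<le> c \<and> c < r + length (P ! (r - i))"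
proof (induction i P rule: row_boxes.induct)
  case (2 i R P)
  show ?case
  proof (cases "r = i")
    case True
    then show ?thesis using row_boxes_ge[of "(i, c)" "Suc i" P] by auto
  next
    case False
    then have "r - i = Suc (r - Suc i)" if "i \<le> r" using that by simp
    then show ?thesis using 2 False by auto
  qed
qed simp

lemma shifted_diagram_lengths:
  assumes "decomp_tab n P"
  shows "strict_partition (map length P)" "shifted_diagram (map length P) = row_boxes 1 P"
proof -
  have ne: "R \<noteq> []" if "R \<in> set P" for R using that assms by (auto simp: decomp_tab_def)
  then show "strict_partition (map length P)"
    using decomp_tab_dcr[OF assms] by (auto simp: strict_partition_def)
  show "shifted_diagram (map length P) = row_boxes 1 P"
  proof (rule set_eqI)
    fix b :: box
    obtain r c where b: "b = (r, c)" by (cases b)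
    have "(r, c) \<in> shifted_diagram (map length P) \<longleftrightarrow> (r, c) \<in> row_boxes 1 P"
    proof (cases "1 \<le> r \<and> r \<le> length P")
      case True
      then have "map length P ! (r - 1) = length (P ! (r - 1))"
        by (intro nth_map) linarith
      then show ?thesis using True unfolding row_boxes_iff shifted_diagram_def by auto
    next
      case False
      then show ?thesis unfolding row_boxes_iff shifted_diagram_def by auto
    qed
    then show "b \<in> shifted_diagram (map length P) \<longleftrightarrow> b \<in> row_boxes 1 P" using b by simp
  qed
qed

lemma shifted_diagram_inj:
  assumes "strict_partition lam" "strict_partition mu" "shifted_diagram lam = shifted_diagram mu"
  shows "lam = mu"
proof -
  have pos: "1 \<le> nu ! i" if "strict_partition nu" "i < length nu" for nu i
    using that nth_mem[of i nu] unfolding strict_partition_def by (metis One_nat_def Suc_leI neq0_conv)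
  have diag: "(Suc i, Suc i) \<in> shifted_diagram nu \<longleftrightarrow> i < length nu" if "strict_partition nu" for nu i
    using pos[OF that, of i] by (auto simp: shifted_diagram_def)
  have "i < length lam \<longleftrightarrow> i < length mu" for i
    using diag assms by metis
  then have len: "length lam = length mu"
    by (metis linorder_neqE_nat less_irrefl)
  have le: "al ! i \<le> be ! i"
    if "strict_partition al" "shifted_diagram al = shifted_diagram be" "i < length al" for al be i
  proof -
    have "(Suc i, al ! i + i) \<in> shifted_diagram al"
      using that(3) pos[OF that(1,3)] by (simp add: shifted_diagram_def)
    then have "(Suc i, al ! i + i) \<in> shifted_diagram be" using that(2) by simp
    then show ?thesis by (simp add: shifted_diagram_def)
  qed
  show ?thesis
    using len le[OF assms(1,3)] le[OF assms(2) assms(3)[symmetric]] by (intro nth_equalityI) (auto intro: antisym)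
qed

lemma shape_of_eq:
  assumes "decomp_tab n P" "dom T = row_boxes 1 P"
  shows "shape_of T = map length P"
  unfolding shape_of_def
  using shifted_diagram_lengths[OF assms(1)] shifted_diagram_inj assms(2) by (intro the_equality) auto

definition primed_tableau :: "nat \<Rightarrow> nat list list \<Rightarrow> ptab \<Rightarrow> bool" where
  "primed_tableau m P T \<longleftrightarrow> semistandard T \<and> plain_diag T \<and> dom T = row_boxes 1 P \<and>
     (\<forall>b x. T b = Some x \<longrightarrow> 1 \<le> val x \<and> val x \<le> m)"

text \<open>Surjectivity turns the \<open>inv_into\<close> of the definition into an actual
  preimage; the chosen standard tableau fits because \<open>shape_of\<close> returns the row lengths
  of \<open>P\<close>.\<close>

lemma odd_f_P_word:
  assumes T: "primed_tableau m P T" "decomp_tab n P"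
    and Q: "\<And>lam. strict_partition lam \<Longrightarrow> standard_shifted_tableau lam (Q lam)"
  obtains b where "b \<in> lists {1..m}" "P_HM b = T" "odd_f_P Q m T = map_option P_HM (odd_f_word b)"
proof -
  let ?lam = "map length P"
  have shape: "shape_of T = ?lam"
    using T by (intro shape_of_eq) (simp_all add: primed_tableau_def)
  have std: "standard_shifted_tableau ?lam (Q ?lam)"
    using Q shifted_diagram_lengths(1)[OF T(2)] .
  have dom: "shifted_diagram ?lam = dom T"
    using shifted_diagram_lengths(2)[OF T(2)] T(1) by (simp add: primed_tableau_def)
  have bij: "bij_betw (\<lambda>b. the (Q ?lam b)) (dom T) {1..sum_list ?lam}"
    using std dom by (simp add: standard_shifted_tableau_def)
  then have "card (dom T) = sum_list ?lam"
    using bij_betw_same_card by fastforce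
  then have "\<exists>b\<in>lists {1..m}. HM b = (T, Q ?lam) \<and> length b = card (dom T)"
    using T(1) std dom bij
    by (intro HM_surj) (auto simp: primed_tableau_def standard_shifted_tableau_def)
  then have mem: "(T, Q ?lam) \<in> HM ` lists {1..m}" by (metis image_eqI)
  define b where "b = inv_into (lists {1..m}) HM (T, Q ?lam)"
  have "b \<in> lists {1..m}" "HM b = (T, Q ?lam)"
    using inv_into_into[OF mem] f_inv_into_f[OF mem] by (simp_all add: b_def)
  moreover have "odd_f_P Q m T = map_option P_HM (odd_f_word b)"
    unfolding odd_f_P_def shape b_def P_HM_def ..
  ultimately show ?thesis
    using that by (simp add: P_HM_def)
qed

lemma odd_f_word_split: "1 \<notin> set u \<Longrightarrow> odd_f_word (u @ 1 # v) = (if 2 \<in> set u then None else Some (u @ 2 # v))"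
proof -
  assume "1 \<notin> set u"
  then have "takeWhile (\<lambda>x. x \<noteq> 1) (u @ 1 # v) = u"
    by (induction u) auto
  then show ?thesis by (simp add: odd_f_word_def)
qed

text \<open>The first row of \<open>T\<close> shows of which kind \<open>b\<close> is: no
  \<open>1\<close>, a \<open>2\<close> before the leftmost \<open>1\<close>, or neither. The three
  patterns exclude each other, and in the last one \<open>k\<close> is determined by
  \<open>T\<close>.\<close>

lemma odd_f_P_cases:
  assumes T: "primed_tableau m P T" "decomp_tab n P"
    and Q: "\<And>lam. strict_partition lam \<Longrightarrow> standard_shifted_tableau lam (Q lam)"
  shows "T (1, 1) \<noteq> Some (Plain 1) \<Longrightarrow> odd_f_P Q m T = None"
    and "T (1, j) = Some (Primed 2) \<Longrightarrow> odd_f_P Q m T = None"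
    and "1 \<le> k \<Longrightarrow> head_ones k T \<Longrightarrow> odd_f_P Q m T = Some (T((1, k) \<mapsto> twin k))"
proof -
  obtain b where b: "b \<in> lists {1..m}" "P_HM b = T" "odd_f_P Q m T = map_option P_HM (odd_f_word b)"
    using odd_f_P_word[OF T Q] by metis
  consider (no_one) "\<forall>x\<in>set b. 2 \<le> x" "odd_f_word b = None"
    | (two_first) k where "head_ones_primed k T" "odd_f_word b = None"
    | (change) k where "1 \<le> k" "head_ones k T" "odd_f_P Q m T = Some (T((1, k) \<mapsto> twin k))"
  proof (cases "1 \<in> set b")
    case False
    have "2 \<le> x" if "x \<in> set b" for x
    proof -
      have "1 \<le> x" "x \<noteq> 1" using b(1) that False by auto
      then show ?thesis by simp
    qed
    then show ?thesis using no_one False by (simp add: odd_f_word_def)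
  next
    case True
    then obtain u v where uv: "b = u @ 1 # v" "1 \<notin> set u" by (meson split_list_first)
    have u2: "\<forall>x\<in>set u. 2 \<le> x"
    proof
      fix x assume "x \<in> set u"
      then have "1 \<le> x" "x \<noteq> 1" using b(1) uv by auto
      then show "2 \<le> x" by simp
    qed
    have v1: "\<forall>x\<in>set v. 1 \<le> x" using b(1) uv by auto
    show ?thesis
    proof (cases "2 \<in> set u")
      case True
      then show ?thesis
        using P_HM_ones_primed[OF u2 True v1] two_first odd_f_word_split[OF uv(2), of v] uv(1) b(2) by auto
    next
      case False
      have "\<forall>x\<in>set u. 3 \<le> x"
      proof
        fix x assume "x \<in> set u"
        then have "2 \<le> x" "x \<noteq> 2" using u2 False by auto
        then show "3 \<le> x" by simp
      qed
      then obtain k where "1 \<le> k" "head_ones k (P_HM (u @ 1 # v))"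
        "P_HM (u @ 2 # v) = (P_HM (u @ 1 # v))((1, k) \<mapsto> twin k)"
        using P_HM_change_first_one[OF _ v1] by blast
      then show ?thesis
        using change odd_f_word_split[OF uv(2), of v] uv(1) b(2,3) False by simp
    qed
  qed
  note cases = this
  have one: "T (1, 1) = Some (Plain 1)" if "1 \<le> k" "head_ones k T" for k
    using that by (simp add: head_ones_def)
  show "odd_f_P Q m T = None" if "T (1, 1) \<noteq> Some (Plain 1)"
    using cases
  proof cases
    case (change k)
    then show ?thesis using one that by blast
  qed (simp_all add: b(3))
  show "odd_f_P Q m T = None" if primed: "T (1, j) = Some (Primed 2)"
    using cases
  proof cases
    case (change k)
    have "1 \<le> j"
      using shifted_shape_pos[of "dom T" 1 j] primed T(1) unfolding primed_tableau_def semistandard_def by blast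
    then have "k < j"
      using change(2) primed unfolding head_ones_def by (metis letter.distinct(1) not_le option.inject)
    then show ?thesis using change(2) primed unfolding head_ones_def by blast
  qed (simp_all add: b(3))
  show "odd_f_P Q m T = Some (T((1, k) \<mapsto> twin k))" if k: "1 \<le> k" "head_ones k T"
    using cases
  proof cases
    case no_one
    have "Plain 2 \<le> Plain 1"
      using P_HM_lower[OF no_one(1), of "(1, 1)" "Plain 1"] one[OF k] b(2) by simp
    then show ?thesis by (simp add: Plain_le)
  next
    case (two_first l)
    have l: "1 \<le> l" "T (1, l) = Some (Primed 2)" using two_first(1) by (simp_all add: head_ones_primed_def)
    then have "k < l"
      using k(2) unfolding head_ones_def by (metis letter.distinct(1) not_le option.inject)
    then show ?thesis using k(2) l(2) unfolding head_ones_def by blast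
  next
    case (change l)
    have no: "\<not> k1 < k2" if "head_ones k1 T" "head_ones k2 T" "1 \<le> k2" for k1 k2
    proof
      assume "k1 < k2"
      have "T (1, k2) = Some (Plain 1)" using that(2,3) by (simp add: head_ones_def)
      then have "Primed 2 < Plain 1" using that(1) \<open>k1 < k2\<close> unfolding head_ones_def by blast
      then show False by (simp add: Plain_less)
    qed
    have "k = l" using no[OF k(2) change(2,1)] no[OF change(2) k(2,1)] by simp
    then show ?thesis using change(3) by simp
  qed
qed

section \<open>Diagonal primes\<close>

lemma DPR_apply: "DPR T (r, c) = (if r = c then map_option (\<lambda>x. Plain (val x)) (T (r, c)) else T (r, c))"
  by (simp add: DPR_def)

lemma dom_DPR: "dom (DPR T) = dom T"
  by (auto simp: DPR_def dom_def split: if_splits prod.splits)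

text \<open>A diagonal box has no left neighbour and none below, so raising \<open>i'\<close> to
  \<open>i\<close> can conflict only with the right neighbour. That one exceeds \<open>i'\<close>,
  hence is at least \<open>i\<close>, and equal plain letters may share a row.\<close>

lemma primed_tableau_DPR:
  assumes "semistandard T" "dom T = row_boxes 1 P" "\<forall>b x. T b = Some x \<longrightarrow> 1 \<le> val x \<and> val x \<le> m"
  shows "primed_tableau m P (DPR T)"
  unfolding primed_tableau_def
proof (intro conjI)
  have pos: "r \<le> c" if "T (r, c) = Some x" for r c x
    using shifted_shape_pos[OF semistandard_shape[OF assms(1)], of r c] that by blast
  show "semistandard (DPR T)"
    unfolding semistandard_def dom_DPR
  proof (intro conjI allI impI; (elim conjE)?)
    show "shifted_shape (dom T)" by (rule semistandard_shape[OF assms(1)])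
    fix r c x y
    assume *: "DPR T (r, c) = Some x" "DPR T (r, Suc c) = Some y"
    obtain x0 where x0: "T (r, c) = Some x0" "x = x0 \<or> x = Plain (val x0)"
      using *(1) by (auto simp: DPR_apply split: if_splits)
    have "r \<noteq> Suc c" using pos[OF x0(1)] by simp
    then have "T (r, Suc c) = Some y" using *(2) by (simp add: DPR_apply)
    then have "x0 < y \<or> x0 = y \<and> x0 = Plain (val x0)"
      using semistandard_row[OF assms(1) x0(1)] by blast
    then show "x < y \<or> x = y \<and> x = Plain (val x)"
      using x0(2) by (cases x0; cases y) (auto simp: Plain_less)
  next
    fix r c x y
    assume *: "DPR T (r, c) = Some x" "DPR T (Suc r, c) = Some y"
    obtain y0 where y0: "T (Suc r, c) = Some y0" "y = y0 \<or> y = Plain (val y0)"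
      using *(2) by (auto simp: DPR_apply split: if_splits)
    have "r \<noteq> c" using pos[OF y0(1)] by simp
    then have "T (r, c) = Some x" using *(1) by (simp add: DPR_apply)
    then have "x < y0 \<or> x = y0 \<and> x = Primed (val x)"
      using semistandard_col[OF assms(1) _ y0(1)] by blast
    then show "x < y \<or> x = y \<and> x = Primed (val x)"
      using y0(2) by (cases x; cases y0) (auto simp: Plain_less)
  qed
  show "plain_diag (DPR T)"
    by (auto simp: plain_diag_def DPR_apply)
  show "dom (DPR T) = row_boxes 1 P" using assms(2) by (simp add: dom_DPR)
  show "\<forall>b x. DPR T b = Some x \<longrightarrow> 1 \<le> val x \<and> val x \<le> m"
    using assms(3) by (auto simp: DPR_def split: if_splits)
qed

text \<open>Away from the changed box, removing and restoring primes cancel; in the changed box a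
  prime returns only on a diagonal place that carried one.\<close>

lemma PR_DPR_update:
  "PR (primed_diag T) ((DPR T)((r, c) \<mapsto> e)) =
     T((r, c) \<mapsto> (if r = c \<and> r \<in> primed_diag T then Primed (val e) else e))"
proof (rule ext)
  fix b :: box
  obtain i j where b: "b = (i, j)" by (cases b)
  show "PR (primed_diag T) ((DPR T)((r, c) \<mapsto> e)) b = (T((r, c) \<mapsto> (if r = c \<and> r \<in> primed_diag T then Primed (val e) else e))) b"
  proof (cases "(i, j) = (r, c)")
    case True
    then show ?thesis using b by (auto simp: PR_def)
  next
    case False
    have "PR (primed_diag T) ((DPR T)((r, c) \<mapsto> e)) (i, j) = T (i, j)"
    proof (cases "i = j")
      case True
      show ?thesis
      proof (cases "T (i, i)")
        case None
        then show ?thesis using True False by (auto simp: PR_def DPR_apply)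
      next
        case (Some x)
        then have "i \<in> primed_diag T \<longleftrightarrow> x = Primed (val x)"
          by (cases x) (auto simp: primed_diag_def)
        then show ?thesis using True False Some by (cases x) (auto simp: PR_def DPR_apply)
      qed
    qed (use False in \<open>auto simp: PR_def DPR_apply\<close>)
    then show ?thesis using False b by auto
  qed
qed

section \<open>From the first two factors to all of them\<close>

lemma KR_Cons_Cons: "KR (F # G # As) = foldl KR_step (KR [F, G]) (enumerate 3 As)"
  by (simp add: KR_def numeral_3_eq_3 numeral_2_eq_2)

text \<open>Later factors see only \<open>P\<close>, write only outside its boxes and use labels
  from \<open>i\<close> on. So a changed old entry is carried along, and the first row can be
  studied after two factors.\<close>

lemma foldl_KR_step:
  assumes "decomp_tab n P" "red n (concat (rev P) @ concat (map snd As))"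
    and "foldl KR_step (P, T) (enumerate i As) = (P', T')"
  shows "\<beta> \<in> row_boxes 1 P \<Longrightarrow> foldl KR_step (P, T(\<beta> \<mapsto> e)) (enumerate i As) = (P', T'(\<beta> \<mapsto> e))"
    and "b \<in> row_boxes 1 P \<Longrightarrow> T' b = T b"
    and "T' b = Some x \<Longrightarrow> T b = Some x \<or> i \<le> val x"
proof -
  have "(\<beta> \<in> row_boxes 1 P \<longrightarrow> foldl KR_step (P, T(\<beta> \<mapsto> e)) (enumerate i As) = (P', T'(\<beta> \<mapsto> e))) \<and>
      (b \<in> row_boxes 1 P \<longrightarrow> T' b = T b) \<and> (T' b = Some x \<longrightarrow> T b = Some x \<or> i \<le> val x)"
    using assms
  proof (induction As arbitrary: P T i)
    case (Cons f As)
    obtain s a where f: "f = (s, a)" by fastforce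
    obtain P1 bxs where ins: "kr_insert_word a P = (P1, bxs)" by fastforce
    define T1 where "T1 = T(bxs [\<mapsto>] rec_labels i s bxs)"
    have red: "red n (concat (rev P) @ a)" "red n ((concat (rev P) @ a) @ concat (map snd As))"
      using Cons.prems(2) red_appendD1[of n "concat (rev P) @ a" "concat (map snd As)"] f by simp_all
    note tab = kr_insert_word_decomp_tab[OF ins Cons.prems(1) red(1)]
    note sh = kr_insert_word_shape[OF ins Cons.prems(1) red(1)]
    have red1: "red n (concat (rev P1) @ concat (map snd As))"
      using red_ck[OF red(2) ck_right] tab by blast
    have step: "foldl KR_step (P1, T1) (enumerate (Suc i) As) = (P', T')"
      using Cons.prems(3) ins f by (simp add: KR_step_def T1_def)
    note IH = Cons.IH[OF _ red1 step]
    have old: "T1 z = T z" if "z \<notin> set bxs" for z using that by (simp add: T1_def)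
    have 1: "foldl KR_step (P, T(\<beta> \<mapsto> e)) (enumerate i (f # As)) = (P', T'(\<beta> \<mapsto> e))" if "\<beta> \<in> row_boxes 1 P"
    proof -
      have "\<beta> \<notin> set bxs" "\<beta> \<in> row_boxes 1 P1" using that sh by auto
      moreover from this have "(T(\<beta> \<mapsto> e))(bxs [\<mapsto>] rec_labels i s bxs) = T1(\<beta> \<mapsto> e)"
        by (simp add: T1_def map_upds_twist)
      ultimately have "KR_step (P, T(\<beta> \<mapsto> e)) (i, f) = (P1, T1(\<beta> \<mapsto> e))"
        using ins f by (simp add: KR_step_def)
      moreover have "foldl KR_step (P1, T1(\<beta> \<mapsto> e)) (enumerate (Suc i) As) = (P', T'(\<beta> \<mapsto> e))"
        using IH tab \<open>\<beta> \<in> row_boxes 1 P1\<close> by blast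
      ultimately show ?thesis by (simp del: fun_upd_apply)
    qed
    have 2: "T' b = T b" if "b \<in> row_boxes 1 P"
    proof -
      have "b \<notin> set bxs" "b \<in> row_boxes 1 P1" using that sh by auto
      then show ?thesis using IH tab old by simp
    qed
    have 3: "T b = Some x \<or> i \<le> val x" if "T' b = Some x"
    proof -
      have "T1 b = Some x \<or> Suc i \<le> val x" using IH tab that by blast
      moreover have "i \<le> val x" if hyp: "b \<in> set bxs" "T1 b = Some x"
      proof -
        obtain j where j: "j < length bxs" "bxs ! j = b" using hyp(1) by (auto simp: in_set_conv_nth)
        then have "x = rec_labels i s bxs ! j"
          using map_upds_nth[of bxs "rec_labels i s bxs" j T] sh hyp(2) by (simp add: T1_def)
        then show ?thesis using j(1) by (auto simp: rec_labels_def)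
      qed
      ultimately show ?thesis using old by fastforce
    qed
    show ?case using 1 2 3 by blast
  qed simp
  then show "\<beta> \<in> row_boxes 1 P \<Longrightarrow> foldl KR_step (P, T(\<beta> \<mapsto> e)) (enumerate i As) = (P', T'(\<beta> \<mapsto> e))"
    and "b \<in> row_boxes 1 P \<Longrightarrow> T' b = T b"
    and "T' b = Some x \<Longrightarrow> T b = Some x \<or> i \<le> val x" by blast+
qed

lemma kr_insert_word_row:
  "u \<noteq> [] \<Longrightarrow> unimodal (u @ v) \<Longrightarrow>
     kr_insert_word v [u] = ([u @ v], map (Pair 1) [Suc (length u)..<Suc (length u + length v)])"
proof (induction v arbitrary: u)
  case (Cons x v)
  have "unimodal (u @ [x])" using Cons.prems unimodal_append_left[of "u @ [x]" v] by simp
  moreover have "kr_insert_word v [u @ [x]] = ([u @ x # v], map (Pair 1) [Suc (Suc (length u))..<Suc (Suc (length u + length v))])"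
    using Cons.IH[of "u @ [x]"] Cons.prems by simp
  ultimately show ?case by (simp add: upt_conv_Cons del: upt_Suc)
qed simp

lemma kr_insert_word_row_Nil:
  assumes "unimodal v" "v \<noteq> []"
  shows "kr_insert_word v [] = ([v], map (Pair 1) [1..<Suc (length v)])"
proof -
  obtain x w where v: "v = x # w" using assms(2) by (cases v) auto
  then show ?thesis
    using kr_insert_word_row[of "[x]" w] assms(1) by (simp add: upt_conv_Cons del: upt_Suc)
qed

text \<open>Within one row every step is a right step, so the turn is at the first box; that is
  where the sign of the factor shows.\<close>

lemma turns_at_row: "a < b \<Longrightarrow> turns_at 0 (map (Pair r) [a..<b])"
proof -
  assume "a < b"
  have "sorted_wrt right_step (map (Pair r) [a..<b])"
    by (simp add: sorted_wrt_map right_step_def)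
  then show ?thesis using \<open>a < b\<close> by (simp add: turns_at_def take_Suc sorted_wrt.simps)
qed

definition row_labels :: "nat \<Rightarrow> sign \<Rightarrow> nat \<Rightarrow> nat \<Rightarrow> ptab \<Rightarrow> ptab" where
  "row_labels i s a b T =
     (\<lambda>(r, c). if r = 1 \<and> a \<le> c \<and> c < b then Some (if c = a \<and> s = SMinus then Primed i else Plain i) else T (r, c))"

lemma row_labels_upds:
  "T(map (Pair 1) [a..<b] [\<mapsto>] rec_labels i s (map (Pair 1) [a..<b])) = row_labels i s a b T"
proof (rule ext)
  fix z :: box
  obtain r c where z: "z = (r, c)" by (cases z)
  let ?bxs = "map (Pair (1::nat)) [a..<b]"
  show "(T(?bxs [\<mapsto>] rec_labels i s ?bxs)) z = row_labels i s a b T z"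
  proof (cases "r = 1 \<and> a \<le> c \<and> c < b")
    case True
    then have "a < b" by simp
    have "distinct ?bxs" by (simp add: distinct_map inj_on_def)
    then have "(T(?bxs [\<mapsto>] rec_labels i s ?bxs)) (?bxs ! (c - a)) = Some (rec_labels i s ?bxs ! (c - a))"
      using True by (intro map_upds_nth) auto
    moreover have "c - a < b - a" using True by (simp add: diff_less_mono)
    then have "?bxs ! (c - a) = z" using True z by simp
    moreover have "rec_labels i s ?bxs ! (c - a) = (if c = a \<and> s = SMinus then Primed i else Plain i)"
      using rec_labels_nth[OF turns_at_row[OF \<open>a < b\<close>], of "c - a" 1 i s] True by auto
    ultimately show ?thesis using True z by (simp add: row_labels_def)
  next
    case False
    then have "z \<notin> set ?bxs" using z by auto
    then show ?thesis using False z by (auto simp: row_labels_def)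
  qed
qed

lemma KR_step_row_Nil:
  assumes "unimodal a"
  shows "KR_step ([], T) (i, s, a) = (if a = [] then [] else [a], row_labels i s 1 (Suc (length a)) T)"
proof (cases "a = []")
  case True
  have "row_labels i s 1 (Suc 0) T = T" by (auto simp: row_labels_def fun_eq_iff)
  then show ?thesis using True by (simp add: KR_step_def)
next
  case False
  then show ?thesis
    using kr_insert_word_row_Nil[OF assms False] row_labels_upds[of T 1 "Suc (length a)" i s]
    by (simp add: KR_step_def del: upt_Suc)
qed

lemma KR_step_row:
  assumes "u \<noteq> []" "unimodal (u @ a)"
  shows "KR_step ([u], T) (i, s, a) = ([u @ a], row_labels i s (Suc (length u)) (Suc (length u + length a)) T)"
  using kr_insert_word_row[OF assms] row_labels_upds[of T "Suc (length u)" "Suc (length u + length a)" i s]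
  by (simp add: KR_step_def del: upt_Suc)

lemma KR_pair: "KR [(s, a), (t, b)] = KR_step (KR_step ([], Map.empty) (1, s, a)) (2, t, b)"
  by (simp add: KR_def numeral_2_eq_2)

lemma signed_unimodal_facts_iff:
  "A \<in> signed_unimodal_facts n m w \<longleftrightarrow>
     length A = m \<and> signed_factors A \<and> red n (concat (map snd A)) \<and> word_prod (concat (map snd A)) = w"
  by (auto simp: signed_unimodal_facts_def signed_factors_def red_def reduced_word_def)

context
  fixes Q :: "nat list \<Rightarrow> box \<rightharpoonup> nat" and n m :: nat and w :: "int \<Rightarrow> int"
    and F1 F2 :: "sign \<times> nat list" and As :: factorization and P2 :: "nat list list" and T2 :: ptab
  assumes Q: "\<And>lam. strict_partition lam \<Longrightarrow> standard_shifted_tableau lam (Q lam)"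
    and facts: "F1 # F2 # As \<in> signed_unimodal_facts n m w"
    and KR2: "KR [F1, F2] = (P2, T2)"
begin

lemma first_two_factors:
  "signed_factors [F1, F2]" "red n (concat (map snd [F1, F2]))"
  "decomp_tab n P2" "dom T2 = row_boxes 1 P2" "red n (concat (rev P2) @ concat (map snd As))"
proof -
  have all: "signed_factors (F1 # F2 # As)" "red n (concat (map snd [F1, F2]) @ concat (map snd As))"
    using facts by (simp_all add: signed_unimodal_facts_iff)
  show s: "signed_factors [F1, F2]" using all(1) by (simp add: signed_factors_def)
  show r: "red n (concat (map snd [F1, F2]))" using red_appendD1[OF all(2)] .
  note inv = KR_invariant[OF s r KR2]
  then show "decomp_tab n P2" "dom T2 = row_boxes 1 P2" by blast+
  show "red n (concat (rev P2) @ concat (map snd As))"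
    using red_ck[OF all(2) ck_right] inv by blast
qed

lemma odd_f_F_eq:
  obtains P T where "KR (F1 # F2 # As) = (P, T)" "foldl KR_step (P2, T2) (enumerate 3 As) = (P, T)"
    "primed_tableau m P (DPR T)" "decomp_tab n P"
    "odd_f_F Q n m w (F1 # F2 # As) = map_option (\<lambda>T'. inv_into (signed_unimodal_facts n m w) KR (P, T'))
       (map_option (PR (primed_diag T)) (odd_f_P Q m (DPR T)))"
proof -
  obtain P T where PT: "KR (F1 # F2 # As) = (P, T)" by fastforce
  have inv: "decomp_tab n P \<and> dom T = row_boxes 1 P \<and> semistandard T \<and> (\<forall>b x. T b = Some x \<longrightarrow> 1 \<le> val x \<and> val x \<le> m)"
    using KR_invariant[of "F1 # F2 # As" n P T] PT facts unfolding signed_unimodal_facts_iff by blast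
  show ?thesis
  proof (rule that[OF PT])
    show "foldl KR_step (P2, T2) (enumerate 3 As) = (P, T)"
      using KR_Cons_Cons[of F1 F2 As] PT KR2 by simp
    show "primed_tableau m P (DPR T)" using primed_tableau_DPR[of T P m] inv by blast
    show "odd_f_F Q n m w (F1 # F2 # As) = map_option (\<lambda>T'. inv_into (signed_unimodal_facts n m w) KR (P, T'))
       (map_option (PR (primed_diag T)) (odd_f_P Q m (DPR T)))"
      by (simp add: odd_f_F_def PT odd_f_sP_def)
  qed (use inv in blast)
qed

lemma odd_f_F_None_no_one:
  assumes "\<And>x. T2 (1, 1) = Some x \<Longrightarrow> val x \<noteq> 1"
  shows "odd_f_F Q n m w (F1 # F2 # As) = None"
proof -
  obtain P T where *: "foldl KR_step (P2, T2) (enumerate 3 As) = (P, T)" "primed_tableau m P (DPR T)" "decomp_tab n P"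
    "odd_f_F Q n m w (F1 # F2 # As) = map_option (\<lambda>T'. inv_into (signed_unimodal_facts n m w) KR (P, T'))
       (map_option (PR (primed_diag T)) (odd_f_P Q m (DPR T)))"
    using odd_f_F_eq by metis
  have "DPR T (1, 1) \<noteq> Some (Plain 1)"
  proof
    assume "DPR T (1, 1) = Some (Plain 1)"
    then obtain x where x: "T (1, 1) = Some x" "val x = 1" by (auto simp: DPR_apply)
    then show False
      using foldl_KR_step(3)[OF first_two_factors(3,5) *(1) x(1)] assms by auto
  qed
  then show ?thesis using odd_f_P_cases(1)[OF *(2,3) Q] *(4) by simp
qed

lemma odd_f_F_None_primed:
  assumes "T2 (1, k) = Some (Primed 2)" "1 < k"
  shows "odd_f_F Q n m w (F1 # F2 # As) = None"
proof -
  obtain P T where *: "foldl KR_step (P2, T2) (enumerate 3 As) = (P, T)" "primed_tableau m P (DPR T)" "decomp_tab n P"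
    "odd_f_F Q n m w (F1 # F2 # As) = map_option (\<lambda>T'. inv_into (signed_unimodal_facts n m w) KR (P, T'))
       (map_option (PR (primed_diag T)) (odd_f_P Q m (DPR T)))"
    using odd_f_F_eq by metis
  have "(1, k) \<in> row_boxes 1 P2" using assms(1) first_two_factors(4) by blast
  then have "DPR T (1, k) = Some (Primed 2)"
    using foldl_KR_step(2)[OF first_two_factors(3,5) *(1)] assms by (simp add: DPR_apply)
  then show ?thesis using odd_f_P_cases(2)[OF *(2,3) Q] *(4) by simp
qed

text \<open>Reduces the nonzero cases to two factors: later labels have value at least
  \<open>3\<close> and do not disturb the pattern, and injectivity of \<open>KR\<close> identifies
  the exhibited factorization. A \<open>1'\<close> on the diagonal regains its prime and becomes
  \<open>2'\<close>.\<close>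

lemma odd_f_F_Some:
  assumes ones: "1 \<le> k" "\<And>j. 1 \<le> j \<Longrightarrow> j \<le> k \<Longrightarrow> DPR T2 (1, j) = Some (Plain 1)"
    "\<And>j y. k < j \<Longrightarrow> T2 (1, j) = Some y \<Longrightarrow> Primed 2 < y"
    and G: "KR [G1, G2] = (P2, T2((1, k) \<mapsto> (if k = 1 \<and> 1 \<in> primed_diag T2 then Primed 2 else twin k)))"
    "G1 # G2 # As \<in> signed_unimodal_facts n m w"
  shows "odd_f_F Q n m w (F1 # F2 # As) = Some (G1 # G2 # As)"
proof -
  let ?U = "signed_unimodal_facts n m w"
  obtain P T where *: "foldl KR_step (P2, T2) (enumerate 3 As) = (P, T)" "primed_tableau m P (DPR T)" "decomp_tab n P"
    "odd_f_F Q n m w (F1 # F2 # As) = map_option (\<lambda>T'. inv_into ?U KR (P, T'))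
       (map_option (PR (primed_diag T)) (odd_f_P Q m (DPR T)))"
    using odd_f_F_eq by metis
  note fold = foldl_KR_step[OF first_two_factors(3,5) *(1)]
  have box: "(1, j) \<in> row_boxes 1 P2" if "1 \<le> j" "j \<le> k" for j
  proof -
    have "(1, j) \<in> dom (DPR T2)" using ones(2)[OF that] by blast
    then show ?thesis using first_two_factors(4) by (simp add: dom_DPR)
  qed
  have same: "DPR T (1, j) = DPR T2 (1, j)" if "1 \<le> j" "j \<le> k" for j
    unfolding DPR_apply fold(2)[OF box[OF that]] by (cases "1 = j") (use fold(2)[OF box[OF that]] in auto)
  have "head_ones k (DPR T)"
    unfolding head_ones_def
  proof (intro conjI allI impI; elim conjE)
    fix j assume "1 \<le> j" "j \<le> k"
    then show "DPR T (1, j) = Some (Plain 1)" using same ones(2) by simp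
  next
    fix j y assume j: "k < j" "DPR T (1, j) = Some y"
    then have "T (1, j) = Some y" using ones(1) by (simp add: DPR_apply)
    then have "T2 (1, j) = Some y \<or> 3 \<le> val y" by (rule fold(3))
    then show "Primed 2 < y"
      using ones(3)[OF j(1)] by (auto simp: less_letter_def)
  qed
  then have f: "odd_f_P Q m (DPR T) = Some ((DPR T)((1, k) \<mapsto> twin k))"
    using odd_f_P_cases(3)[OF *(2,3) Q ones(1)] by blast
  have "T (1, 1) = T2 (1, 1)" using fold(2)[OF box] ones(1) by simp
  then have diag: "1 \<in> primed_diag T \<longleftrightarrow> 1 \<in> primed_diag T2" by (simp add: primed_diag_def)
  have "PR (primed_diag T) ((DPR T)((1, k) \<mapsto> twin k)) =
      T((1, k) \<mapsto> (if k = 1 \<and> 1 \<in> primed_diag T2 then Primed 2 else twin k))"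
    unfolding PR_DPR_update using diag by (auto simp: twin_def)
  moreover have "KR (G1 # G2 # As) = (P, T((1, k) \<mapsto> (if k = 1 \<and> 1 \<in> primed_diag T2 then Primed 2 else twin k)))"
    using KR_Cons_Cons[of G1 G2 As] G(1) fold(1)[OF box[of k]] ones(1) by simp
  moreover have "inj_on KR ?U"
    using KR_inj by (auto simp: inj_on_def signed_unimodal_facts_iff)
  ultimately show ?thesis
    using *(4) f G(2) inv_into_f_f[of KR ?U "G1 # G2 # As"] by simp
qed

end

lemma row_labels_apply:
  "row_labels i s a b T (r, c) = (if r = 1 \<and> a \<le> c \<and> c < b then Some (if c = a \<and> s = SMinus then Primed i else Plain i) else T (r, c))"
  by (simp add: row_labels_def)

lemma turns_at_Cons_down:
  assumes "turns_at k (y # ys)" "down_step x y"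
  shows "turns_at (Suc k) (x # y # ys)"
  using assms sorted_wrt2[OF transp_steps(1), of x y "take k ys"] by (simp add: turns_at_def)

lemma butlast_last_append: "a \<noteq> [] \<Longrightarrow> butlast a @ last a # r = a @ r"
  by (cases a rule: rev_cases) auto

lemma second_row_box:
  assumes "\<not> unimodal (a @ [x])" "kr_insert_word (x # v) [a] = (P, bxs)"
  shows "\<exists>bxs'. bxs = (2, 2) # bxs'"
  using assms by (auto simp: numeral_2_eq_2 split: prod.splits)

theorem theorem4p18:
  fixes n m :: nat and w :: "int \<Rightarrow> int" and Q :: "nat list \<Rightarrow> box \<rightharpoonup> nat"
    and s1 s2 :: sign and a1 a2 :: "nat list" and As :: factorization
  assumes "w \<in> signed_perms n" and "m \<ge> 2"
    and "\<And>lam. strict_partition lam \<Longrightarrow> standard_shifted_tableau lam (Q lam)"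
    and "(s1, a1) # (s2, a2) # As \<in> signed_unimodal_facts n m w"
  shows "(\<forall>B. odd_f_F Q n m w ((s1, a1) # (s2, a2) # As) = Some B \<longrightarrow>
            (\<exists>F1 F2. B = F1 # F2 # As)) \<and>
         (\<not> unimodal (a1 @ a2) \<longrightarrow>
            odd_f_F Q n m w ((s1, a1) # (s2, a2) # As) =
              (if unimodal (last a1 # a2)
               then Some ((s1, butlast a1) # (s2, last a1 # a2) # As)
               else None)) \<and>
         (unimodal (a1 @ a2) \<longrightarrow>
            odd_f_F Q n m w ((s1, a1) # (s2, a2) # As) =
              (if a2 \<noteq> [] \<and> s2 = SMinus then None
               else if a1 = [] then None
               else if length a1 = 1
               then Some ((SZero, butlast a1) # (s1, last a1 # a2) # As)
               else Some ((s1, butlast a1) # (SMinus, last a1 # a2) # As)))"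
proof -
  let ?A = "(s1, a1) # (s2, a2) # As"
  let ?f = "odd_f_F Q n m w ?A"
  define T1 where "T1 = row_labels 1 s1 1 (Suc (length a1)) Map.empty"
  define k where "k = length a1"
  note facts = assms(4)
  have uni: "unimodal a1" "unimodal a2" "s1 = SZero \<longleftrightarrow> a1 = []" "s2 = SZero \<longleftrightarrow> a2 = []"
    using facts by (auto simp: signed_unimodal_facts_iff signed_factors_def)
  have red: "red n (a1 @ a2)"
    using facts red_appendD1[of n "a1 @ a2" "concat (map snd As)"] by (simp add: signed_unimodal_facts_iff)
  have KR1: "KR_step ([], Map.empty) (1, s1, a1) = (if a1 = [] then [] else [a1], T1)"
    using KR_step_row_Nil[OF uni(1)] by (simp add: T1_def)
  have T1: "T1 (r, c) = (if r = 1 \<and> 1 \<le> c \<and> c \<le> k then Some (if c = 1 \<and> s1 = SMinus then Primed 1 else Plain 1) else None)" for r c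
    by (auto simp: T1_def row_labels_apply k_def)
  have DPR1: "DPR T1 (1, j) = Some (Plain 1)" if "1 \<le> j" "j \<le> k" for j
    using that by (auto simp: DPR_apply T1)
  have moved: "(t1, butlast a1) # (t2, last a1 # a2) # As \<in> signed_unimodal_facts n m w"
    if "a1 \<noteq> []" "unimodal (last a1 # a2)" "t1 = SZero \<longleftrightarrow> butlast a1 = []" "t2 \<noteq> SZero" for t1 t2
  proof -
    have "unimodal (butlast a1)"
      using uni(1) that(1) unimodal_append_left[of "butlast a1" "[last a1]"] by simp
    have eq: "concat (map snd ((t1, butlast a1) # (t2, last a1 # a2) # As)) =
        concat (map snd ((s1, a1) # (s2, a2) # As))"
      using butlast_last_append[OF that(1)] by simp
    show ?thesis
      using facts that(2-4) \<open>unimodal (butlast a1)\<close>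
      unfolding signed_unimodal_facts_iff signed_factors_def eq by simp
  qed
  have nonunimodal: "?f = (if unimodal (last a1 # a2) then Some ((s1, butlast a1) # (s2, last a1 # a2) # As) else None)"
    if not_uni: "\<not> unimodal (a1 @ a2)"
  proof -
    have ne: "a1 \<noteq> []" "a2 \<noteq> []" using not_uni uni(1,2) by auto
    obtain x v where a2: "a2 = x # v" using ne(2) by (cases a2) auto
    obtain P2 bxs where ins: "kr_insert_word a2 [a1] = (P2, bxs)" by fastforce
    define T2 where "T2 = T1(bxs [\<mapsto>] rec_labels 2 s2 bxs)"
    have KR2: "KR [(s1, a1), (s2, a2)] = (P2, T2)"
      unfolding KR_pair KR1 using ne(1) ins by (simp add: KR_step_def T2_def)
    have tab1: "decomp_tab n [a1]"
      using uni(1) ne(1) red_appendD1[OF red] by (simp add: decomp_tab_def)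
    have red1: "red n (concat (rev [a1]) @ a2)" using red by simp
    obtain t where t: "turns_at t bxs"
      using kr_insert_word_turns[OF ins tab1 red1 uni(2) ne(2)] by blast
    note sh = kr_insert_word_shape[OF ins tab1 red1]
    have box1: "(1, c) \<in> row_boxes 1 [a1] \<longleftrightarrow> 1 \<le> c \<and> c \<le> k" for c
      by (auto simp: k_def)
    have label: "T2 (bxs ! j) = Some (if j < t \<or> j = t \<and> s2 = SMinus then Primed 2 else Plain 2)" if "j < length bxs" for j
      using map_upds_nth[of bxs "rec_labels 2 s2 bxs" j T1] rec_labels_nth[OF t that, of 2 s2] sh that
      by (simp add: T2_def)
    have old: "T2 z = T1 z" if "z \<notin> set bxs" for z using that by (simp add: T2_def)
    have neq: "last a1 \<noteq> x"
      using red_distinct_adj[of n "butlast a1" "last a1" x v] red a2 butlast_last_append[OF ne(1)] by simp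
    show ?thesis
    proof (cases "unimodal (last a1 # a2)")
      case True
      \<comment> \<open>Otherwise \<open>a1 @ [x]\<close> and \<open>last a1 # a2\<close> are both
        unimodal and overlap in the step from \<open>last a1\<close> to \<open>x\<close>, which
        makes \<open>a1 @ a2\<close> unimodal.\<close>
      have not_app: "\<not> unimodal (a1 @ [x])"
      proof
        assume "unimodal (a1 @ [x])"
        then have "unimodal (a1 @ x # v)"
          using True neq ne(1) unfolding unimodal_append_Cons a2 by (auto simp: unimodal_Cons)
        then show False using not_uni a2 by simp
      qed
      then obtain bxs' where bxs: "bxs = (2, 2) # bxs'"
        using second_row_box ins a2 by blast
      have "2 \<le> k"
      proof (rule ccontr)
        assume "\<not> 2 \<le> k"
        then have "length a1 = 1" using ne(1) unfolding k_def by (simp add: not_le less_2_cases_iff)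
        then have "a1 = [last a1]" by (auto simp: length_Suc_conv)
        then show False using True not_uni by (metis append_Cons append_Nil)
      qed
      have bl: "butlast a1 \<noteq> []" "length (butlast a1) = k - 1"
        unfolding length_0_conv[symmetric] using \<open>2 \<le> k\<close> by (simp_all add: k_def del: length_0_conv)
      have app: "butlast a1 @ [last a1] = a1" using ne(1) by simp
      \<comment> \<open>The moved letter puts the box \<open>(1, k)\<close> in front of
        \<open>(2, 2)\<close>. This is a down step, so the turn is delayed by one and the new box
        gets \<open>2'\<close> whatever the sign.\<close>
      have t': "turns_at (Suc t) ((1, k) # bxs)"
        using turns_at_Cons_down[of t "(2, 2)" bxs' "(1, k)"] t bxs \<open>2 \<le> k\<close> by (simp add: down_step_def)
      have lab': "rec_labels 2 s2 ((1, k) # bxs) = Primed 2 # rec_labels 2 s2 bxs"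
      proof (rule nth_equalityI)
        fix j assume "j < length (rec_labels 2 s2 ((1, k) # bxs))"
        then show "rec_labels 2 s2 ((1, k) # bxs) ! j = (Primed 2 # rec_labels 2 s2 bxs) ! j"
          using rec_labels_nth[OF t', of j 2 s2] rec_labels_nth[OF t, of "j - 1" 2 s2] by (cases j) auto
      qed simp
      have ins': "kr_insert_word (last a1 # a2) [butlast a1] = (P2, (1, k) # bxs)"
        using app uni(1) ins bl \<open>2 \<le> k\<close> by simp
      have T1': "(row_labels 1 s1 1 (Suc (length (butlast a1))) Map.empty)((1, k) \<mapsto> Primed 2) = T1((1, k) \<mapsto> Primed 2)"
        using bl(2) \<open>2 \<le> k\<close> by (auto simp: fun_eq_iff T1 row_labels_apply)
      have "(1, k) \<notin> set bxs" using sh box1 \<open>2 \<le> k\<close> by fastforce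
      have "unimodal (butlast a1)" using unimodal_append_left[of "butlast a1" "[last a1]"] app uni(1) by simp
      then have KR': "KR [(s1, butlast a1), (s2, last a1 # a2)] = (P2, T2((1, k) \<mapsto> Primed 2))"
        unfolding KR_pair using KR_step_row_Nil[of "butlast a1" Map.empty 1 s1] bl(1) ins' T1' lab' \<open>(1, k) \<notin> set bxs\<close>
        by (simp add: KR_step_def T2_def map_upds_twist)
      have inT1: "T2 (1, j) = T1 (1, j)" if "j \<le> k" for j
      proof -
        have "(1, j) \<notin> set bxs" if "1 \<le> j" using sh box1 \<open>j \<le> k\<close> that by fastforce
        moreover have "(1, j) \<notin> set bxs" if "\<not> 1 \<le> j"
        proof -
          have "shifted_shape (row_boxes 1 [a1] \<union> set (take (length bxs) bxs))" using sh by blast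
          then show ?thesis using shifted_shape_pos[of _ 1 j] that by auto
        qed
        ultimately show ?thesis using old by blast
      qed
      have "?f = Some ((s1, butlast a1) # (s2, last a1 # a2) # As)"
      proof (rule odd_f_F_Some[OF assms(3) facts KR2])
        show "1 \<le> k" using \<open>2 \<le> k\<close> by simp
        show "DPR T2 (1, j) = Some (Plain 1)" if "1 \<le> j" "j \<le> k" for j
          using DPR1[OF that] by (simp only: DPR_apply inT1[OF that(2)])
        show "Primed 2 < y" if "k < j" "T2 (1, j) = Some y" for j y
        proof -
          have "T1 (1, j) = None" using that(1) by (simp add: T1)
          then have "(1, j) \<in> set bxs" using old that(2) by fastforce
          then obtain p where p: "p < length bxs" "bxs ! p = (1, j)" by (auto simp: in_set_conv_nth)
          have "p \<noteq> 0" using p(2) bxs by (cases p) auto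
          \<comment> \<open>The boxes start in row \<open>2\<close>, so row \<open>1\<close> is
            reached again only after the turn, where labels are plain.\<close>
          have "\<not> p \<le> t"
            using turns_at_down[OF t, of 0 p] \<open>p \<noteq> 0\<close> p(2) bxs by (auto simp: down_step_def)
          then show ?thesis using label[OF p(1)] p(2) that(2) by (auto simp: Plain_less)
        qed
        show "KR [(s1, butlast a1), (s2, last a1 # a2)] = (P2, T2((1, k) \<mapsto> (if k = 1 \<and> 1 \<in> primed_diag T2 then Primed 2 else twin k)))"
          using KR' \<open>2 \<le> k\<close> by (simp add: twin_def)
        show "(s1, butlast a1) # (s2, last a1 # a2) # As \<in> signed_unimodal_facts n m w"
          using moved ne(1) True uni(3,4) ne(2) bl(1) by simp
      qed
      then show ?thesis using True by simp
    next
      case False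
      \<comment> \<open>Here \<open>a2\<close> starts with \<open>x > last a1\<close> and then falls
        to \<open>y\<close>: \<open>x\<close> extends the first row, \<open>y\<close> causes the box
        \<open>(2, 2)\<close>, and the box of \<open>x\<close>, lying before the turn, gets
        \<open>2'\<close>.\<close>
      have "last a1 < x"
        using False uni(2) neq a2 by (auto simp: unimodal_Cons[of "last a1"])
      then have app: "unimodal (a1 @ [x])" using uni(1) by (simp add: unimodal_snoc)
      have "\<not> inc a2" using False \<open>last a1 < x\<close> a2 by (auto simp: unimodal_Cons[of "last a1"])
      then obtain y v' where v: "v = y # v'" "y < x"
        using uni(2) a2 by (cases v) (auto simp: unimodal_Cons inc_Cons)
      have "\<not> unimodal ((a1 @ [x]) @ [y])"
        using \<open>last a1 < x\<close> v(2) ne(1) unfolding unimodal_snoc[of "a1 @ [x]"] dcr_snoc by auto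
      then obtain bxs' where bxs: "bxs = (1, Suc k) # (2, 2) # bxs'"
        using second_row_box[of "a1 @ [x]" y v'] ins app a2 v(1)
        by (auto simp: k_def split: prod.splits)
      have "t \<noteq> 0"
        using turns_at_right[OF t, of 0 1] bxs by (auto simp: right_step_def)
      then have "T2 (1, Suc k) = Some (Primed 2)" using label[of 0] bxs by simp
      moreover have "1 < Suc k" using ne(1) by (simp add: k_def)
      ultimately have "?f = None" using odd_f_F_None_primed[OF assms(3) facts KR2] by blast
      then show ?thesis using False by simp
    qed
  qed
  have unim: "?f = (if a2 \<noteq> [] \<and> s2 = SMinus then None
               else if a1 = [] then None
               else if length a1 = 1
               then Some ((SZero, butlast a1) # (s1, last a1 # a2) # As)
               else Some ((s1, butlast a1) # (SMinus, last a1 # a2) # As))"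
    if u: "unimodal (a1 @ a2)"
  proof (cases "a1 = []")
    case True
    have KR2: "KR [(s1, a1), (s2, a2)] = (if a2 = [] then [] else [a2], row_labels 2 s2 1 (Suc (length a2)) T1)"
      unfolding KR_pair KR1 using True KR_step_row_Nil[OF uni(2)] by simp
    \<comment> \<open>With an empty first factor no box of the first two factors has value
      \<open>1\<close>.\<close>
    have "?f = None"
      by (rule odd_f_F_None_no_one[OF assms(3) facts KR2])
        (use True in \<open>auto simp: row_labels_apply T1 k_def split: if_splits\<close>)
    then show ?thesis using True by simp
  next
    case False
    define T2 where "T2 = row_labels 2 s2 (Suc k) (Suc (k + length a2)) T1"
    have KR2: "KR [(s1, a1), (s2, a2)] = ([a1 @ a2], T2)"
      unfolding KR_pair KR1 using False KR_step_row[OF False u] by (simp add: T2_def k_def)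
    have T2: "T2 (r, c) = (if r = 1 \<and> k < c \<and> c \<le> k + length a2 then Some (if c = Suc k \<and> s2 = SMinus then Primed 2 else Plain 2) else T1 (r, c))" for r c
      by (auto simp: T2_def row_labels_apply)
    have "1 \<le> k" using False by (cases a1) (auto simp: k_def)
    show ?thesis
    proof (cases "a2 \<noteq> [] \<and> s2 = SMinus")
      case True
      \<comment> \<open>The second factor turns at its first box \<open>(1, k + 1)\<close>, so a
        minus sign puts \<open>2'\<close> there.\<close>
      then have "T2 (1, Suc k) = Some (Primed 2)" by (cases a2) (auto simp: T2)
      then have "?f = None"
        using odd_f_F_None_primed[OF assms(3) facts KR2, of "Suc k"] \<open>1 \<le> k\<close> by simp
      then show ?thesis using True by simp
    next
      case plus: False
      have big: "Primed 2 < y" if "k < j" "T2 (1, j) = Some y" for j y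
        using that plus by (auto simp: T2 T1 Plain_less split: if_splits)
      have ones: "DPR T2 (1, j) = Some (Plain 1)" if "1 \<le> j" "j \<le> k" for j
      proof -
        have eq: "T2 (1, j) = T1 (1, j)" using that by (simp add: T2)
        show ?thesis using DPR1[OF that] by (simp only: DPR_apply eq)
      qed
      have app: "butlast a1 @ last a1 # a2 = a1 @ a2"
        by (rule butlast_last_append[OF False])
      have last: "unimodal (last a1 # a2)"
        using unimodal_append_right[of "butlast a1" "last a1 # a2"] app u by simp
      have bl: "unimodal (butlast a1)"
        using unimodal_append_left[of "butlast a1" "last a1 # a2"] app u by simp
      have "s1 \<noteq> SZero" using False uni(3) by simp
      show ?thesis
      proof (cases "k = 1")
        case True
        have b0: "butlast a1 = []"
          unfolding length_0_conv[symmetric] using True by (simp add: k_def del: length_0_conv)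
        then have a1: "last a1 # a2 = a1 @ a2" using app by simp
        \<comment> \<open>The only letter of \<open>a1\<close> sits on the diagonal, and its sign is
          the prime at \<open>(1, 1)\<close>. After the move this box starts the second factor,
          which therefore takes over \<open>s1\<close>.\<close>
        have diag: "1 \<in> primed_diag T2 \<longleftrightarrow> s1 = SMinus"
          using True by (auto simp: primed_diag_def T2 T1)
        have eq: "row_labels 2 s1 1 (Suc (length (a1 @ a2))) (row_labels 1 SZero 1 (Suc 0) Map.empty)
            = T2((1, k) \<mapsto> (if k = 1 \<and> 1 \<in> primed_diag T2 then Primed 2 else twin k))"
          using True plus k_def unfolding diag by (auto simp: fun_eq_iff row_labels_apply T2 T1 twin_def)
        have KR': "KR [(SZero, butlast a1), (s1, last a1 # a2)] =
            ([a1 @ a2], T2((1, k) \<mapsto> (if k = 1 \<and> 1 \<in> primed_diag T2 then Primed 2 else twin k)))"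
          unfolding KR_pair a1 b0 eq[symmetric] using KR_step_row_Nil[of "[]" Map.empty 1 SZero] KR_step_row_Nil[OF u] False
          by simp
        have "?f = Some ((SZero, butlast a1) # (s1, last a1 # a2) # As)"
        proof (rule odd_f_F_Some[OF assms(3) facts KR2 \<open>1 \<le> k\<close> _ _ KR'])
          show "(SZero, butlast a1) # (s1, last a1 # a2) # As \<in> signed_unimodal_facts n m w"
            using moved[of SZero s1] False last b0 \<open>s1 \<noteq> SZero\<close> by simp
        qed (use ones big in blast)+
        then show ?thesis using plus False True by (simp add: k_def)
      next
        case k: False
        then have "2 \<le> k" using \<open>1 \<le> k\<close> by simp
        have b0: "butlast a1 \<noteq> []" "length (butlast a1) = k - 1"
          unfolding length_0_conv[symmetric] using \<open>2 \<le> k\<close> by (simp_all add: k_def del: length_0_conv)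
        \<comment> \<open>Box \<open>k\<close> is now off the diagonal and becomes the first box of
          the second factor; the label \<open>2'\<close> there is what a minus sign
          produces.\<close>
        have eq: "row_labels 2 SMinus (Suc (k - 1)) (Suc (k - 1 + length (last a1 # a2))) (row_labels 1 s1 1 (Suc (k - 1)) Map.empty)
            = T2((1, k) \<mapsto> (if k = 1 \<and> 1 \<in> primed_diag T2 then Primed 2 else twin k))"
          using \<open>2 \<le> k\<close> plus by (auto simp: fun_eq_iff row_labels_apply T2 T1 twin_def)
        have KR': "KR [(s1, butlast a1), (SMinus, last a1 # a2)] =
            ([a1 @ a2], T2((1, k) \<mapsto> (if k = 1 \<and> 1 \<in> primed_diag T2 then Primed 2 else twin k)))"
          unfolding KR_pair eq[symmetric] using KR_step_row_Nil[OF bl, of Map.empty 1 s1] KR_step_row[OF b0(1), of "last a1 # a2"] b0 u app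
          by simp
        have "?f = Some ((s1, butlast a1) # (SMinus, last a1 # a2) # As)"
        proof (rule odd_f_F_Some[OF assms(3) facts KR2 \<open>1 \<le> k\<close> _ _ KR'])
          show "(s1, butlast a1) # (SMinus, last a1 # a2) # As \<in> signed_unimodal_facts n m w"
            using moved[of s1 SMinus] False last b0 \<open>s1 \<noteq> SZero\<close> by simp
        qed (use ones big in blast)+
        then show ?thesis using plus False k by (simp add: k_def)
      qed
    qed
  qed
  have "\<exists>F1 F2. B = F1 # F2 # As" if "?f = Some B" for B
    using that nonunimodal unim by (cases "unimodal (a1 @ a2)") (auto split: if_splits)
  then show ?thesis using nonunimodal unim by blast
qed

end
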